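(* Let $\mathscr F$ be a foliation by Riemann surfaces in a neighborhood of $0\in\mathbb C^2$, and assume that $0$ is a hyperbolic singularity of $\mathscr F$. Let $\varepsilon:[0,1]\to\mathbb R^+=[0,\infty)$ be a continuous function such that $\varepsilon(0)=0$. Then there exist $\delta_0\in(0,1]$ and a positive $dd^c$-closed $(1,1)$-current $T$, defined on a neighborhood of $0\in\mathbb C^2$ containing $\delta_0\mathbb D^2$, such that $T$ is directed by $\mathscr F$, $T$ has no mass on the separatrices of $\mathscr F$ at $0$, and $$\|T\|_{\delta\mathbb D^2}\ \geq\ \varepsilon(\delta)\,\delta^2\qquad\text{for all } 0<\delta<\delta_0 .$$
   Context: Notation: $\delta\mathbb D^2=\{(z_1,z_2)\in\mathbb C^2: |z_1|<\delta,\ |z_2|<\delta\}$; $d^c=\frac{i}{2\pi}(\partial-\overline\partial)$ up to the usual sign convention, normalized so that $dd^c=\frac{i}{\pi}\partial\overline\partial$; the mass of a positive $(1,1)$-current $T$ on a Borel set $B$ is $\|T\|_B=\int_B T\wedge dd^c\|z\|^2$, where $\|z\|^2=|z_1|^2+|z_2|^2$. $T$ is $dd^c$-closed if $\langle T,dd^c\phi\rangle=0$ for every smooth compactly supported function $\phi$ on the domain of $T$. Foliation: $\mathscr F$ is the (singular) holomorphic foliation defined by a holomorphic vector field $F$ on a neighborhood of $0\in\mathbb C^2$ with an isolated zero at $0$; its leaves are the maximal connected Riemann surfaces, immersed in the complement of the zero set of $F$, tangent to $F$. Hyperbolic singularity: $0$ is a hyperbolic singularity of $\mathscr F$ if $F$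 and local holomorphic coordinates $(z_1,z_2)$ centered at $0$ can be chosen so that $F=\eta z_1\frac{\partial}{\partial z_1}+z_2\frac{\partial}{\partial z_2}+\text{higher order terms}$, with $\eta=a+ib$, $a,b\in\mathbb R$, $b\neq0$. By the Poincaré–Dulac theorem, there are then local holomorphic coordinates centered at $0$ in which $F=\eta z_1\frac{\partial}{\partial z_1}+z_2\frac{\partial}{\partial z_2}$. The separatrices of $\mathscr F$ at $0$ are the two curves given by $\{z_1=0\}$ and $\{z_2=0\}$ in these linearizing coordinates. Directed current: a positive $dd^c$-closed $(1,1)$-current $T$ is directed by $\mathscr F$ if $T\wedge\Omega=0$ for a holomorphic $1$-form $\Omega$ defining $\mathscr F$ (i.e. a holomorphic $1$-form with $\Omega(F)=0$, nonvanishing away from $0$). Equivalently, away from the singularity, in each flow box $T=\int h_\alpha[P_\alpha]\,d\mu(\alpha)$, where $P_\alpha$ are the plaques, $h_\alpha$ are positive harmonic functions on the plaques and $\mu$ is a positive measure on a transversal. "No mass on the separatrices" means that the mass measure $T\wedge dd^c\|z\|^2$ of $T$ gives zero mass to the separatrices. *)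

theory Defs
  imports "HOL-Analysis.Analysis" "HOL-Library.Landau_Symbols"
begin

text \<open>Smooth functions. \<open>nderiv [v\<^sub>1, \<dots>, v\<^sub>n] f\<close> is the iterated directional derivative
  \<open>\<partial>\<^bsub>v\<^sub>1\<^esub> \<dots> \<partial>\<^bsub>v\<^sub>n\<^esub> f\<close>; derivatives are real throughout, so complex space counts as a real vector
  space.\<close>

primrec nderiv ::
  "'a::real_normed_vector list \<Rightarrow> ('a \<Rightarrow> 'b::real_normed_vector) \<Rightarrow> 'a \<Rightarrow> 'b" where
  "nderiv [] f = f"
| "nderiv (v # vs) f = (\<lambda>x. frechet_derivative (nderiv vs f) (at x) v)"

definition smooth_on ::
  "'a::real_normed_vector set \<Rightarrow> ('a \<Rightarrow> 'b::real_normed_vector) \<Rightarrow> bool" where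
  "smooth_on U f \<longleftrightarrow> (\<forall>vs. nderiv vs f differentiable_on U)"

text \<open>Test objects on an open set \<open>U\<close>, extended by zero to the whole space.\<close>

definition test_on ::
  "'a::real_normed_vector set \<Rightarrow> ('a \<Rightarrow> 'b::real_normed_vector) \<Rightarrow> bool" where
  "test_on U f \<longleftrightarrow> smooth_on UNIV f \<and> (\<exists>K. compact K \<and> K \<subseteq> U \<and> (\<forall>z. z \<notin> K \<longrightarrow> f z = 0))"

definition holomorphic_map_on :: "(complex^'m) set \<Rightarrow> (complex^'m \<Rightarrow> complex^'n) \<Rightarrow> bool" where
  "holomorphic_map_on U f \<longleftrightarrow>
     (\<forall>z\<in>U. \<exists>D. (f has_derivative D) (at z) \<and> (\<forall>c v. D (c *s v) = c *s D v))"

text \<open>A 1-form of type (1,0), \<open>\<alpha>\<^sub>1 dz\<^sub>1 + \<alpha>\<^sub>2 dz\<^sub>2\<close>, and one of type (0,1),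
  \<open>\<beta>\<^sub>1 d\<zeta>\<^sub>1 + \<beta>\<^sub>2 d\<zeta>\<^sub>2\<close> with \<open>\<zeta>\<^sub>k\<close> the conjugate of \<open>z\<^sub>k\<close>, are given by their coefficient vectors;
  a (1,1)-form is given by the matrix \<open>A\<close> of its coefficients in
  \<open>\<Sum>\<^sub>j\<^sub>k A\<^sub>j\<^sub>k dz\<^sub>j \<and> d\<zeta>\<^sub>k\<close>.\<close>

type_synonym C2 = "complex^2"
type_synonym form1 = "C2 \<Rightarrow> complex^2"
type_synonym form11 = "C2 \<Rightarrow> complex^2^2"

definition form_scale :: "(C2 \<Rightarrow> complex) \<Rightarrow> form11 \<Rightarrow> form11" where
  "form_scale f A = (\<lambda>z. \<chi> j k. f z * A z $ j $ k)"

definition wedge_10_01 :: "form1 \<Rightarrow> form1 \<Rightarrow> form11" where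
  "wedge_10_01 \<alpha> \<beta> = (\<lambda>z. \<chi> j k. \<alpha> z $ j * \<beta> z $ k)"

definition form_cnj :: "form1 \<Rightarrow> form1" where
  "form_cnj \<alpha> = (\<lambda>z. \<chi> j. cnj (\<alpha> z $ j))"

text \<open>The Wirtinger derivatives with respect to \<open>z\<^sub>j\<close> and to its conjugate.\<close>

definition d_z :: "2 \<Rightarrow> (C2 \<Rightarrow> complex) \<Rightarrow> C2 \<Rightarrow> complex" where
  "d_z j f = (\<lambda>z. (frechet_derivative f (at z) (axis j 1)
                    - \<i> * frechet_derivative f (at z) (axis j \<i>)) / 2)"

definition d_zbar :: "2 \<Rightarrow> (C2 \<Rightarrow> complex) \<Rightarrow> C2 \<Rightarrow> complex" where
  "d_zbar k f = (\<lambda>z. (frechet_derivative f (at z) (axis k 1)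
                       + \<i> * frechet_derivative f (at z) (axis k \<i>)) / 2)"

text \<open>Normalized so that \<open>dd\<^sup>c\<parallel>z\<parallel>\<^sup>2\<close> is \<open>i/\<pi>\<close> times \<open>\<Sum>\<^sub>j dz\<^sub>j \<and> d\<zeta>\<^sub>j\<close>.\<close>

definition ddc :: "(C2 \<Rightarrow> complex) \<Rightarrow> form11" where
  "ddc f = (\<lambda>z. \<chi> j k. \<i> / of_real pi * d_z j (d_zbar k f) z)"

text \<open>A (1,1)-current on \<open>U\<close> is a continuous linear functional on the test (1,1)-forms on \<open>U\<close>;
  the values of \<open>T\<close> on other forms are irrelevant. The last clause is continuity in the usual
  inductive limit topology on test forms.\<close>

definition current :: "C2 set \<Rightarrow> (form11 \<Rightarrow> complex) \<Rightarrow> bool" where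
  "current U T \<longleftrightarrow>
     (\<forall>\<phi> \<psi>. test_on U \<phi> \<longrightarrow> test_on U \<psi> \<longrightarrow> T (\<lambda>z. \<phi> z + \<psi> z) = T \<phi> + T \<psi>) \<and>
     (\<forall>c \<phi>. test_on U \<phi> \<longrightarrow> T (form_scale (\<lambda>_. c) \<phi>) = c * T \<phi>) \<and>
     (\<forall>K. compact K \<longrightarrow> K \<subseteq> U \<longrightarrow>
        (\<exists>C N. \<forall>\<phi> M. test_on U \<phi> \<longrightarrow> (\<forall>z. z \<notin> K \<longrightarrow> \<phi> z = 0) \<longrightarrow>
           (\<forall>vs z. set vs \<subseteq> Basis \<longrightarrow> length vs \<le> N \<longrightarrow> norm (nderiv vs \<phi> z) \<le> M) \<longrightarrow>
           norm (T \<phi>) \<le> C * M))"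

definition positive_current :: "C2 set \<Rightarrow> (form11 \<Rightarrow> complex) \<Rightarrow> bool" where
  "positive_current U T \<longleftrightarrow> current U T \<and>
     (\<forall>(f :: C2 \<Rightarrow> real) \<alpha>. test_on U f \<longrightarrow> (\<forall>z. 0 \<le> f z) \<longrightarrow> smooth_on U \<alpha> \<longrightarrow>
        T (form_scale (\<lambda>z. \<i> * of_real (f z)) (wedge_10_01 \<alpha> (form_cnj \<alpha>))) \<in> \<real>\<^sub>\<ge>\<^sub>0)"

definition ddc_closed :: "C2 set \<Rightarrow> (form11 \<Rightarrow> complex) \<Rightarrow> bool" where
  "ddc_closed U T \<longleftrightarrow> (\<forall>\<phi>. test_on U \<phi> \<longrightarrow> T (ddc \<phi>) = 0)"

text \<open>\<open>\<mu>\<close> is the measure \<open>T \<and> dd\<^sup>c\<parallel>z\<parallel>\<^sup>2\<close> on \<open>U\<close>, so that the mass of \<open>T\<close> on a Borel set \<open>B\<close> is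
  \<open>emeasure \<mu> B\<close>. For a positive current such a measure exists and is unique, by the Riesz
  representation theorem.\<close>

definition mass_measure :: "C2 set \<Rightarrow> (form11 \<Rightarrow> complex) \<Rightarrow> C2 measure \<Rightarrow> bool" where
  "mass_measure U T \<mu> \<longleftrightarrow>
     space \<mu> = U \<and> sets \<mu> = sets (restrict_space borel U) \<and>
     (\<forall>K. compact K \<longrightarrow> K \<subseteq> U \<longrightarrow> emeasure \<mu> K < \<infinity>) \<and>
     (\<forall>\<phi>. test_on U \<phi> \<longrightarrow>
        T (form_scale \<phi> (ddc (\<lambda>z. of_real ((norm z)\<^sup>2)))) = (\<integral>z. \<phi> z \<partial>\<mu>))"

definition polydisc :: "real \<Rightarrow> C2 set" where
  "polydisc \<delta> = {z. norm (z $ 1) < \<delta> \<and> norm (z $ 2) < \<delta>}"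

text \<open>A foliation near \<open>0\<close> with a singularity at \<open>0\<close> is given by a holomorphic vector field \<open>F\<close>,
  \<open>F\<^sub>1 \<partial>/\<partial>z\<^sub>1 + F\<^sub>2 \<partial>/\<partial>z\<^sub>2\<close>, on an open neighborhood \<open>V\<close> of \<open>0\<close>.\<close>

definition foliation_field :: "C2 set \<Rightarrow> (C2 \<Rightarrow> C2) \<Rightarrow> bool" where
  "foliation_field V F \<longleftrightarrow> open V \<and> 0 \<in> V \<and> holomorphic_map_on V F \<and> F 0 = 0 \<and>
     (\<forall>\<^sub>F z in at 0. F z \<noteq> 0)"

text \<open>\<open>G\<close> is another vector field which defines, on \<open>W\<close>, the same foliation as \<open>F\<close>.\<close>

definition same_foliation :: "C2 set \<Rightarrow> (C2 \<Rightarrow> C2) \<Rightarrow> (C2 \<Rightarrow> C2) \<Rightarrow> bool" where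
  "same_foliation W F G \<longleftrightarrow> holomorphic_map_on W G \<and> G 0 = 0 \<and>
     (\<forall>z\<in>W - {0}. F z \<noteq> 0 \<and> G z \<noteq> 0 \<and> F z $ 1 * G z $ 2 = F z $ 2 * G z $ 1)"

definition centered_coords :: "C2 set \<Rightarrow> (C2 \<Rightarrow> C2) \<Rightarrow> bool" where
  "centered_coords W \<Phi> \<longleftrightarrow> open W \<and> 0 \<in> W \<and> \<Phi> 0 = 0 \<and> inj_on \<Phi> W \<and> open (\<Phi> ` W) \<and>
     holomorphic_map_on W \<Phi> \<and> holomorphic_map_on (\<Phi> ` W) (inv_into W \<Phi>)"

text \<open>The components of the vector field \<open>G\<close>, at the point \<open>z\<close>, in the coordinates \<open>\<Phi>\<close>.\<close>

definition in_coords :: "(C2 \<Rightarrow> C2) \<Rightarrow> (C2 \<Rightarrow> C2) \<Rightarrow> C2 \<Rightarrow> C2" where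
  "in_coords \<Phi> G z = frechet_derivative \<Phi> (at z) (G z)"

definition linear_field :: "complex \<Rightarrow> C2 \<Rightarrow> C2" where
  "linear_field \<eta> w = vector [\<eta> * w $ 1, w $ 2]"

definition hyperbolic_singularity :: "C2 set \<Rightarrow> (C2 \<Rightarrow> C2) \<Rightarrow> bool" where
  "hyperbolic_singularity V F \<longleftrightarrow>
     (\<exists>W \<Phi> G \<eta>. W \<subseteq> V \<and> centered_coords W \<Phi> \<and> same_foliation W F G \<and> Im \<eta> \<noteq> 0 \<and>
        (\<lambda>z. norm (in_coords \<Phi> G z - linear_field \<eta> (\<Phi> z))) \<in> O[at 0](\<lambda>z. (norm (\<Phi> z))\<^sup>2))"

definition linearizing_coords :: "C2 set \<Rightarrow> (C2 \<Rightarrow> C2) \<Rightarrow> C2 set \<Rightarrow> (C2 \<Rightarrow> C2) \<Rightarrow> bool" where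
  "linearizing_coords V F W \<Phi> \<longleftrightarrow>
     W \<subseteq> V \<and> centered_coords W \<Phi> \<and>
     (\<exists>G \<eta>. same_foliation W F G \<and> Im \<eta> \<noteq> 0 \<and>
        (\<forall>z\<in>W. in_coords \<Phi> G z = linear_field \<eta> (\<Phi> z)))"

definition separatrices :: "C2 set \<Rightarrow> (C2 \<Rightarrow> C2) \<Rightarrow> C2 set" where
  "separatrices W \<Phi> = {z\<in>W. \<Phi> z $ 1 = 0} \<union> {z\<in>W. \<Phi> z $ 2 = 0}"

text \<open>Separatrices are only defined where linearizing coordinates are, so the domain \<open>U\<close> of \<open>T\<close>
  is required to lie in the domain \<open>W\<close> of the coordinates. The coordinate axes in \<open>W\<close> are
  invariant under the foliation, so whichever linearizing coordinates are chosen they contain the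
  germs of the separatrices at \<open>0\<close> together with all their continuations along leaves within \<open>U\<close>.\<close>

definition no_mass_on_separatrices ::
  "C2 set \<Rightarrow> (C2 \<Rightarrow> C2) \<Rightarrow> C2 set \<Rightarrow> C2 measure \<Rightarrow> bool" where
  "no_mass_on_separatrices V F U \<mu> \<longleftrightarrow>
     (\<exists>W \<Phi>. linearizing_coords V F W \<Phi> \<and> U \<subseteq> W \<and> separatrices W \<Phi> \<inter> U \<in> null_sets \<mu>)"

text \<open>\<open>T \<and> \<Omega> = 0\<close>, where \<open>T \<and> \<Omega>\<close> acts on test (0,1)-forms by \<open>\<beta> \<mapsto> T (\<Omega> \<and> \<beta>)\<close>.\<close>

definition directed_by :: "C2 set \<Rightarrow> (C2 \<Rightarrow> C2) \<Rightarrow> (form11 \<Rightarrow> complex) \<Rightarrow> bool" where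
  "directed_by U F T \<longleftrightarrow>
     (\<exists>\<Omega>. holomorphic_map_on U \<Omega> \<and> (\<forall>z\<in>U - {0}. \<Omega> z \<noteq> 0) \<and>
        (\<forall>z\<in>U. \<Omega> z $ 1 * F z $ 1 + \<Omega> z $ 2 * F z $ 2 = 0) \<and>
        (\<forall>\<beta>. test_on U \<beta> \<longrightarrow> T (wedge_10_01 \<Omega> \<beta>) = 0))"

end

theory Submission
  imports Defs "HOL-Complex_Analysis.Cauchy_Integral_Formula"
begin

text \<open>
  A hyperbolic singularity is linearizable, and in linearizing coordinates one of its leaves is
  \<open>t \<mapsto> (exp (\<eta> t), exp t)\<close>. The part of this leaf in the unit bidisc is the sector where \<open>Re t < 0\<close> and
  \<open>Re (\<eta> t) < 0\<close>; its angle is less than \<open>\<pi>\<close> because \<open>Im \<eta> \<noteq> 0\<close>. A positive harmonic function \<open>h\<close> on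
  the sector defines a current, namely \<open>h\<close> times integration over the leaf. It is directed by the foliation, and it
  does not charge the separatrices, because the leaf does not meet them.

  In terms of the distances \<open>x\<close> and \<open>y\<close> to the two edges of the sector, the area element of the leaf
  is comparable to \<open>exp (- 2 x) + exp (- 2 y)\<close>. So the mass of the current is comparable to the integral of \<open>h\<close> along
  the edges. The bidisc of radius \<open>\<delta>\<close> corresponds to the sector with its vertex moved inwards by
  about \<open>ln (1 / \<delta>)\<close>, where the area element is smaller by the factor \<open>\<delta>\<^sup>2\<close>. What has to be
  arranged is that the integral of \<open>h\<close> along the edges of the moved sector tends to \<open>0\<close> slowly with \<open>\<delta>\<close>.

  For this, let \<open>u = A + k t\<close>, where \<open>A\<close> is large and multiplication by \<open>k\<close> takes the sector into the right
  half plane. If \<open>p > 1\<close> is close to \<open>1\<close>, then \<open>Re (u powr (- p))\<close> is positive on the sector. The integral of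
  \<open>A powr (p - 1) * Re (u powr (- p))\<close> along the edges is finite because \<open>p > 1\<close>, it is bounded
  independently of \<open>A\<close>, and it stays above a positive constant until \<open>ln (1 / \<delta>)\<close> reaches \<open>A\<close>
  (\<open>positive_kernel\<close>, \<open>integrable_weight_edge_decay\<close>, \<open>mass_polydisc_ge\<close>). A sum of such functions with weights
  \<open>1 / 2 ^ n\<close> and with \<open>A n\<close> tending to infinity as fast as \<open>\<epsilon>\<close> requires has all the properties
  (\<open>harmonic_density\<close>, \<open>scales_for_modulus\<close>).

  The current has to be closed across the singular point too. There a test function \<open>\<phi>\<close>, pulled back to the
  sector, does not have compact support: it vanishes near the edges but tends to \<open>\<phi> 0\<close> deep inside.
  Integration by parts remains possible because the derivatives of the pulled back function decay away from the edges and
  those of \<open>u powr (- p)\<close> decay at infinity (\<open>integral_kernel_Levi_eq_0\<close>).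

  The linearization is Poincare's theorem. A complex change of the time scale gives both eigenvalues the real
  part \<open>-1\<close> (\<open>rotate_eigenvalues\<close>), so that the linear flow contracts by exactly \<open>exp (- t)\<close> in all directions. The
  conjugacy \<open>w \<mapsto> w + h w\<close> then solves a fixed point equation obtained by integrating along the linear flow, which is
  contracting on maps of order \<open>(norm w)\<^sup>2\<close> (\<open>nonlinear_homological_equation\<close>, \<open>Poincare_linearization\<close>). Holomorphy
  of the maps in this construction follows from Cauchy's estimates on complex lines
  (\<open>cdiff_on_integral\<close>).
\<close>

section \<open>Holomorphic functions of several variables\<close>

text \<open>Maps are treated one component at a time, because the one-variable theory is about complex-valued functions.\<close>

definition cdiff_on :: "(complex^'n) set \<Rightarrow> (complex^'n \<Rightarrow> complex) \<Rightarrow> bool" where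
  "cdiff_on U f \<longleftrightarrow>
     (\<forall>z\<in>U. \<exists>D. (f has_derivative D) (at z) \<and> (\<forall>c v. D (c *s v) = c * D v))"

lemma norm_vector_scalar_mult [simp]:
  fixes v :: "complex^'n"
  shows "norm (c *s v) = norm c * norm v"
  by (simp add: norm_vec_def L2_set_def norm_mult power_mult_distrib sum_distrib_left[symmetric]
      real_sqrt_mult)

lemma bounded_linear_vector_scalar_mult:
  fixes v :: "complex^'n"
  shows "bounded_linear (\<lambda>c. c *s v)"
  by (rule bounded_linear_intro[where K="norm v"])
     (auto simp: vec_eq_iff algebra_simps)

lemma cdiff_on_derivative:
  assumes "cdiff_on U f" "z \<in> U"
  shows "(f has_derivative frechet_derivative f (at z)) (at z)"
    and "frechet_derivative f (at z) (c *s v) = c * frechet_derivative f (at z) v"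
proof -
  obtain D where D: "(f has_derivative D) (at z)" "\<And>c v. D (c *s v) = c * D v"
    using assms unfolding cdiff_on_def by blast
  from frechet_derivative_at[OF D(1)] have "D = frechet_derivative f (at z)" .
  with D show "(f has_derivative frechet_derivative f (at z)) (at z)"
    "frechet_derivative f (at z) (c *s v) = c * frechet_derivative f (at z) v"
    by auto
qed

lemma cdiff_onI:
  assumes "\<And>z. z \<in> U \<Longrightarrow> (f has_derivative D z) (at z)"
    and "\<And>z c v. z \<in> U \<Longrightarrow> D z (c *s v) = c * D z v"
  shows "cdiff_on U f"
  using assms unfolding cdiff_on_def by blast

lemma cdiff_on_subset: "cdiff_on U f \<Longrightarrow> W \<subseteq> U \<Longrightarrow> cdiff_on W f"
  unfolding cdiff_on_def by blast

lemma cdiff_on_imp_continuous_on: "cdiff_on U f \<Longrightarrow> continuous_on U f"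
  by (meson cdiff_on_derivative(1) continuous_at_imp_continuous_on has_derivative_continuous)

lemma cdiff_on_slice:
  assumes "cdiff_on U f" "w + \<zeta> *s v \<in> U"
  shows "((\<lambda>\<zeta>. f (w + \<zeta> *s v)) has_field_derivative
           frechet_derivative f (at (w + \<zeta> *s v)) v) (at \<zeta>)"
proof -
  have "((\<lambda>\<zeta>. w + \<zeta> *s v) has_derivative (\<lambda>\<xi>. \<xi> *s v)) (at \<zeta>)"
    using bounded_linear_imp_has_derivative[OF bounded_linear_vector_scalar_mult[of v]]
    by (auto intro!: derivative_eq_intros)
  from has_derivative_compose[OF this cdiff_on_derivative(1)[OF assms]]
  have "((\<lambda>\<zeta>. f (w + \<zeta> *s v)) has_derivative
       (\<lambda>\<xi>. frechet_derivative f (at (w + \<zeta> *s v)) (\<xi> *s v))) (at \<zeta>)" .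
  then show ?thesis
    
    by (simp add: has_field_derivative_def cdiff_on_derivative(2)[OF assms]
        mult_commute_abs[of "frechet_derivative f _ _"])
qed

text \<open>On the complex line \<open>\<zeta> \<mapsto> w + \<zeta> v\<close> everything reduces to one variable, with \<open>r / norm v\<close> as the radius of the
  disc that the line maps into the ball.\<close>

lemma cdiff_on_slice_bounds:
  assumes "cdiff_on U f" "cball w r \<subseteq> U" "0 < r" and M: "\<And>z. z \<in> cball w r \<Longrightarrow> norm (f z) \<le> M"
    and v: "v \<noteq> 0" and \<xi>: "norm \<xi> + s \<le> r / norm v" and s: "0 < s"
  shows "norm ((deriv ^^ n) (\<lambda>\<zeta>. f (w + \<zeta> *s v)) \<xi>) \<le> fact n * M / s ^ n"
proof (rule Cauchy_inequality[OF _ _ s])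
  have in_ball: "w + \<zeta> *s v \<in> cball w r" if "\<zeta> \<in> cball \<xi> s" for \<zeta>
  proof -
    have "norm \<zeta> \<le> r / norm v"
      using that \<xi> norm_triangle_ineq2[of \<zeta> \<xi>] by (auto simp: dist_norm norm_minus_commute)
    then show ?thesis using v by (simp add: dist_norm field_simps)
  qed
  have d: "((\<lambda>\<zeta>. f (w + \<zeta> *s v)) has_field_derivative
           frechet_derivative f (at (w + \<zeta> *s v)) v) (at \<zeta>)" if "\<zeta> \<in> cball \<xi> s" for \<zeta>
    using in_ball[OF that] assms(2) by (intro cdiff_on_slice[OF assms(1)]) auto
  have "(\<lambda>\<zeta>. f (w + \<zeta> *s v)) holomorphic_on cball \<xi> s"
    unfolding holomorphic_on_def field_differentiable_def
    using d has_field_derivative_at_within by blast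
  then show "continuous_on (cball \<xi> s) (\<lambda>\<zeta>. f (w + \<zeta> *s v))"
    "(\<lambda>\<zeta>. f (w + \<zeta> *s v)) holomorphic_on ball \<xi> s"
    using holomorphic_on_imp_continuous_on holomorphic_on_subset ball_subset_cball by blast+
  show "norm (f (w + \<zeta> *s v)) \<le> M" if "norm (\<xi> - \<zeta>) = s" for \<zeta>
    using that by (intro M in_ball) (auto simp: dist_norm)
qed

lemma cdiff_on_Cauchy_estimate:
  assumes "cdiff_on U f" "cball w r \<subseteq> U" "0 < r" and M: "\<And>z. z \<in> cball w r \<Longrightarrow> norm (f z) \<le> M"
  shows "norm (frechet_derivative f (at w) v) \<le> M * norm v / r"
proof (cases "v = 0")
  case True
  have "w \<in> U" using assms by auto
  then show ?thesis
    using linear_0[OF has_derivative_linear[OF cdiff_on_derivative(1)[OF assms(1)]]] True by simp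
next
  case False
  have "((\<lambda>\<zeta>. f (w + \<zeta> *s v)) has_field_derivative
           frechet_derivative f (at (w + 0 *s v)) v) (at 0)"
    using assms by (intro cdiff_on_slice[OF assms(1)]) auto
  then have "deriv (\<lambda>\<zeta>. f (w + \<zeta> *s v)) 0 = frechet_derivative f (at w) v"
    by (simp add: DERIV_imp_deriv)
  then show ?thesis
    using cdiff_on_slice_bounds[OF assms False, of 0 "r / norm v" 1] False assms(3) by simp
qed

text \<open>The remainder of the first order Taylor expansion is controlled by the supremum of the function
  alone; this is what makes holomorphy survive integration with respect to a parameter.\<close>

lemma cdiff_on_Taylor_estimate:
  assumes "cdiff_on U f" "cball w r \<subseteq> U" "0 < r" and M: "\<And>z. z \<in> cball w r \<Longrightarrow> norm (f z) \<le> M"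
    and v: "norm v \<le> r / 2"
  shows "norm (f (w + v) - f w - frechet_derivative f (at w) v) \<le> 8 * M * (norm v)\<^sup>2 / r\<^sup>2"
proof (cases "v = 0")
  case True
  have "w \<in> U" using assms(2,3) by auto
  then show ?thesis
    using linear_0[OF has_derivative_linear[OF cdiff_on_derivative(1)[OF assms(1)]]] True by simp
next
  case False
  define g where "g = (\<lambda>\<zeta>. f (w + \<zeta> *s v))"
  define R where "R = r / norm v"
  have R: "R \<ge> 2" using v False assms(3) by (simp add: R_def field_simps)
  have d: "(g has_field_derivative frechet_derivative f (at (w + \<zeta> *s v)) v) (at \<zeta>)"
    if "\<zeta> \<in> ball 0 R" for \<zeta> unfolding g_def
  proof (rule cdiff_on_slice[OF assms(1)])
    have "w + \<zeta> *s v \<in> cball w r" using that False by (simp add: R_def dist_norm field_simps)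
    then show "w + \<zeta> *s v \<in> U" using assms(2) by blast
  qed
  have hol: "g holomorphic_on ball 0 R"
    unfolding holomorphic_on_def field_differentiable_def
    using d has_field_derivative_at_within by blast
  have hol': "deriv g holomorphic_on ball 0 R"
    by (rule holomorphic_deriv[OF hol]) auto
  have sub: "x \<in> ball 0 R" if "x \<in> cball 0 1" for x :: complex
    using that R by auto
  have "norm ((deriv ^^ 0) g 1 - (\<Sum>i\<le>1. (deriv ^^ i) g 0 * (1 - 0) ^ i / fact i))
      \<le> (8 * M * (norm v)\<^sup>2 / r\<^sup>2) * norm (1 - 0 :: complex) ^ Suc 1 / fact 1"
  proof (rule complex_Taylor[where S="cball 0 1" and f="\<lambda>i. (deriv ^^ i) g"])
    show "((deriv ^^ i) g has_field_derivative (deriv ^^ Suc i) g x) (at x within cball 0 1)"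
      if "x \<in> cball 0 1" "i \<le> 1" for i x
      using that(2) holomorphic_derivI[OF hol _ sub[OF that(1)]]
        holomorphic_derivI[OF hol' _ sub[OF that(1)]]
      by (cases i) auto
    show "norm ((deriv ^^ Suc 1) g x) \<le> 8 * M * (norm v)\<^sup>2 / r\<^sup>2" if "x \<in> cball 0 1" for x
    proof -
      have "norm ((deriv ^^ 2) g x) \<le> fact 2 * M / (R / 2) ^ 2"
        unfolding g_def using that R
        by (intro cdiff_on_slice_bounds[OF assms(1-4) False]) (auto simp: R_def[symmetric])
      also have "\<dots> = 8 * M * (norm v)\<^sup>2 / r\<^sup>2"
        by (simp add: R_def power2_eq_square)
      finally show ?thesis by (simp add: numeral_2_eq_2)
    qed
  qed auto
  moreover have "deriv g 0 = frechet_derivative f (at w) v"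
    using d[of 0] R by (simp add: DERIV_imp_deriv)
  ultimately show ?thesis
    by (simp add: g_def algebra_simps)
qed

lemma norm_integral_le:
  fixes f :: "'a \<Rightarrow> 'b::{banach,second_countable_topology}"
  assumes "integrable M f" "integrable M g" "\<And>x. x \<in> space M \<Longrightarrow> norm (f x) \<le> g x"
  shows "norm (\<integral>x. f x \<partial>M) \<le> (\<integral>x. g x \<partial>M)"
  by (rule order.trans[OF integral_norm_bound integral_mono]) (use assms in auto)

text \<open>Taylor's estimate holds uniformly in the parameter up to the factor \<open>b t\<close>, so it may be integrated over the
  parameter. Series are covered as integrals over a counting measure.\<close>

proposition cdiff_on_integral:
  fixes k :: "'a \<Rightarrow> complex^'n \<Rightarrow> complex"
  assumes U: "open U" and k: "\<And>t. t \<in> space M \<Longrightarrow> cdiff_on U (k t)"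
    and meas: "\<And>w. w \<in> U \<Longrightarrow> (\<lambda>t. k t w) \<in> borel_measurable M"
    and b: "integrable M b" and kb: "\<And>t w. t \<in> space M \<Longrightarrow> w \<in> U \<Longrightarrow> norm (k t w) \<le> b t"
  shows "cdiff_on U (\<lambda>w. \<integral>t. k t w \<partial>M)"
    and "w \<in> U \<Longrightarrow> integrable M (\<lambda>t. frechet_derivative (k t) (at w) v)"
    and "w \<in> U \<Longrightarrow> frechet_derivative (\<lambda>w. \<integral>t. k t w \<partial>M) (at w) v =
           (\<integral>t. frechet_derivative (k t) (at w) v \<partial>M)"
proof -
  define D where "D w v = (\<integral>t. frechet_derivative (k t) (at w) v \<partial>M)" for w v
  have lin: "linear (frechet_derivative (k t) (at w))" if "t \<in> space M" "w \<in> U" for t w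
    using cdiff_on_derivative(1)[OF k] that has_derivative_linear by blast
  have int: "integrable M (\<lambda>t. k t w)" if "w \<in> U" for w
    by (rule Bochner_Integration.integrable_bound[OF b meas[OF that]])
       (auto intro!: AE_I2 order.trans[OF kb[OF _ that]])
  have intd: "integrable M (\<lambda>t. frechet_derivative (k t) (at w) v)" if w: "w \<in> U" for w v
  proof -
    obtain r where r: "0 < r" "cball w r \<subseteq> U" using U w open_contains_cball by blast
    show ?thesis
    proof (rule Bochner_Integration.integrable_bound)
      show "integrable M (\<lambda>t. b t * (norm v / r))" using b by simp
      show "AE t in M. norm (frechet_derivative (k t) (at w) v) \<le> norm (b t * (norm v / r))"
      proof (rule AE_I2)
        fix t assume t: "t \<in> space M"
        have "norm (frechet_derivative (k t) (at w) v) \<le> b t * norm v / r"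
          by (rule cdiff_on_Cauchy_estimate[OF k[OF t] r(2,1)]) (use kb[OF t] r in auto)
        then show "norm (frechet_derivative (k t) (at w) v) \<le> norm (b t * (norm v / r))"
          by (metis abs_ge_self order.trans real_norm_def times_divide_eq_right)
      qed
      \<comment> \<open>The derivative is measurable in \<open>t\<close> as a pointwise limit of difference quotients; the steps are
        scaled so that they stay in the ball.\<close>
      define \<rho> where "\<rho> n = r / ((norm v + 1) * (real n + 1))" for n
      have \<rho>: "0 < \<rho> n" for n using r by (auto simp: \<rho>_def intro!: divide_pos_pos mult_pos_pos add_nonneg_pos)
      have \<rho>w: "w + \<rho> n *\<^sub>R v \<in> U" for n
      proof -
        have "norm v \<le> (norm v + 1) * (real n + 1)" by (simp add: algebra_simps)
        then have "norm v / ((norm v + 1) * (real n + 1)) \<le> 1"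
          by (intro divide_le_eq_1_pos[THEN iffD2] mult_pos_pos add_nonneg_pos) auto
        from mult_left_mono[OF this, of r] r have "\<rho> n * norm v \<le> r" by (simp add: \<rho>_def)
        then show ?thesis using r(2) \<rho>[of n] by (auto simp: dist_norm subset_iff)
      qed
      have \<rho>lim: "filterlim \<rho> (at 0) sequentially"
      proof (rule filterlim_atI)
        have "(\<lambda>n. r / (norm v + 1) * (1 / (real n + 1))) \<longlonglongrightarrow> r / (norm v + 1) * 0"
          by (intro tendsto_mult tendsto_const) (simp add: lim_1_over_n LIMSEQ_Suc add.commute
              LIMSEQ_inverse_real_of_nat[unfolded inverse_eq_divide of_nat_Suc])
        then show "\<rho> \<longlonglongrightarrow> 0" by (simp add: \<rho>_def[abs_def])
        show "\<forall>\<^sub>F n in sequentially. \<rho> n \<noteq> 0" using \<rho> by (intro always_eventually) (metis less_irrefl)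
      qed
      show "(\<lambda>t. frechet_derivative (k t) (at w) v) \<in> borel_measurable M"
      proof (rule borel_measurable_LIMSEQ_metric)
        show "(\<lambda>t. (k t (w + \<rho> n *\<^sub>R v) - k t w) /\<^sub>R \<rho> n) \<in> borel_measurable M" for n
          using meas[OF \<rho>w] meas[OF w] by measurable
        fix t assume t: "t \<in> space M"
        have "(\<lambda>\<zeta>. (k t (w + \<zeta> *s v) - k t w) / \<zeta>) \<midarrow>0\<rightarrow> frechet_derivative (k t) (at w) v"
          using cdiff_on_slice[OF k[OF t], of w 0 v] w by (simp add: DERIV_def)
        moreover have "filterlim (\<lambda>n. complex_of_real (\<rho> n)) (at 0) sequentially"
          using \<rho>lim by (simp add: filterlim_at tendsto_of_real_iff[where c=0, simplified])
        ultimately have "(\<lambda>n. (k t (w + complex_of_real (\<rho> n) *s v) - k t w) / complex_of_real (\<rho> n))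
            \<longlonglongrightarrow> frechet_derivative (k t) (at w) v"
          by (rule filterlim_compose)
        moreover have "complex_of_real c *s v = c *\<^sub>R v" for c
          by (simp add: vec_eq_iff scaleR_conv_of_real[where 'a=complex])
        ultimately show "(\<lambda>n. (k t (w + \<rho> n *\<^sub>R v) - k t w) /\<^sub>R \<rho> n) \<longlonglongrightarrow> frechet_derivative (k t) (at w) v"
          by (simp add: scaleR_conv_of_real[where 'a=complex] divide_inverse mult.commute)
      qed
    qed
  qed
  have lin_D: "D w (x + y) = D w x + D w y" "D w (c *\<^sub>R x) = c *\<^sub>R D w x" "D w (c' *s x) = c' * D w x"
    if w: "w \<in> U" for w x y c c'
  proof -
    have "D w (x + y) = (\<integral>t. frechet_derivative (k t) (at w) x + frechet_derivative (k t) (at w) y \<partial>M)"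
      unfolding D_def by (rule Bochner_Integration.integral_cong) (auto simp: linear_add[OF lin] w)
    then show "D w (x + y) = D w x + D w y" using intd[OF w] by (simp add: D_def)
    have "D w (c *\<^sub>R x) = (\<integral>t. c *\<^sub>R frechet_derivative (k t) (at w) x \<partial>M)"
      unfolding D_def by (rule Bochner_Integration.integral_cong) (auto simp: linear_scale[OF lin] w)
    then show "D w (c *\<^sub>R x) = c *\<^sub>R D w x" by (simp add: D_def)
    have "D w (c' *s x) = (\<integral>t. c' * frechet_derivative (k t) (at w) x \<partial>M)"
      unfolding D_def by (rule Bochner_Integration.integral_cong)
        (auto simp: cdiff_on_derivative(2)[OF k] w)
    then show "D w (c' *s x) = c' * D w x" by (simp add: D_def)
  qed
  define B where "B = (\<integral>t. b t \<partial>M)"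
  have hd: "((\<lambda>w. \<integral>t. k t w \<partial>M) has_derivative D w) (at w)" if w: "w \<in> U" for w
  proof -
    obtain r where r: "0 < r" "cball w r \<subseteq> U" using U w open_contains_cball by blast
    have bound1: "norm (D w v) \<le> norm v * (B / r)" for v
    proof -
      have "norm (D w v) \<le> (\<integral>t. b t * (norm v / r) \<partial>M)"
        unfolding D_def
      proof (rule norm_integral_le)
        show "integrable M (\<lambda>t. frechet_derivative (k t) (at w) v)" by (rule intd[OF w])
        show "integrable M (\<lambda>t. b t * (norm v / r))" using b by simp
        show "norm (frechet_derivative (k t) (at w) v) \<le> b t * (norm v / r)" if t: "t \<in> space M" for t
          using cdiff_on_Cauchy_estimate[OF k[OF t] r(2,1), of "b t" v] kb[OF t] r
          by (auto simp: subset_iff)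
      qed
      then show ?thesis by (simp add: B_def mult.commute)
    qed
    have bl: "bounded_linear (D w)"
      by (rule bounded_linear_intro[OF lin_D(1,2)[OF w] bound1])
    have bound2: "norm ((\<integral>t. k t (w + v) \<partial>M) - (\<integral>t. k t w \<partial>M) - D w v) \<le> 8 * B / r\<^sup>2 * (norm v)\<^sup>2"
      if v: "norm v \<le> r / 2" for v
    proof -
      have wv: "w + v \<in> U" using r v by (auto simp: dist_norm subset_iff)
      have "(\<integral>t. k t (w + v) \<partial>M) - (\<integral>t. k t w \<partial>M) - D w v
          = (\<integral>t. k t (w + v) - k t w - frechet_derivative (k t) (at w) v \<partial>M)"
        unfolding D_def using int[OF w] int[OF wv] intd[OF w] by simp
      also have "norm \<dots> \<le> (\<integral>t. b t * (8 * (norm v)\<^sup>2 / r\<^sup>2) \<partial>M)"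
      proof (rule norm_integral_le)
        show "integrable M (\<lambda>t. k t (w + v) - k t w - frechet_derivative (k t) (at w) v)"
          using int[OF w] int[OF wv] intd[OF w] by simp
        show "integrable M (\<lambda>t. b t * (8 * (norm v)\<^sup>2 / r\<^sup>2))" using b by simp
        show "norm (k t (w + v) - k t w - frechet_derivative (k t) (at w) v) \<le> b t * (8 * (norm v)\<^sup>2 / r\<^sup>2)"
          if t: "t \<in> space M" for t
          using cdiff_on_Taylor_estimate[OF k[OF t] r(2,1), of "b t" v] kb[OF t] r v
          by (auto simp: mult_ac subset_iff)
      qed
      finally show ?thesis by (simp add: B_def mult_ac)
    qed
    show ?thesis
      unfolding has_derivative_at
    proof (intro conjI bl)
      have "((\<lambda>h::complex^'n. 8 * B / r\<^sup>2 * norm h) \<longlongrightarrow> 8 * B / r\<^sup>2 * norm (0::complex^'n)) (at 0)"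
        by (rule tendsto_mult[OF tendsto_const tendsto_norm[OF tendsto_ident_at]])
      then have lim: "((\<lambda>h::complex^'n. 8 * B / r\<^sup>2 * norm h) \<longlongrightarrow> 0) (at 0)" by simp
      show "(\<lambda>h. norm ((\<integral>t. k t (w + h) \<partial>M) - (\<integral>t. k t w \<partial>M) - D w h) / norm h) \<midarrow>0\<rightarrow> 0"
      proof (rule Lim_null_comparison[OF _ lim])
        have "\<forall>\<^sub>F h in at 0. norm (h::complex^'n) \<le> r / 2 \<and> h \<noteq> 0"
          unfolding eventually_at using r(1) by (intro exI[of _ "r/2"]) (auto simp: dist_norm)
        then show "\<forall>\<^sub>F h in at 0. norm (norm ((\<integral>t. k t (w + h) \<partial>M) - (\<integral>t. k t w \<partial>M) - D w h) / norm h)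
            \<le> 8 * B / r\<^sup>2 * norm h"
        proof eventually_elim
          case (elim h)
          then show ?case using bound2[of h] by (simp add: divide_le_eq power2_eq_square mult_ac)
        qed
      qed
    qed
  qed
  show "cdiff_on U (\<lambda>w. \<integral>t. k t w \<partial>M)"
    by (rule cdiff_onI[OF hd]) (auto simp: lin_D)
  show "integrable M (\<lambda>t. frechet_derivative (k t) (at w) v)" if "w \<in> U"
    by (rule intd[OF that])
  show "frechet_derivative (\<lambda>w. \<integral>t. k t w \<partial>M) (at w) v =
           (\<integral>t. frechet_derivative (k t) (at w) v \<partial>M)" if "w \<in> U"
    using fun_cong[OF frechet_derivative_at[OF hd[OF that]], of v] by (simp add: D_def)
qed


lemma cdiff_on_const [simp]: "cdiff_on U (\<lambda>_. c)"
  by (rule cdiff_onI[where D="\<lambda>_ _. 0"]) auto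

lemma cdiff_on_coord: "cdiff_on U (\<lambda>z. z $ i)"
  by (rule cdiff_onI[where D="\<lambda>_ v. v $ i"])
     (auto intro!: bounded_linear_imp_has_derivative bounded_linear_vec_nth)

lemma cdiff_on_add:
  assumes "cdiff_on U f" "cdiff_on U g" shows "cdiff_on U (\<lambda>z. f z + g z)"
  by (rule cdiff_onI[OF has_derivative_add[OF assms[THEN cdiff_on_derivative(1)]]])
     (auto simp: assms[THEN cdiff_on_derivative(2)] algebra_simps)

lemma cdiff_on_diff:
  assumes "cdiff_on U f" "cdiff_on U g" shows "cdiff_on U (\<lambda>z. f z - g z)"
  by (rule cdiff_onI[OF has_derivative_diff[OF assms[THEN cdiff_on_derivative(1)]]])
     (auto simp: assms[THEN cdiff_on_derivative(2)] algebra_simps)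

lemma cdiff_on_mult:
  assumes "cdiff_on U f" "cdiff_on U g" shows "cdiff_on U (\<lambda>z. f z * g z)"
  by (rule cdiff_onI[OF has_derivative_mult[OF assms[THEN cdiff_on_derivative(1)]]])
     (auto simp: assms[THEN cdiff_on_derivative(2)] algebra_simps)

lemma cdiff_on_sum:
  "(\<And>i. i \<in> I \<Longrightarrow> cdiff_on U (f i)) \<Longrightarrow> cdiff_on U (\<lambda>z. \<Sum>i\<in>I. f i z)"
  by (induction I rule: infinite_finite_induct) (auto intro: cdiff_on_add)

lemma cdiff_on_cong_open:
  assumes "cdiff_on U f" "open U" "\<And>z. z \<in> U \<Longrightarrow> f z = g z"
  shows "cdiff_on U g"
  by (rule cdiff_onI[OF has_derivative_transform_within_open[OF cdiff_on_derivative(1)[OF assms(1)] assms(2)]])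
     (auto simp: assms(3) cdiff_on_derivative(2)[OF assms(1)])

lemma holomorphic_map_on_derivative:
  assumes "holomorphic_map_on U f" "z \<in> U"
  shows "(f has_derivative frechet_derivative f (at z)) (at z)"
    and "frechet_derivative f (at z) (c *s v) = c *s frechet_derivative f (at z) v"
proof -
  obtain D where D: "(f has_derivative D) (at z)" "\<And>c v. D (c *s v) = c *s D v"
    using assms unfolding holomorphic_map_on_def by blast
  from frechet_derivative_at[OF D(1)] have "D = frechet_derivative f (at z)" .
  with D show "(f has_derivative frechet_derivative f (at z)) (at z)"
    "frechet_derivative f (at z) (c *s v) = c *s frechet_derivative f (at z) v"
    by auto
qed

lemma frechet_derivative_nth:
  fixes f :: "complex^'m \<Rightarrow> complex^'n"
  assumes "holomorphic_map_on U f" "z \<in> U"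
  shows "frechet_derivative f (at z) v $ i = frechet_derivative (\<lambda>z. f z $ i) (at z) v"
  using frechet_derivative_at[OF bounded_linear.has_derivative[OF bounded_linear_vec_nth
      holomorphic_map_on_derivative(1)[OF assms]], of i]
  by (rule fun_cong)

lemma has_derivative_vec_lambda:
  fixes f :: "'a::real_normed_vector \<Rightarrow> 'b::euclidean_space^'n"
  assumes "\<And>i. ((\<lambda>x. f x $ i) has_derivative (\<lambda>v. D v $ i)) (at a)"
  shows "(f has_derivative D) (at a)"
proof -
  have "((\<lambda>x. f x \<bullet> axis i b) has_derivative (\<lambda>v. D v \<bullet> axis i b)) (at a)" for i b
    unfolding inner_axis by (rule has_derivative_inner_left[OF assms])
  then show ?thesis
    by (subst has_derivative_componentwise_within) (auto simp: Basis_vec_def)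
qed

lemma holomorphic_map_on_iff:
  fixes f :: "complex^'m \<Rightarrow> complex^'n"
  shows "holomorphic_map_on U f \<longleftrightarrow> (\<forall>i. cdiff_on U (\<lambda>z. f z $ i))"
proof safe
  fix i assume f: "holomorphic_map_on U f"
  show "cdiff_on U (\<lambda>z. f z $ i)"
    by (rule cdiff_onI[OF bounded_linear.has_derivative[OF bounded_linear_vec_nth
      holomorphic_map_on_derivative(1)[OF f]]])
      (auto simp: holomorphic_map_on_derivative(2)[OF f])
next
  assume f: "\<forall>i. cdiff_on U (\<lambda>z. f z $ i)"
  show "holomorphic_map_on U f"
    unfolding holomorphic_map_on_def
  proof
    fix z assume z: "z \<in> U"
    have "(f has_derivative (\<lambda>v. \<chi> i. frechet_derivative (\<lambda>z. f z $ i) (at z) v)) (at z)"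
      by (rule has_derivative_vec_lambda) (use f z in \<open>simp add: cdiff_on_derivative(1)[where U=U]\<close>)
    moreover have "(\<chi> i. frechet_derivative (\<lambda>z. f z $ i) (at z) (c *s v))
        = c *s (\<chi> i. frechet_derivative (\<lambda>z. f z $ i) (at z) v)" for c v
      using f z by (simp add: vec_eq_iff cdiff_on_derivative(2)[where U=U])
    ultimately show "\<exists>D. (f has_derivative D) (at z) \<and> (\<forall>c v. D (c *s v) = c *s D v)"
      by blast
  qed
qed

lemma holomorphic_map_on_subset: "holomorphic_map_on U f \<Longrightarrow> W \<subseteq> U \<Longrightarrow> holomorphic_map_on W f"
  unfolding holomorphic_map_on_def by blast

lemma holomorphic_map_on_imp_continuous_on: "holomorphic_map_on U f \<Longrightarrow> continuous_on U f"
  by (meson holomorphic_map_on_derivative(1) continuous_at_imp_continuous_on has_derivative_continuous)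

lemma holomorphic_map_on_cong_open:
  assumes "holomorphic_map_on U f" "open U" "\<And>z. z \<in> U \<Longrightarrow> f z = g z"
  shows "holomorphic_map_on U g"
  unfolding holomorphic_map_on_iff
proof
  fix i
  have "cdiff_on U (\<lambda>z. f z $ i)" using assms(1) by (simp add: holomorphic_map_on_iff)
  then show "cdiff_on U (\<lambda>z. g z $ i)"
    by (rule cdiff_on_cong_open[OF _ assms(2)]) (simp add: assms(3))
qed

lemma cdiff_on_compose:
  assumes f: "cdiff_on W f" and g: "holomorphic_map_on U g" and "g ` U \<subseteq> W"
  shows "cdiff_on U (\<lambda>z. f (g z))"
    and "z \<in> U \<Longrightarrow> frechet_derivative (\<lambda>z. f (g z)) (at z) v =
           frechet_derivative f (at (g z)) (frechet_derivative g (at z) v)"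
proof -
  have d: "((\<lambda>z. f (g z)) has_derivative
      (\<lambda>v. frechet_derivative f (at (g z)) (frechet_derivative g (at z) v))) (at z)" if "z \<in> U" for z
    using that assms(3) by (intro has_derivative_compose[OF holomorphic_map_on_derivative(1)[OF g]
        cdiff_on_derivative(1)[OF f]]) auto
  show "cdiff_on U (\<lambda>z. f (g z))"
    by (rule cdiff_onI[OF d])
      (use assms(3) in \<open>auto simp: holomorphic_map_on_derivative(2)[OF g] cdiff_on_derivative(2)[OF f]\<close>)
  show "frechet_derivative (\<lambda>z. f (g z)) (at z) v =
           frechet_derivative f (at (g z)) (frechet_derivative g (at z) v)" if "z \<in> U"
    using frechet_derivative_at[OF d[OF that], symmetric] by (rule fun_cong)
qed

lemma holomorphic_map_on_compose:
  assumes f: "holomorphic_map_on W f" and g: "holomorphic_map_on U g" and "g ` U \<subseteq> W"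
  shows "holomorphic_map_on U (\<lambda>z. f (g z))"
    and "z \<in> U \<Longrightarrow> frechet_derivative (\<lambda>z. f (g z)) (at z) v =
           frechet_derivative f (at (g z)) (frechet_derivative g (at z) v)"
proof -
  show "holomorphic_map_on U (\<lambda>z. f (g z))"
    using f cdiff_on_compose(1)[OF _ g assms(3)] unfolding holomorphic_map_on_iff by auto
  show "frechet_derivative (\<lambda>z. f (g z)) (at z) v =
           frechet_derivative f (at (g z)) (frechet_derivative g (at z) v)" if "z \<in> U"
  proof -
    have "((\<lambda>z. f (g z)) has_derivative
      (\<lambda>v. frechet_derivative f (at (g z)) (frechet_derivative g (at z) v))) (at z)"
      using that assms(3) by (intro has_derivative_compose[OF holomorphic_map_on_derivative(1)[OF g]
        holomorphic_map_on_derivative(1)[OF f]]) auto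
    from frechet_derivative_at[OF this, symmetric] show ?thesis by (rule fun_cong)
  qed
qed

text \<open>The limit is the first term plus a telescoping series, to which differentiation under the integral applies.\<close>

lemma cdiff_on_limit:
  assumes U: "open U" and f: "\<And>n. cdiff_on U (f n)"
    and b: "\<And>n z. z \<in> U \<Longrightarrow> norm (f (Suc n) z - f n z) \<le> b n" and sb: "summable b"
    and lim: "\<And>z. z \<in> U \<Longrightarrow> (\<lambda>n. f n z) \<longlonglongrightarrow> g z"
  shows "cdiff_on U g"
proof (cases "U = {}")
  case True then show ?thesis by (simp add: cdiff_on_def)
next
  case False
  then have b0: "0 \<le> b n" for n using b norm_ge_zero order.trans by blast
  have "cdiff_on U (\<lambda>z. \<integral>n. (f (Suc n) z - f n z) \<partial>count_space UNIV)"
  proof (rule cdiff_on_integral(1)[OF U])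
    show "integrable (count_space UNIV) b"
      using sb b0 by (simp add: integrable_count_space_nat_iff)
  qed (simp_all add: cdiff_on_diff f b)
  then have "cdiff_on U (\<lambda>z. f 0 z + (\<integral>n. (f (Suc n) z - f n z) \<partial>count_space UNIV))"
    by (rule cdiff_on_add[OF f])
  moreover have "f 0 z + (\<integral>n. (f (Suc n) z - f n z) \<partial>count_space UNIV) = g z" if z: "z \<in> U" for z
  proof -
    have "summable (\<lambda>n. norm (f (Suc n) z - f n z))"
      by (rule summable_comparison_test'[OF sb]) (use b[OF z] in auto)
    then have "integrable (count_space UNIV) (\<lambda>n. f (Suc n) z - f n z)"
      by (simp add: integrable_count_space_nat_iff)
    then have "(\<integral>n. (f (Suc n) z - f n z) \<partial>count_space UNIV) = (\<Sum>n. f (Suc n) z - f n z)"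
      by (rule integral_count_space_nat)
    also have "\<dots> = g z - f 0 z"
      using sums_unique[OF telescope_sums[OF lim[OF z]]] by simp
    finally show ?thesis by simp
  qed
  ultimately show ?thesis
    by (rule cdiff_on_cong_open[OF _ U])
qed

text \<open>Difference quotients with geometrically decreasing steps converge geometrically, by Taylor's estimate, so their
  limit is holomorphic.\<close>

lemma cdiff_on_frechet_derivative:
  assumes U: "open U" and f: "cdiff_on U f"
  shows "cdiff_on U (\<lambda>z. frechet_derivative f (at z) v)"
  unfolding cdiff_on_def
proof
  fix z0 assume "z0 \<in> U"
  then obtain r0 where r0: "0 < r0" "cball z0 r0 \<subseteq> U" using U open_contains_cball by blast
  define r where "r = r0 / 2"
  have r: "0 < r" using r0 by (simp add: r_def)
  obtain M where M: "\<And>z. z \<in> cball z0 r0 \<Longrightarrow> norm (f z) \<le> M"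
    using compact_imp_bounded[OF compact_continuous_image[OF continuous_on_subset
          [OF cdiff_on_imp_continuous_on[OF f] r0(2)] compact_cball]]
    unfolding bounded_iff by blast
  have sub: "cball z r \<subseteq> cball z0 r0" if "z \<in> ball z0 r" for z
  proof
    fix x assume "x \<in> cball z r"
    then show "x \<in> cball z0 r0"
      using that dist_triangle[of z0 x z] by (simp add: r_def)
  qed
  define \<rho> where "\<rho> n = r / (2 * (norm v + 1)) / 2 ^ n" for n :: nat
  have nv: "norm v + 1 > 0" by (simp add: add_nonneg_pos)
  have \<rho>: "0 < \<rho> n" "\<rho> n * norm v \<le> r / 2" for n
  proof -
    show "0 < \<rho> n" using r nv by (simp add: \<rho>_def)
    have "\<rho> n * norm v = r / 2 * ((norm v / (norm v + 1)) / 2 ^ n)"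
      by (simp add: \<rho>_def)
    also have "\<dots> \<le> r / 2 * 1"
    proof (rule mult_left_mono)
      have "norm v / (norm v + 1) \<le> 1" using nv by (simp add: field_simps)
      moreover have "(1::real) \<le> 2 ^ n" by simp
      ultimately have "norm v / (norm v + 1) \<le> 2 ^ n" by (rule order.trans)
      then show "norm v / (norm v + 1) / 2 ^ n \<le> 1" by (subst divide_le_eq) simp
    qed (use r in auto)
    finally show "\<rho> n * norm v \<le> r / 2" by simp
  qed
  define q where "q n z = (f (z + \<rho> n *\<^sub>R v) - f z) / \<rho> n" for n z
  have err: "norm (q n z - frechet_derivative f (at z) v) \<le> 8 * M * (norm v)\<^sup>2 / r\<^sup>2 * \<rho> n"
    if z: "z \<in> ball z0 r" for n z
  proof -
    have zU: "cball z r \<subseteq> U" "z \<in> cball z r" using sub[OF z] r r0 by auto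
    then have zU: "z \<in> U" "cball z r \<subseteq> U" by blast+
    have "norm (f (z + \<rho> n *\<^sub>R v) - f z - frechet_derivative f (at z) (\<rho> n *\<^sub>R v))
        \<le> 8 * M * (norm (\<rho> n *\<^sub>R v))\<^sup>2 / r\<^sup>2"
      by (rule cdiff_on_Taylor_estimate[OF f zU(2) r]) (use sub[OF z] M \<rho>[of n] in auto)
    also have "frechet_derivative f (at z) (\<rho> n *\<^sub>R v) = \<rho> n *\<^sub>R frechet_derivative f (at z) v"
      by (rule linear_scale[OF has_derivative_linear[OF cdiff_on_derivative(1)[OF f zU(1)]]])
    also have "f (z + \<rho> n *\<^sub>R v) - f z - \<rho> n *\<^sub>R frechet_derivative f (at z) v
        = \<rho> n *\<^sub>R (q n z - frechet_derivative f (at z) v)"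
      using \<rho>(1)[of n] by (simp add: q_def scaleR_conv_of_real[where 'a=complex] field_simps)
    finally have "\<rho> n * norm (q n z - frechet_derivative f (at z) v)
        \<le> \<rho> n * (8 * M * (norm v)\<^sup>2 / r\<^sup>2 * \<rho> n)"
      using \<rho>(1)[of n] by (simp add: power2_eq_square mult_ac)
    then show ?thesis using \<rho>(1)[of n] by (simp only: mult_le_cancel_left_pos)
  qed
  have "cdiff_on (ball z0 r) (\<lambda>z. frechet_derivative f (at z) v)"
  proof (rule cdiff_on_limit[where f=q])
    show "cdiff_on (ball z0 r) (q n)" for n
    proof -
      have "holomorphic_map_on (ball z0 r) (\<lambda>z. z + \<rho> n *\<^sub>R v)"
        unfolding holomorphic_map_on_iff by (auto intro!: cdiff_on_add cdiff_on_coord)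
      moreover have "(\<lambda>z. z + \<rho> n *\<^sub>R v) ` ball z0 r \<subseteq> U"
      proof safe
        fix z assume "z \<in> ball z0 r"
        from sub[OF this] r0(2) have "cball z r \<subseteq> U" by blast
        moreover have "z + \<rho> n *\<^sub>R v \<in> cball z r" using \<rho>[of n] r by (simp add: dist_norm)
        ultimately show "z + \<rho> n *\<^sub>R v \<in> U" by blast
      qed
      moreover have "ball z0 r \<subseteq> U" using r0 r by (auto simp: r_def)
      ultimately have "cdiff_on (ball z0 r) (\<lambda>z. (1 / \<rho> n) * (f (z + \<rho> n *\<^sub>R v) - f z))"
        by (intro cdiff_on_mult cdiff_on_const cdiff_on_diff cdiff_on_compose(1)[OF f]
            cdiff_on_subset[OF f])
      then show ?thesis by (simp add: q_def[abs_def])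
    qed
    have s: "summable (\<lambda>n. \<rho> n)"
      unfolding \<rho>_def using summable_mult[OF summable_geometric[of "1/2::real"], of "r / (2 * (norm v + 1))"]
      by (simp add: power_divide)
    show "summable (\<lambda>n. 8 * M * (norm v)\<^sup>2 / r\<^sup>2 * \<rho> (Suc n) + 8 * M * (norm v)\<^sup>2 / r\<^sup>2 * \<rho> n)"
      by (intro summable_add summable_mult s summable_Suc_iff[THEN iffD2])
    show "norm (q (Suc n) z - q n z) \<le> 8 * M * (norm v)\<^sup>2 / r\<^sup>2 * \<rho> (Suc n) + 8 * M * (norm v)\<^sup>2 / r\<^sup>2 * \<rho> n"
      if z: "z \<in> ball z0 r" for n z
      using norm_triangle_le_diff[OF add_mono[OF err[OF z, of "Suc n"] err[OF z, of n]]] by simp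
    show "(\<lambda>n. q n z) \<longlonglongrightarrow> frechet_derivative f (at z) v" if z: "z \<in> ball z0 r" for z
    proof (rule Lim_transform2[OF tendsto_const])
      show "(\<lambda>n. frechet_derivative f (at z) v - q n z) \<longlonglongrightarrow> 0"
        by (rule Lim_null_comparison[where g="\<lambda>n. 8 * M * (norm v)\<^sup>2 / r\<^sup>2 * \<rho> n"])
          (use err[OF z] summable_LIMSEQ_zero[OF summable_mult[OF s, of "8 * M * (norm v)\<^sup>2 / r\<^sup>2"]]
            in \<open>auto simp: norm_minus_commute\<close>)
    qed
  qed auto
  then show "\<exists>D. ((\<lambda>z. frechet_derivative f (at z) v) has_derivative D) (at z0) \<and> (\<forall>c v. D (c *s v) = c * D v)"
    using r unfolding cdiff_on_def by auto
qed

section \<open>Linearization of a vector field\<close>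

lemma integral_FTC_halfline:
  fixes f :: "real \<Rightarrow> complex"
  assumes f: "\<And>x. a \<le> x \<Longrightarrow> (f has_vector_derivative f' x) (at x within {a..})"
    and int: "set_integrable lborel {a..} f'" and lim: "(f \<longlongrightarrow> L) at_top"
  shows "(LINT x:{a..}|lborel. f' x) = L - f a"
proof (rule tendsto_unique[OF trivial_limit_at_top_linorder])
  show "((\<lambda>b. LINT x:{a..b}|lborel. f' x) \<longlongrightarrow> (LINT x:{a..}|lborel. f' x)) at_top"
    by (rule tendsto_set_lebesgue_integral_at_top[OF _ int]) auto
  have "\<forall>\<^sub>F b in at_top. f b - f a = (LINT x:{a..b}|lborel. f' x)"
    using eventually_ge_at_top[of a]
  proof eventually_elim
    case (elim b)
    have "(f' has_integral f b - f a) {a..b}"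
      by (rule fundamental_theorem_of_calculus[OF elim])
         (auto intro: has_vector_derivative_within_subset[OF f])
    moreover have "set_integrable lborel {a..b} f'"
      by (rule set_integrable_subset[OF int]) auto
    ultimately show ?case
      using set_borel_integral_eq_integral(2) integral_unique by metis
  qed
  then show "((\<lambda>b. LINT x:{a..b}|lborel. f' x) \<longlongrightarrow> L - f a) at_top"
    by (rule Lim_transform_eventually[OF tendsto_diff[OF lim tendsto_const]])
qed

lemma nn_integral_exp_minus_halfline:
  "(\<integral>\<^sup>+t. ennreal (exp (- t)) * indicator {0..} t \<partial>lborel) = ennreal 1"
proof -
  have "(\<integral>\<^sup>+t. ennreal (exp (- t)) * indicator {0..} t \<partial>lborel) = ennreal (0 - (- exp (- 0)))"
  proof (rule nn_integral_FTC_atLeast[where F="\<lambda>t. - exp (- t)"])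
    show "((\<lambda>t::real. - exp (- t)) \<longlongrightarrow> 0) at_top"
      by (rule tendsto_eq_intros filterlim_compose[OF exp_at_bot filterlim_uminus_at_bot_at_top] | simp)+
  qed (auto intro!: derivative_eq_intros)
  then show ?thesis by simp
qed

abbreviation halfline :: "real measure" where
  "halfline \<equiv> restrict_space lborel {0..}"

lemma borel_measurable_halfline:
  fixes f :: "real \<Rightarrow> 'a::topological_space"
  assumes "continuous_on {0..} f" shows "f \<in> borel_measurable halfline"
proof -
  have "measurable halfline borel = measurable (restrict_space borel {0::real..}) (borel :: 'a measure)"
    by (rule measurable_cong_sets) (auto simp: sets_restrict_space)
  with borel_measurable_continuous_on_restrict[OF assms] show ?thesis by simp
qed

lemma integral_exp_minus_halfline:
  "integrable halfline (\<lambda>t. exp (- t))" "(\<integral>t. exp (- t) \<partial>halfline) = 1"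
proof -
  have nn: "(\<integral>\<^sup>+t. ennreal (exp (- t)) \<partial>halfline) = ennreal 1"
    by (subst nn_integral_restrict_space) (auto simp: nn_integral_exp_minus_halfline)
  have "has_bochner_integral halfline (\<lambda>t. exp (- t)) 1"
    by (rule has_bochner_integral_nn_integral[OF _ _ _ nn])
       (auto intro!: borel_measurable_halfline continuous_intros)
  then show "integrable halfline (\<lambda>t. exp (- t))" "(\<integral>t. exp (- t) \<partial>halfline) = 1"
    by (auto simp: has_bochner_integral_iff)
qed

definition diag_field :: "complex^'n \<Rightarrow> complex^'n \<Rightarrow> complex^'n" where
  "diag_field \<Lambda> w = (\<chi> i. \<Lambda> $ i * w $ i)"

definition diag_flow :: "complex^'n \<Rightarrow> real \<Rightarrow> complex^'n \<Rightarrow> complex^'n" where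
  "diag_flow \<Lambda> t w = (\<chi> i. exp (of_real t * \<Lambda> $ i) * w $ i)"

lemma diag_field_nth [simp]: "diag_field \<Lambda> w $ i = \<Lambda> $ i * w $ i"
  by (simp add: diag_field_def)

lemma diag_flow_nth [simp]: "diag_flow \<Lambda> t w $ i = exp (of_real t * \<Lambda> $ i) * w $ i"
  by (simp add: diag_flow_def)

lemma norm_diag_flow:
  assumes "\<And>i. Re (\<Lambda> $ i) = -1"
  shows "norm (diag_flow \<Lambda> t w) = exp (- t) * norm w"
  by (simp add: norm_vec_def L2_set_def norm_mult assms power_mult_distrib sum_distrib_left[symmetric]
      real_sqrt_mult)

lemma holomorphic_diag_flow:
  "holomorphic_map_on U (diag_flow \<Lambda> t)"
  unfolding holomorphic_map_on_iff by (auto intro!: cdiff_on_mult cdiff_on_coord)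

lemma frechet_derivative_diag_flow:
  "frechet_derivative (diag_flow \<Lambda> t) (at w) v = diag_flow \<Lambda> t v"
proof -
  have "(diag_flow \<Lambda> t has_derivative diag_flow \<Lambda> t) (at w)"
    by (rule has_derivative_vec_lambda)
       (auto intro!: bounded_linear_imp_has_derivative bounded_linear_mult_right
        bounded_linear_vec_nth bounded_linear_compose[OF bounded_linear_mult_right])
  from fun_cong[OF frechet_derivative_at[OF this, symmetric]] show ?thesis .
qed

lemma diag_flow_has_vector_derivative:
  "((\<lambda>t. diag_flow \<Lambda> t w) has_vector_derivative diag_field \<Lambda> (diag_flow \<Lambda> t w)) (at t)"
  unfolding has_vector_derivative_def
proof (rule has_derivative_vec_lambda)
  fix i
  have "((\<lambda>x. exp (of_real x * \<Lambda> $ i) * w $ i) has_vector_derivative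
       \<Lambda> $ i * (exp (of_real t * \<Lambda> $ i) * w $ i)) (at t)"
    by (auto intro!: derivative_eq_intros has_vector_derivative_real_field simp: algebra_simps)
  then show "((\<lambda>x. diag_flow \<Lambda> x w $ i) has_derivative
        (\<lambda>v. (v *\<^sub>R diag_field \<Lambda> (diag_flow \<Lambda> t w)) $ i)) (at t)"
    by (simp add: has_vector_derivative_def)
qed

text \<open>The equation \<open>Dh(w)(\<Lambda>w) = \<Lambda>h(w) + g(w)\<close>, with the diagonal matrix that has the entries of \<open>\<Lambda>\<close>,
  is a linear ordinary differential equation for \<open>h\<close> along the orbits of \<open>\<Lambda>\<close>. Its solution that
  vanishes to second order at \<open>0\<close> comes from variation of constants.\<close>

definition homological :: "complex^'n \<Rightarrow> (complex^'n \<Rightarrow> complex^'n) \<Rightarrow> complex^'n \<Rightarrow> complex^'n" where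
  "homological \<Lambda> g w = - (\<integral>t. diag_flow \<Lambda> (- t) (g (diag_flow \<Lambda> t w)) \<partial>halfline)"

context
  fixes \<Lambda> :: "complex^'n" and r :: real
  assumes Re_diag: "\<And>i. Re (\<Lambda> $ i) = -1"
begin

lemma diag_flow_in_ball: "w \<in> ball 0 r \<Longrightarrow> 0 \<le> t \<Longrightarrow> diag_flow \<Lambda> t w \<in> ball 0 r"
  using mult_right_le_one_le[of "norm w" "exp (- t)"]
  by (simp add: norm_diag_flow[OF Re_diag] mult.commute)

text \<open>Going back along the flow costs the factor \<open>exp t\<close>, but the quadratic decay of \<open>g\<close> gains \<open>exp (- 2 t)\<close>.\<close>

lemma homological_integrand:
  fixes g :: "complex^'n \<Rightarrow> complex^'n"
  assumes g: "continuous_on (ball 0 r) g" and b: "\<And>w. w \<in> ball 0 r \<Longrightarrow> norm (g w) \<le> C * (norm w)\<^sup>2"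
    and w: "w \<in> ball 0 r"
  shows "(\<lambda>t. diag_flow \<Lambda> (- t) (g (diag_flow \<Lambda> t w))) \<in> borel_measurable halfline"
    and "0 \<le> t \<Longrightarrow> norm (diag_flow \<Lambda> (- t) (g (diag_flow \<Lambda> t w))) \<le> C * (norm w)\<^sup>2 * exp (- t)"
    and "integrable halfline (\<lambda>t. diag_flow \<Lambda> (- t) (g (diag_flow \<Lambda> t w)))"
    and "norm (homological \<Lambda> g w) \<le> C * (norm w)\<^sup>2"
proof -
  have E: "continuous_on A (\<lambda>t. diag_flow \<Lambda> t w)" for A
    using diag_flow_has_vector_derivative has_vector_derivative_continuous
    by (blast intro: continuous_at_imp_continuous_on)
  have "continuous_on {0..} (\<lambda>t. g (diag_flow \<Lambda> t w))"
    by (rule continuous_on_compose2[OF g E]) (use diag_flow_in_ball[OF w] in auto)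
  then have "continuous_on {0..} (\<lambda>t. diag_flow \<Lambda> (- t) (g (diag_flow \<Lambda> t w)))"
    unfolding diag_flow_def[of \<Lambda> "- _"] by (intro continuous_intros)
  then show m: "(\<lambda>t. diag_flow \<Lambda> (- t) (g (diag_flow \<Lambda> t w))) \<in> borel_measurable halfline"
    by (rule borel_measurable_halfline)
  show n: "norm (diag_flow \<Lambda> (- t) (g (diag_flow \<Lambda> t w))) \<le> C * (norm w)\<^sup>2 * exp (- t)" if "0 \<le> t" for t
  proof -
    have "norm (diag_flow \<Lambda> (- t) (g (diag_flow \<Lambda> t w))) = exp t * norm (g (diag_flow \<Lambda> t w))"
      by (simp add: norm_diag_flow[OF Re_diag])
    also have "\<dots> \<le> exp t * (C * (exp (- t) * norm w)\<^sup>2)"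
      using b[OF diag_flow_in_ball[OF w that]] by (simp add: norm_diag_flow[OF Re_diag])
    also have "\<dots> = C * (norm w)\<^sup>2 * exp (- t)"
      by (simp add: power_mult_distrib power2_eq_square exp_minus field_simps)
    finally show ?thesis .
  qed
  have e: "integrable halfline (\<lambda>t. C * (norm w)\<^sup>2 * exp (- t))"
    using integral_exp_minus_halfline(1) by simp
  show i: "integrable halfline (\<lambda>t. diag_flow \<Lambda> (- t) (g (diag_flow \<Lambda> t w)))"
    by (rule Bochner_Integration.integrable_bound[OF e m])
       (auto intro!: AE_I2 order.trans[OF n])
  show "norm (homological \<Lambda> g w) \<le> C * (norm w)\<^sup>2"
    unfolding homological_def norm_minus_cancel
    using norm_integral_le[OF i e n] integral_exp_minus_halfline(2) by simp
qed

lemma homological_diff: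
  fixes g1 g2 :: "complex^'n \<Rightarrow> complex^'n"
  assumes "continuous_on (ball 0 r) g1" "\<And>w. w \<in> ball 0 r \<Longrightarrow> norm (g1 w) \<le> C1 * (norm w)\<^sup>2"
    and "continuous_on (ball 0 r) g2" "\<And>w. w \<in> ball 0 r \<Longrightarrow> norm (g2 w) \<le> C2 * (norm w)\<^sup>2"
    and "\<And>w. w \<in> ball 0 r \<Longrightarrow> norm (g1 w - g2 w) \<le> C * (norm w)\<^sup>2"
    and w: "w \<in> ball 0 r"
  shows "norm (homological \<Lambda> g1 w - homological \<Lambda> g2 w) \<le> C * (norm w)\<^sup>2"
proof -
  have "diag_flow \<Lambda> s (x - y) = diag_flow \<Lambda> s x - diag_flow \<Lambda> s y" for s and x y :: "complex^'n"
    by (simp add: vec_eq_iff algebra_simps)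
  then have "homological \<Lambda> g1 w - homological \<Lambda> g2 w = homological \<Lambda> (\<lambda>w. g1 w - g2 w) w"
    using homological_integrand(3)[OF assms(1,2) w] homological_integrand(3)[OF assms(3,4) w]
    by (simp add: homological_def)
  then show ?thesis
    using homological_integrand(4)[OF continuous_on_diff[OF assms(1,3)] assms(5) w] by simp
qed

text \<open>Differentiating under the integral in the direction \<open>\<Lambda>w\<close> produces a total time derivative, whose integral is
  the value \<open>g w\<close> at time \<open>0\<close>.\<close>

lemma homological_solution:
  fixes g :: "complex^'n \<Rightarrow> complex^'n"
  assumes g: "holomorphic_map_on (ball 0 r) g" and b: "\<And>w. w \<in> ball 0 r \<Longrightarrow> norm (g w) \<le> C * (norm w)\<^sup>2"
  shows "holomorphic_map_on (ball 0 r) (homological \<Lambda> g)"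
    and "w \<in> ball 0 r \<Longrightarrow> frechet_derivative (homological \<Lambda> g) (at w) (diag_field \<Lambda> w)
            = diag_field \<Lambda> (homological \<Lambda> g w) + g w"
proof -
  note gc = holomorphic_map_on_imp_continuous_on[OF g]
  have gi1: "(\<lambda>t. diag_flow \<Lambda> (- t) (g (diag_flow \<Lambda> t w))) \<in> borel_measurable halfline"
    and gi2: "\<And>t. 0 \<le> t \<Longrightarrow> norm (diag_flow \<Lambda> (- t) (g (diag_flow \<Lambda> t w))) \<le> C * (norm w)\<^sup>2 * exp (- t)"
    and gi3: "integrable halfline (\<lambda>t. diag_flow \<Lambda> (- t) (g (diag_flow \<Lambda> t w)))"
    if "w \<in> ball 0 r" for w
    using homological_integrand[OF gc _ that] b by blast+
  define k where "k i t w = - (exp (- of_real t * \<Lambda> $ i) * g (diag_flow \<Lambda> t w) $ i)" for i t w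
  have k_alt: "k i t w = - (diag_flow \<Lambda> (- t) (g (diag_flow \<Lambda> t w)) $ i)" for i t w
    by (simp add: k_def)
  have nth: "homological \<Lambda> g w $ i = (\<integral>t. k i t w \<partial>halfline)" if "w \<in> ball 0 r" for w i
    using integral_bounded_linear[OF bounded_linear_vec_nth gi3[OF that], of i]
    by (simp add: homological_def k_alt)
  have maps: "diag_flow \<Lambda> t ` ball 0 r \<subseteq> ball 0 r" if "t \<in> space halfline" for t
    using diag_flow_in_ball that by (auto simp: space_restrict_space)
  have gcd: "cdiff_on (ball 0 r) (\<lambda>w. g w $ i)" for i
    using g by (simp add: holomorphic_map_on_iff)
  have k1: "cdiff_on (ball 0 r) (k i t)" if "t \<in> space halfline" for i t
  proof -
    have "cdiff_on (ball 0 r) (\<lambda>w. (- exp (- of_real t * \<Lambda> $ i)) * g (diag_flow \<Lambda> t w) $ i)"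
      by (intro cdiff_on_mult cdiff_on_const
          cdiff_on_compose(1)[OF gcd holomorphic_diag_flow maps[OF that]])
    then show ?thesis by (simp add: k_def[abs_def])
  qed
  have k2: "(\<lambda>t. k i t w) \<in> borel_measurable halfline" if "w \<in> ball 0 r" for i w
    unfolding k_alt
    by (rule borel_measurable_uminus, rule measurable_compose[OF gi1[OF that]],
        rule borel_measurable_continuous_onI[OF linear_continuous_on[OF bounded_linear_vec_nth]])
  have k3: "norm (k i t w) \<le> C * (norm w)\<^sup>2 * exp (- t)" if "t \<in> space halfline" "w \<in> ball 0 r" for i t w
    unfolding k_alt norm_minus_cancel
    by (rule order.trans[OF Finite_Cartesian_Product.norm_nth_le gi2[OF that(2)]])
       (use that(1) in \<open>simp add: space_restrict_space\<close>)
  have k3': "norm (k i t w) \<le> \<bar>C\<bar> * r\<^sup>2 * exp (- t)" if "t \<in> space halfline" "w \<in> ball 0 r" for i t w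
  proof -
    have "C * (norm w)\<^sup>2 \<le> \<bar>C\<bar> * r\<^sup>2"
      using that(2) by (intro mult_mono power_mono) auto
    from mult_right_mono[OF this, of "exp (- t)"] show ?thesis
      by (intro order.trans[OF k3[OF that]]) simp
  qed
  have e: "integrable halfline (\<lambda>t. \<bar>C\<bar> * r\<^sup>2 * exp (- t))"
    using integral_exp_minus_halfline(1) by simp
  have ci1: "cdiff_on (ball 0 r) (\<lambda>w. \<integral>t. k i t w \<partial>halfline)" for i
    by (rule cdiff_on_integral(1)[OF open_ball k1 k2 e k3'])
  have ci2: "integrable halfline (\<lambda>t. frechet_derivative (k i t) (at w) v)" if "w \<in> ball 0 r" for i w v
    by (rule cdiff_on_integral(2)[OF open_ball k1 k2 e k3' that])
  have ci3: "frechet_derivative (\<lambda>w. \<integral>t. k i t w \<partial>halfline) (at w) v =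
      (\<integral>t. frechet_derivative (k i t) (at w) v \<partial>halfline)" if "w \<in> ball 0 r" for i w v
    by (rule cdiff_on_integral(3)[OF open_ball k1 k2 e k3' that])
  have hnth: "cdiff_on (ball 0 r) (\<lambda>w. homological \<Lambda> g w $ i)" for i
    by (rule cdiff_on_cong_open[OF ci1 open_ball]) (use nth in auto)
  then show hol: "holomorphic_map_on (ball 0 r) (homological \<Lambda> g)"
    by (simp add: holomorphic_map_on_iff)
  assume w: "w \<in> ball 0 r"
  show "frechet_derivative (homological \<Lambda> g) (at w) (diag_field \<Lambda> w) = diag_field \<Lambda> (homological \<Lambda> g w) + g w"
  proof (subst vec_eq_iff, rule allI)
    fix i
    define k' where "k' t = frechet_derivative (k i t) (at w) (diag_field \<Lambda> w)" for t
    have k'_int: "integrable halfline k'"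
      unfolding k'_def using ci2[OF w] by simp
    have k_int: "integrable halfline (\<lambda>t. k i t w)"
      unfolding k_alt using integrable_bounded_linear[OF bounded_linear_vec_nth gi3[OF w]] by simp
    \<comment> \<open>The flow commutes with its generator, so the derivative of the integrand in the direction of
      the linear field is, up to the term coming from the exponential factor, its time derivative.\<close>
    have deriv: "((\<lambda>t. k i t w) has_vector_derivative (k' t - \<Lambda> $ i * k i t w)) (at t within {0..})"
      if t: "0 \<le> t" for t
    proof -
      have tN: "t \<in> space halfline" using t by (simp add: space_restrict_space)
      have Ew: "diag_flow \<Lambda> t w \<in> ball 0 r" by (rule diag_flow_in_ball[OF w t])
      define G where "G = frechet_derivative (\<lambda>w. g w $ i) (at (diag_flow \<Lambda> t w))"
      have G: "((\<lambda>w. g w $ i) has_derivative G) (at (diag_flow \<Lambda> t w))"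
        unfolding G_def by (rule cdiff_on_derivative(1)[OF gcd Ew])
      have "((\<lambda>t. g (diag_flow \<Lambda> t w) $ i) has_derivative (\<lambda>s. G (s *\<^sub>R diag_field \<Lambda> (diag_flow \<Lambda> t w)))) (at t)"
        by (rule has_derivative_compose[OF diag_flow_has_vector_derivative[unfolded has_vector_derivative_def] G])
      then have gd: "((\<lambda>t. g (diag_flow \<Lambda> t w) $ i) has_vector_derivative G (diag_field \<Lambda> (diag_flow \<Lambda> t w))) (at t)"
        unfolding has_vector_derivative_def by (simp add: linear_scale[OF has_derivative_linear[OF G]])
      have ed: "((\<lambda>t. - exp (- of_real t * \<Lambda> $ i)) has_vector_derivative \<Lambda> $ i * exp (- of_real t * \<Lambda> $ i)) (at t)"
        by (auto intro!: derivative_eq_intros has_vector_derivative_real_field simp: algebra_simps)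
      have "((\<lambda>t. (- exp (- of_real t * \<Lambda> $ i)) * g (diag_flow \<Lambda> t w) $ i) has_vector_derivative
          ((- exp (- of_real t * \<Lambda> $ i)) * G (diag_field \<Lambda> (diag_flow \<Lambda> t w))
            + \<Lambda> $ i * exp (- of_real t * \<Lambda> $ i) * g (diag_flow \<Lambda> t w) $ i)) (at t)"
        by (rule has_vector_derivative_mult[OF ed gd])
      moreover have "k' t = (- exp (- of_real t * \<Lambda> $ i)) * G (diag_field \<Lambda> (diag_flow \<Lambda> t w))"
      proof -
        have c: "cdiff_on (ball 0 r) (\<lambda>w. g (diag_flow \<Lambda> t w) $ i)"
          by (rule cdiff_on_compose(1)[OF gcd holomorphic_diag_flow maps[OF tN]])
        have "((\<lambda>w. (- exp (- of_real t * \<Lambda> $ i)) * g (diag_flow \<Lambda> t w) $ i) has_derivative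
           (\<lambda>v. (- exp (- of_real t * \<Lambda> $ i)) * frechet_derivative (\<lambda>w. g (diag_flow \<Lambda> t w) $ i) (at w) v)) (at w)"
          by (rule has_derivative_mult_right[OF cdiff_on_derivative(1)[OF c w]])
        from fun_cong[OF frechet_derivative_at[OF this], of "diag_field \<Lambda> w"]
        have "k' t = (- exp (- of_real t * \<Lambda> $ i)) * frechet_derivative (\<lambda>w. g (diag_flow \<Lambda> t w) $ i) (at w) (diag_field \<Lambda> w)"
          by (simp add: k'_def k_def[abs_def])
        also have "frechet_derivative (\<lambda>w. g (diag_flow \<Lambda> t w) $ i) (at w) (diag_field \<Lambda> w)
            = G (diag_flow \<Lambda> t (diag_field \<Lambda> w))"
          unfolding G_def
          by (subst cdiff_on_compose(2)[OF gcd holomorphic_diag_flow maps[OF tN] w])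
             (simp add: frechet_derivative_diag_flow)
        also have "diag_flow \<Lambda> t (diag_field \<Lambda> w) = diag_field \<Lambda> (diag_flow \<Lambda> t w)"
          by (simp add: vec_eq_iff)
        finally show ?thesis .
      qed
      moreover have "(\<lambda>t. (- exp (- of_real t * \<Lambda> $ i)) * g (diag_flow \<Lambda> t w) $ i) = (\<lambda>t. k i t w)"
        by (simp add: k_def)
      moreover have "k' t - \<Lambda> $ i * k i t w
          = k' t + \<Lambda> $ i * exp (- of_real t * \<Lambda> $ i) * g (diag_flow \<Lambda> t w) $ i"
        by (simp add: k_def)
      ultimately show ?thesis
        by (metis has_vector_derivative_at_within)
    qed
    have "(LINT t:{0..}|lborel. k' t - \<Lambda> $ i * k i t w) = 0 - k i 0 w"
    proof (rule integral_FTC_halfline[OF deriv])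
      show "set_integrable lborel {0..} (\<lambda>t. k' t - \<Lambda> $ i * k i t w)"
        unfolding set_integrable_def
        by (subst integrable_restrict_space[symmetric]) (use k'_int k_int in auto)
      have "((\<lambda>t. C * (norm w)\<^sup>2 * exp (- t)) \<longlongrightarrow> C * (norm w)\<^sup>2 * 0) at_top"
        by (intro tendsto_mult tendsto_const filterlim_compose[OF exp_at_bot filterlim_uminus_at_bot_at_top])
      then have z: "((\<lambda>t. C * (norm w)\<^sup>2 * exp (- t)) \<longlongrightarrow> 0) at_top" by simp
      show "((\<lambda>t. k i t w) \<longlongrightarrow> 0) at_top"
        by (rule Lim_null_comparison[OF eventually_mono[OF eventually_ge_at_top[of 0]] z])
           (use k3[OF _ w] in \<open>auto simp: space_restrict_space\<close>)
    qed
    moreover have "(LINT t:{0..}|lborel. k' t - \<Lambda> $ i * k i t w)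
        = (\<integral>t. k' t \<partial>halfline) - \<Lambda> $ i * (\<integral>t. k i t w \<partial>halfline)"
      unfolding set_lebesgue_integral_def
      by (subst integral_restrict_space[symmetric]) (use k'_int k_int in auto)
    moreover have "k i 0 w = - g w $ i"
      by (simp add: k_def) (simp add: diag_flow_def)
    moreover have "frechet_derivative (homological \<Lambda> g) (at w) (diag_field \<Lambda> w) $ i = (\<integral>t. k' t \<partial>halfline)"
    proof -
      have "((\<lambda>w. \<integral>t. k i t w \<partial>halfline) has_derivative
          frechet_derivative (\<lambda>w. \<integral>t. k i t w \<partial>halfline) (at w)) (at w)"
        by (rule cdiff_on_derivative(1)[OF ci1 w])
      then have "((\<lambda>w. homological \<Lambda> g w $ i) has_derivative
          frechet_derivative (\<lambda>w. \<integral>t. k i t w \<partial>halfline) (at w)) (at w)"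
        by (rule has_derivative_transform_within_open[OF _ open_ball w]) (simp add: nth)
      from fun_cong[OF frechet_derivative_at[OF this, symmetric], of "diag_field \<Lambda> w"]
      show ?thesis
        unfolding frechet_derivative_nth[OF hol w] k'_def ci3[OF w] .
    qed
    ultimately show "frechet_derivative (homological \<Lambda> g) (at w) (diag_field \<Lambda> w) $ i
        = (diag_field \<Lambda> (homological \<Lambda> g w) + g w) $ i"
      by (simp add: nth[OF w] diff_eq_eq add.commute)
  qed
qed

end

lemma vec_expand_axis:
  fixes v :: "complex^'n"
  shows "v = (\<Sum>j\<in>UNIV. v $ j *s axis j 1)"
  by (simp add: vec_eq_iff axis_def if_distrib cong: if_cong)

lemma norm_le_card_mult:
  fixes v :: "complex^'n" and B :: real
  assumes "\<And>i. norm (v $ i) \<le> B"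
  shows "norm v \<le> CARD('n) * B"
proof -
  have "norm v \<le> (\<Sum>i\<in>UNIV. norm (v $ i))"
    unfolding norm_vec_def by (rule L2_set_le_sum) simp
  also have "\<dots> \<le> (\<Sum>i\<in>(UNIV::'n set). B)"
    by (rule sum_mono) (rule assms)
  finally show ?thesis by simp
qed

text \<open>Cauchy's estimate turns quadratic decay into a Lipschitz constant that tends to \<open>0\<close> with the
  radius; this is why both the fixed point equation below is contracting and its solution is a small
  perturbation of the identity.\<close>

lemma quadratic_imp_small_derivative:
  fixes f :: "complex^'m \<Rightarrow> complex^'n" and C s :: real
  assumes f: "holomorphic_map_on (ball 0 R) f" and s: "0 < s" "2 * s \<le> R"
    and b: "\<And>w. w \<in> ball 0 R \<Longrightarrow> norm (f w) \<le> C * (norm w)\<^sup>2" and C: "0 \<le> C"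
  shows "x \<in> ball 0 s \<Longrightarrow> norm (frechet_derivative f (at x) v) \<le> 4 * CARD('n) * C * s * norm v"
    and "x \<in> ball 0 s \<Longrightarrow> y \<in> ball 0 s \<Longrightarrow> norm (f x - f y) \<le> 4 * CARD('n) * C * s * norm (x - y)"
proof -
  have d: "norm (frechet_derivative f (at x) v) \<le> 4 * CARD('n) * C * s * norm v" if x: "x \<in> ball 0 s" for x v
  proof -
    have sub: "cball x s \<subseteq> ball 0 (2 * s)"
    proof
      fix z assume "z \<in> cball x s"
      then show "z \<in> ball 0 (2 * s)" using x norm_triangle_ineq2[of z x] by (simp add: dist_norm norm_minus_commute)
    qed
    have xR: "x \<in> ball 0 R" using x s by simp
    have "norm (frechet_derivative f (at x) v) \<le> CARD('n) * ((C * (2 * s)\<^sup>2) * norm v / s)"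
    proof (rule norm_le_card_mult)
      fix i
      have "norm (frechet_derivative (\<lambda>z. f z $ i) (at x) v) \<le> (C * (2 * s)\<^sup>2) * norm v / s"
      proof (rule cdiff_on_Cauchy_estimate[where U="ball 0 R"])
        show "cdiff_on (ball 0 R) (\<lambda>z. f z $ i)" using f by (simp add: holomorphic_map_on_iff)
        show "cball x s \<subseteq> ball 0 R" using sub s by (auto simp: subset_iff)
        fix z assume "z \<in> cball x s"
        then have z: "norm z < 2 * s" using sub by auto
        have "norm (f z $ i) \<le> C * (norm z)\<^sup>2"
          using z s by (intro order.trans[OF Finite_Cartesian_Product.norm_nth_le b]) simp
        also have "\<dots> \<le> C * (2 * s)\<^sup>2" using z C by (intro mult_left_mono power_mono) auto
        finally show "norm (f z $ i) \<le> C * (2 * s)\<^sup>2" .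
      qed (rule s)
      then show "norm (frechet_derivative f (at x) v $ i) \<le> (C * (2 * s)\<^sup>2) * norm v / s"
        by (simp add: frechet_derivative_nth[OF f xR])
    qed
    also have "\<dots> = 4 * CARD('n) * C * s * norm v" using s by (simp add: power2_eq_square)
    finally show ?thesis .
  qed
  then show "x \<in> ball 0 s \<Longrightarrow> norm (frechet_derivative f (at x) v) \<le> 4 * CARD('n) * C * s * norm v" .
  assume x: "x \<in> ball 0 s" and y: "y \<in> ball 0 s"
  show "norm (f x - f y) \<le> 4 * CARD('n) * C * s * norm (x - y)"
  proof (rule differentiable_bound[OF convex_ball _ _ x y])
    fix z :: "complex^'m" assume z: "z \<in> ball 0 s"
    then have "z \<in> ball 0 R" using s by simp
    then show "(f has_derivative frechet_derivative f (at z)) (at z within ball 0 s)"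
      by (rule has_derivative_at_withinI[OF holomorphic_map_on_derivative(1)[OF f]])
    show "onorm (frechet_derivative f (at z)) \<le> 4 * CARD('n) * C * s"
      by (rule onorm_le) (rule d[OF z])
  qed
qed

text \<open>The nonlinear equation is the fixed point equation \<open>h = homological \<Lambda> (\<lambda>w. f (w + h w))\<close>, which
  Picard iteration solves.\<close>

proposition nonlinear_homological_equation:
  fixes f :: "complex^'n \<Rightarrow> complex^'n" and C R :: real
  assumes \<Lambda>: "\<And>i. Re (\<Lambda> $ i) = -1" and f: "holomorphic_map_on (ball 0 R) f" and R: "0 < R"
    and b: "\<And>w. w \<in> ball 0 R \<Longrightarrow> norm (f w) \<le> C * (norm w)\<^sup>2" and C: "0 < C"
  obtains r h where "0 < r" "holomorphic_map_on (ball 0 r) h"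
    "\<And>w. w \<in> ball 0 r \<Longrightarrow> norm (h w) \<le> 4 * C * (norm w)\<^sup>2"
    "\<And>w. w \<in> ball 0 r \<Longrightarrow> w + h w \<in> ball 0 R"
    "\<And>w. w \<in> ball 0 r \<Longrightarrow> frechet_derivative h (at w) (diag_field \<Lambda> w) = diag_field \<Lambda> (h w) + f (w + h w)"
proof -
  define N where "N = real CARD('n)"
  have N: "1 \<le> N" by (simp add: N_def Suc_le_eq)
  \<comment> \<open>On the ball of radius \<open>s\<close> the map \<open>f\<close> has the Lipschitz constant \<open>1 / 2\<close>; half this radius
    leaves room for \<open>w + h w\<close>.\<close>
  define s where "s = min (R / 2) (1 / (8 * N * C))"
  have s: "0 < s" "2 * s \<le> R" using R C N by (auto simp: s_def)
  have "s \<le> 1 / (8 * N * C)" by (simp add: s_def)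
  then have sC: "8 * N * C * s \<le> 1" using C N by (simp add: field_simps)
  have L: "norm (f x - f y) \<le> norm (x - y) / 2" if "x \<in> ball 0 s" "y \<in> ball 0 s" for x y
  proof -
    have "norm (f x - f y) \<le> 4 * N * C * s * norm (x - y)"
      using quadratic_imp_small_derivative(2)[OF f s b _ that] C by (simp add: N_def)
    also have "\<dots> \<le> 1 / 2 * norm (x - y)" using sC by (intro mult_right_mono) auto
    finally show ?thesis by simp
  qed
  define r where "r = s / 2"
  have r: "0 < r" using s by (simp add: r_def)
  have rC: "4 * C * norm w \<le> 1" if "w \<in> ball 0 r" for w :: "complex^'n"
  proof -
    have "norm w \<le> s" using that s by (simp add: r_def)
    then have "4 * C * norm w \<le> 4 * C * s" using C by (intro mult_left_mono) auto
    also have "\<dots> \<le> 8 * N * C * s" using C s N by (intro mult_right_mono) auto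
    also have "\<dots> \<le> 1" by (rule sC)
    finally show ?thesis .
  qed
  have in_s: "w + x \<in> ball 0 s" if "w \<in> ball 0 r" "norm x \<le> norm w" for w x :: "complex^'n"
    using that norm_triangle_ineq[of w x] by (simp add: r_def)
  have sR: "ball (0::complex^'n) s \<subseteq> ball 0 R" using s by auto
  define g where "g h w = f (w + h w)" for h :: "complex^'n \<Rightarrow> complex^'n" and w
  have g: "holomorphic_map_on (ball 0 r) (g h)" "\<And>w. w \<in> ball 0 r \<Longrightarrow> norm (g h w) \<le> 4 * C * (norm w)\<^sup>2"
    if h: "holomorphic_map_on (ball 0 r) h" "\<And>w. w \<in> ball 0 r \<Longrightarrow> norm (h w) \<le> norm w" for h
  proof -
    have "holomorphic_map_on (ball 0 r) (\<lambda>w. w + h w)"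
      using h(1) by (auto simp: holomorphic_map_on_iff intro!: cdiff_on_add cdiff_on_coord)
    then show "holomorphic_map_on (ball 0 r) (g h)"
      unfolding g_def using in_s h(2) sR
      by (intro holomorphic_map_on_compose(1)[OF f]) blast+
    show "norm (g h w) \<le> 4 * C * (norm w)\<^sup>2" if w: "w \<in> ball 0 r" for w
    proof -
      have "norm (g h w) \<le> C * (norm (w + h w))\<^sup>2"
        unfolding g_def using in_s[OF w h(2)[OF w]] sR by (intro b) blast
      also have "\<dots> \<le> C * (2 * norm w)\<^sup>2"
        using C h(2)[OF w] norm_triangle_ineq[of w "h w"] by (intro mult_left_mono power_mono) auto
      finally show ?thesis by (simp add: power_mult_distrib)
    qed
  qed
  have quad: "norm x \<le> norm w" if "norm x \<le> 4 * C * (norm w)\<^sup>2" "w \<in> ball 0 r" for x w :: "complex^'n"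
    using that(1) mult_right_mono[OF rC[OF that(2)] norm_ge_zero[of w]] by (simp add: power2_eq_square mult_ac)
  define hs where "hs = rec_nat (\<lambda>_. 0) (\<lambda>_ h. homological \<Lambda> (g h))"
  have hs_simps: "hs 0 = (\<lambda>_. 0)" "hs (Suc k) = homological \<Lambda> (g (hs k))" for k
    by (simp_all add: hs_def)
  have hs: "holomorphic_map_on (ball 0 r) (hs k) \<and> (\<forall>w\<in>ball 0 r. norm (hs k w) \<le> 4 * C * (norm w)\<^sup>2)" for k
  proof (induction k)
    case 0
    show ?case using C by (simp add: hs_simps holomorphic_map_on_iff)
  next
    case (Suc k)
    then have "holomorphic_map_on (ball 0 r) (hs k)" "\<And>w. w \<in> ball 0 r \<Longrightarrow> norm (hs k w) \<le> norm w"
      using quad by blast+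
    note gk = g[OF this]
    show ?case
      unfolding hs_simps
      using homological_solution(1)[OF \<Lambda> gk]
        homological_integrand(4)[OF \<Lambda> holomorphic_map_on_imp_continuous_on[OF gk(1)] gk(2)] by blast
  qed
  have hs1: "holomorphic_map_on (ball 0 r) (hs k)" for k using hs by blast
  have hs2: "norm (hs k w) \<le> norm w" if "w \<in> ball 0 r" for k w using hs quad that by blast
  have contr: "norm (homological \<Lambda> (g h) w - homological \<Lambda> (g h') w) \<le> B / 2 * (norm w)\<^sup>2"
    if h: "holomorphic_map_on (ball 0 r) h" "\<And>w. w \<in> ball 0 r \<Longrightarrow> norm (h w) \<le> norm w"
    and h': "holomorphic_map_on (ball 0 r) h'" "\<And>w. w \<in> ball 0 r \<Longrightarrow> norm (h' w) \<le> norm w"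
    and B: "\<And>w. w \<in> ball 0 r \<Longrightarrow> norm (h w - h' w) \<le> B * (norm w)\<^sup>2" and w: "w \<in> ball 0 r"
    for h h' B w
  proof (rule homological_diff[OF \<Lambda> holomorphic_map_on_imp_continuous_on[OF g(1)[OF h]] g(2)[OF h]
      holomorphic_map_on_imp_continuous_on[OF g(1)[OF h']] g(2)[OF h'] _ w])
    fix w :: "complex^'n" assume w: "w \<in> ball 0 r"
    have "norm (g h w - g h' w) \<le> norm ((w + h w) - (w + h' w)) / 2"
      unfolding g_def by (rule L) (use in_s w h(2) h'(2) in blast)+
    also have "\<dots> \<le> B / 2 * (norm w)\<^sup>2" using B[OF w] by simp
    finally show "norm (g h w - g h' w) \<le> B / 2 * (norm w)\<^sup>2" .
  qed
  have step: "norm (hs (Suc k) w - hs k w) \<le> 4 * C * (1/2) ^ k * (norm w)\<^sup>2" if "w \<in> ball 0 r" for k w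
    using that
  proof (induction k arbitrary: w)
    case 0
    then show ?case using hs[of "Suc 0"] by (simp add: hs_simps(1))
  next
    case (Suc k)
    have "norm (homological \<Lambda> (g (hs (Suc k))) w - homological \<Lambda> (g (hs k)) w)
        \<le> (4 * C * (1/2) ^ k) / 2 * (norm w)\<^sup>2"
      by (rule contr[OF hs1 hs2 hs1 hs2 Suc.IH Suc.prems])
    then have "norm (hs (Suc (Suc k)) w - hs (Suc k) w) \<le> (4 * C * (1/2) ^ k) / 2 * (norm w)\<^sup>2"
      by (simp only: hs_simps(2)[symmetric])
    then show ?case by simp
  qed
  have tail: "norm (hs (m + k) w - hs k w) \<le> 8 * C * (1/2) ^ k * (1 - (1/2) ^ m) * (norm w)\<^sup>2"
    if w: "w \<in> ball 0 r" for k m w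
  proof (induction m)
    case (Suc m)
    have "norm (hs (Suc m + k) w - hs k w) \<le> norm (hs (Suc (m + k)) w - hs (m + k) w) + norm (hs (m + k) w - hs k w)"
      using norm_triangle_ineq[of "hs (Suc (m + k)) w - hs (m + k) w" "hs (m + k) w - hs k w"] by simp
    also have "\<dots> \<le> 4 * C * (1/2) ^ (m + k) * (norm w)\<^sup>2 + 8 * C * (1/2) ^ k * (1 - (1/2) ^ m) * (norm w)\<^sup>2"
      by (intro add_mono step[OF w] Suc.IH)
    also have "\<dots> = 8 * C * (1/2) ^ k * (1 - (1/2) ^ Suc m) * (norm w)\<^sup>2"
      by (simp add: algebra_simps power_add)
    finally show ?case .
  qed simp
  define h0 where "h0 w = (\<Sum>k. hs (Suc k) w - hs k w)" for w
  have lim: "(\<lambda>k. hs k w) \<longlonglongrightarrow> h0 w" if w: "w \<in> ball 0 r" for w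
  proof -
    have sg: "summable (\<lambda>k. 4 * C * (1/2) ^ k * (norm w)\<^sup>2)"
      by (intro summable_mult summable_mult2 summable_geometric) simp
    have "summable (\<lambda>k. hs (Suc k) w - hs k w)"
      by (rule summable_comparison_test'[OF sg]) (use step[OF w] in blast)
    then have "(\<lambda>n. \<Sum>k<n. hs (Suc k) w - hs k w) \<longlonglongrightarrow> h0 w"
      unfolding h0_def by (rule summable_LIMSEQ)
    then show ?thesis by (simp add: sum_lessThan_telescope[of "\<lambda>k. hs k w"] hs_simps(1))
  qed
  have h0_tail: "norm (h0 w - hs k w) \<le> 8 * C * (1/2) ^ k * (norm w)\<^sup>2" if w: "w \<in> ball 0 r" for k w
  proof (rule Lim_norm_ubound[OF trivial_limit_sequentially])
    show "(\<lambda>m. hs (m + k) w - hs k w) \<longlonglongrightarrow> h0 w - hs k w"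
      by (intro tendsto_diff tendsto_const LIMSEQ_ignore_initial_segment lim[OF w])
    have "8 * C * (1/2) ^ k * (1 - (1/2) ^ m) * (norm w)\<^sup>2 \<le> 8 * C * (1/2) ^ k * 1 * (norm w)\<^sup>2" for m
      using C by (intro mult_right_mono mult_left_mono) auto
    then show "\<forall>\<^sub>F m in sequentially. norm (hs (m + k) w - hs k w) \<le> 8 * C * (1/2) ^ k * (norm w)\<^sup>2"
      using order.trans[OF tail[OF w, of _ k]] by (intro always_eventually) simp
  qed
  have h0_hol: "holomorphic_map_on (ball 0 r) h0"
    unfolding holomorphic_map_on_iff
  proof
    fix i
    show "cdiff_on (ball 0 r) (\<lambda>w. h0 w $ i)"
    proof (rule cdiff_on_limit[where f="\<lambda>k w. hs k w $ i"])
      show "cdiff_on (ball 0 r) (\<lambda>w. hs k w $ i)" for k using hs1[of k] by (simp add: holomorphic_map_on_iff)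
      show "summable (\<lambda>k. 4 * C * (1/2) ^ k * r\<^sup>2)"
        by (intro summable_mult summable_mult2 summable_geometric) simp
      show "norm (hs (Suc k) w $ i - hs k w $ i) \<le> 4 * C * (1/2) ^ k * r\<^sup>2" if w: "w \<in> ball 0 r" for k w
      proof -
        have "norm (hs (Suc k) w $ i - hs k w $ i) \<le> 4 * C * (1/2) ^ k * (norm w)\<^sup>2"
          using order.trans[OF Finite_Cartesian_Product.norm_nth_le[of "hs (Suc k) w - hs k w" i] step[OF w]] by simp
        also have "\<dots> \<le> 4 * C * (1/2) ^ k * r\<^sup>2" using C w by (intro mult_left_mono power_mono) auto
        finally show ?thesis .
      qed
      show "(\<lambda>k. hs k w $ i) \<longlonglongrightarrow> h0 w $ i" if "w \<in> ball 0 r" for w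
        by (rule tendsto_vec_nth[OF lim[OF that]])
    qed simp
  qed
  have h0_le: "norm (h0 w) \<le> norm w" if w: "w \<in> ball 0 r" for w
    by (rule Lim_norm_ubound[OF trivial_limit_sequentially lim[OF w]]) (simp add: hs2[OF w])
  define h where "h = homological \<Lambda> (g h0)"
  have fixp: "h w = h0 w" if w: "w \<in> ball 0 r" for w
  proof -
    have "norm (h0 w - h w) \<le> 8 * C * (norm w)\<^sup>2 * (1/2) ^ k" for k
    proof -
      have "norm (h0 w - h w) \<le> norm (h0 w - hs (Suc k) w) + norm (h w - hs (Suc k) w)"
        using norm_triangle_ineq4[of "h0 w - hs (Suc k) w" "h w - hs (Suc k) w"] by simp
      also have "\<dots> \<le> 8 * C * (1/2) ^ Suc k * (norm w)\<^sup>2 + (8 * C * (1/2) ^ k) / 2 * (norm w)\<^sup>2"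
        unfolding h_def
        by (intro add_mono h0_tail[OF w], subst hs_simps(2)) (rule contr[OF h0_hol h0_le hs1 hs2 h0_tail w])
      finally show ?thesis by simp
    qed
    moreover have "(\<lambda>k. 8 * C * (norm w)\<^sup>2 * (1/2) ^ k) \<longlonglongrightarrow> 8 * C * (norm w)\<^sup>2 * 0"
      by (intro tendsto_mult tendsto_const LIMSEQ_power_zero) simp
    ultimately have "norm (h0 w - h w) \<le> 0"
      by (intro LIMSEQ_le_const[where X="\<lambda>k. 8 * C * (norm w)\<^sup>2 * (1/2) ^ k"]) auto
    then show ?thesis by simp
  qed
  note gh0 = g[OF h0_hol h0_le]
  show ?thesis
  proof (rule that[OF r])
    show "holomorphic_map_on (ball 0 r) h"
      unfolding h_def by (rule homological_solution(1)[OF \<Lambda> gh0])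
    show "norm (h w) \<le> 4 * C * (norm w)\<^sup>2" if "w \<in> ball 0 r" for w
      unfolding h_def
      by (rule homological_integrand(4)[OF \<Lambda> holomorphic_map_on_imp_continuous_on[OF gh0(1)] gh0(2) that])
    show "w + h w \<in> ball 0 R" if "w \<in> ball 0 r" for w
      using in_s[OF that h0_le[OF that]] sR fixp[OF that] by auto
    show "frechet_derivative h (at w) (diag_field \<Lambda> w) = diag_field \<Lambda> (h w) + f (w + h w)" if "w \<in> ball 0 r" for w
      using homological_solution(2)[OF \<Lambda> gh0 that, folded h_def] by (simp only: g_def fixp[OF that])
  qed
qed

text \<open>The conjugacy is \<open>w \<mapsto> w + h w\<close>. It is injective with injective derivative on a small ball, since there \<open>h\<close> has the
  Lipschitz constant \<open>1 / 2\<close>.\<close>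

proposition Poincare_linearization:
  fixes Y :: "complex^'n \<Rightarrow> complex^'n" and C R :: real
  assumes \<Lambda>: "\<And>i. Re (\<Lambda> $ i) = -1" and Y: "holomorphic_map_on (ball 0 R) Y" and R: "0 < R"
    and b: "\<And>w. w \<in> ball 0 R \<Longrightarrow> norm (Y w - diag_field \<Lambda> w) \<le> C * (norm w)\<^sup>2" and C: "0 < C"
  obtains r H where "0 < r" "holomorphic_map_on (ball 0 r) H" "H 0 = 0" "H ` ball 0 r \<subseteq> ball 0 R"
    "inj_on H (ball 0 r)"
    "\<And>w v. w \<in> ball 0 r \<Longrightarrow> frechet_derivative H (at w) v = 0 \<Longrightarrow> v = 0"
    "\<And>w. w \<in> ball 0 r \<Longrightarrow> frechet_derivative H (at w) (diag_field \<Lambda> w) = Y (H w)"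
proof -
  have lin: "holomorphic_map_on (ball 0 R) (diag_field \<Lambda>)"
    by (simp add: holomorphic_map_on_iff cdiff_on_mult cdiff_on_coord)
  have f: "holomorphic_map_on (ball 0 R) (\<lambda>w. Y w - diag_field \<Lambda> w)"
    using Y lin by (simp add: holomorphic_map_on_iff cdiff_on_diff)
  obtain r0 h where r0: "0 < r0" and h: "holomorphic_map_on (ball 0 r0) h"
    and hb: "\<And>w. w \<in> ball 0 r0 \<Longrightarrow> norm (h w) \<le> 4 * C * (norm w)\<^sup>2"
    and hR: "\<And>w. w \<in> ball 0 r0 \<Longrightarrow> w + h w \<in> ball 0 R"
    and hd: "\<And>w. w \<in> ball 0 r0 \<Longrightarrow> frechet_derivative h (at w) (diag_field \<Lambda> w)
        = diag_field \<Lambda> (h w) + (Y (w + h w) - diag_field \<Lambda> (w + h w))"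
    using nonlinear_homological_equation[OF \<Lambda> f R b C] by blast
  define N where "N = real CARD('n)"
  have N: "1 \<le> N" by (simp add: N_def Suc_le_eq)
  define r where "r = min (r0 / 2) (1 / (32 * N * C))"
  have r: "0 < r" "2 * r \<le> r0" using r0 C N by (auto simp: r_def)
  have "r \<le> 1 / (32 * N * C)" by (simp add: r_def)
  then have small: "4 * N * (4 * C) * r \<le> 1 / 2" using C N by (simp add: field_simps)
  have sub: "ball (0::complex^'n) r \<subseteq> ball 0 r0" using r by auto
  have C4: "0 \<le> 4 * C" using C by simp
  have hd_small: "norm (frechet_derivative h (at w) v) \<le> norm v / 2" if "w \<in> ball 0 r" for w v
  proof -
    have "norm (frechet_derivative h (at w) v) \<le> 4 * CARD('n) * (4 * C) * r * norm v"
      by (rule quadratic_imp_small_derivative(1)[OF h r _ C4 that]) (rule hb)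
    also have "\<dots> \<le> 1 / 2 * norm v" using mult_right_mono[OF small, of "norm v"] by (simp add: N_def)
    finally show ?thesis by simp
  qed
  have h_lip: "norm (h x - h y) \<le> norm (x - y) / 2" if "x \<in> ball 0 r" "y \<in> ball 0 r" for x y
  proof -
    have "norm (h x - h y) \<le> 4 * CARD('n) * (4 * C) * r * norm (x - y)"
      by (rule quadratic_imp_small_derivative(2)[OF h r _ C4 that]) (rule hb)
    also have "\<dots> \<le> 1 / 2 * norm (x - y)" using mult_right_mono[OF small, of "norm (x - y)"] by (simp add: N_def)
    finally show ?thesis by simp
  qed
  define H where "H w = w + h w" for w
  have Hd: "frechet_derivative H (at w) v = v + frechet_derivative h (at w) v" if "w \<in> ball 0 r" for w v
  proof -
    have "(H has_derivative (\<lambda>v. v + frechet_derivative h (at w) v)) (at w)"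
      unfolding H_def using that sub
      by (intro has_derivative_add has_derivative_ident holomorphic_map_on_derivative(1)[OF h]) blast
    from fun_cong[OF frechet_derivative_at[OF this, symmetric]] show ?thesis .
  qed
  show ?thesis
  proof (rule that[OF r(1)])
    show "holomorphic_map_on (ball 0 r) H"
      using holomorphic_map_on_subset[OF h sub]
      by (simp add: H_def holomorphic_map_on_iff cdiff_on_add cdiff_on_coord)
    show "H 0 = 0" using hb[of 0] r0 by (simp add: H_def)
    show "H ` ball 0 r \<subseteq> ball 0 R" using hR sub by (auto simp: H_def)
    show "inj_on H (ball 0 r)"
    proof (rule inj_onI)
      fix x y assume xy: "x \<in> ball 0 r" "y \<in> ball 0 r" "H x = H y"
      then have "x - y = - (h x - h y)" by (simp add: H_def algebra_simps)
      then have "norm (x - y) \<le> norm (x - y) / 2" using h_lip[OF xy(1,2)] by (metis norm_minus_cancel)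
      then show "x = y" by simp
    qed
    show "v = 0" if w: "w \<in> ball 0 r" and z: "frechet_derivative H (at w) v = 0" for w v
    proof -
      have "norm v = norm (frechet_derivative h (at w) v)"
        using z unfolding Hd[OF w] by (metis add.inverse_unique norm_minus_cancel)
      then show ?thesis using hd_small[OF w, of v] by simp
    qed
    show "frechet_derivative H (at w) (diag_field \<Lambda> w) = Y (H w)" if w: "w \<in> ball 0 r" for w
    proof -
      have "diag_field \<Lambda> (w + h w) = diag_field \<Lambda> w + diag_field \<Lambda> (h w)"
        by (simp add: vec_eq_iff algebra_simps)
      then show ?thesis using hd[of w] w sub unfolding Hd[OF w] by (simp add: H_def subset_iff)
    qed
  qed
qed

text \<open>Invariance of domain makes the inverse continuous, hence differentiable where the derivative of \<open>K\<close> is injective.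
  The inverse of a complex linear bijection is complex linear.\<close>

lemma holomorphic_inverse:
  fixes K :: "complex^'n \<Rightarrow> complex^'n"
  assumes "open D" and K: "holomorphic_map_on D K" and inj: "inj_on K D"
    and nondeg: "\<And>w v. w \<in> D \<Longrightarrow> frechet_derivative K (at w) v = 0 \<Longrightarrow> v = 0"
  shows "open (K ` D)" and "holomorphic_map_on (K ` D) (inv_into D K)"
    and "w \<in> D \<Longrightarrow> frechet_derivative (inv_into D K) (at (K w)) (frechet_derivative K (at w) v) = v"
proof -
  note cont = holomorphic_map_on_imp_continuous_on[OF K]
  show op: "open (K ` D)" by (rule invariance_of_domain[OF cont \<open>open D\<close> inj])
  have contg: "continuous_on (K ` D) (inv_into D K)"
    by (rule continuous_on_inverse_open[OF \<open>open D\<close> cont order_refl inv_into_f_f[OF inj]])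
  have ex: "\<exists>g'. (inv_into D K has_derivative g') (at (K w)) \<and> (\<forall>c v. g' (c *s v) = c *s g' v)
      \<and> (\<forall>v. g' (frechet_derivative K (at w) v) = v)" if w: "w \<in> D" for w
  proof -
    define f' where "f' = frechet_derivative K (at w)"
    have d: "(K has_derivative f') (at w)" unfolding f'_def by (rule holomorphic_map_on_derivative(1)[OF K w])
    have lin: "linear f'" by (rule has_derivative_linear[OF d])
    have injf: "inj f'"
      using nondeg[OF w] linear_injective_0[OF lin] by (auto simp: f'_def)
    obtain g' where g': "linear g'" "g' \<circ> f' = id" using linear_injective_left_inverse[OF lin injf] by blast
    have surjf: "surj f'" by (rule linear_injective_imp_surjective[OF lin injf refl])
    have gf: "g' (f' v) = v" for v using g'(2) by (metis comp_apply id_apply)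
    have "(inv_into D K has_derivative g') (at (K w))"
    proof (rule has_derivative_inverse_basic[where f=K and f'=f' and T="K ` D"])
      show "(K has_derivative f') (at (inv_into D K (K w)))" using d w inj by (simp add: inv_into_f_f)
      show "bounded_linear g'" using g'(1) linear_conv_bounded_linear by blast
      show "continuous (at (K w)) (inv_into D K)"
        using contg op w by (simp add: continuous_on_eq_continuous_at)
    qed (use op w g'(2) in \<open>auto simp: f_inv_into_f\<close>)
    moreover have "g' (c *s v) = c *s g' v" for c v
    proof -
      obtain u where u: "v = f' u" using surjf by (metis surjD)
      have "c *s v = f' (c *s u)"
        unfolding u f'_def by (rule holomorphic_map_on_derivative(2)[OF K w, symmetric])
      then show ?thesis using gf u by simp
    qed
    ultimately show ?thesis using gf unfolding f'_def by blast
  qed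
  then show "holomorphic_map_on (K ` D) (inv_into D K)" unfolding holomorphic_map_on_def by blast
  show "frechet_derivative (inv_into D K) (at (K w)) (frechet_derivative K (at w) v) = v" if "w \<in> D"
    using ex[OF that] frechet_derivative_at by metis
qed

lemma cdiff_on_derivative_along_field:
  fixes G :: "complex^'n \<Rightarrow> complex^'n"
  assumes "open W" "cdiff_on W f" "holomorphic_map_on W G"
  shows "cdiff_on W (\<lambda>z. frechet_derivative f (at z) (G z))"
proof (rule cdiff_on_cong_open[OF _ assms(1)])
  show "cdiff_on W (\<lambda>z. \<Sum>j\<in>UNIV. G z $ j * frechet_derivative f (at z) (axis j 1))"
    using assms(3) unfolding holomorphic_map_on_iff
    by (intro cdiff_on_sum cdiff_on_mult cdiff_on_frechet_derivative[OF assms(1,2)]) auto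
  fix z assume z: "z \<in> W"
  have lin: "linear (frechet_derivative f (at z))"
    by (rule has_derivative_linear[OF cdiff_on_derivative(1)[OF assms(2) z]])
  have "frechet_derivative f (at z) (G z) = frechet_derivative f (at z) (\<Sum>j\<in>UNIV. G z $ j *s axis j 1)"
    using vec_expand_axis[of "G z"] by simp
  also have "\<dots> = (\<Sum>j\<in>UNIV. G z $ j * frechet_derivative f (at z) (axis j 1))"
    by (simp add: linear_sum[OF lin] cdiff_on_derivative(2)[OF assms(2) z])
  finally show "(\<Sum>j\<in>UNIV. G z $ j * frechet_derivative f (at z) (axis j 1)) = frechet_derivative f (at z) (G z)" ..
qed

lemma norm_le_add_coordinates: "norm (z :: C2) \<le> norm (z $ 1) + norm (z $ 2)"
  unfolding norm_vec_def using L2_set_le_sum[of UNIV "\<lambda>i. norm (z $ i)"] by (simp add: UNIV_2)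

lemma norm_less_if_polydisc: "z \<in> polydisc 2 \<Longrightarrow> norm z < 4"
  using norm_le_add_coordinates[of z] by (simp add: polydisc_def)

lemma open_polydisc: "open (polydisc \<delta>)"
  unfolding polydisc_def
  by (intro open_Collect_conj open_Collect_less continuous_intros)

text \<open>Rotating and rescaling time moves any pair \<open>(\<eta>, 1)\<close> with \<open>Im \<eta> \<noteq> 0\<close> to a pair with both real parts
  equal to \<open>-1\<close>.\<close>

lemma rotate_eigenvalues:
  assumes "Im \<eta> \<noteq> 0"
  defines "c \<equiv> - 1 + \<i> * of_real ((1 - Re \<eta>) / Im \<eta>)"
  shows "Re c = -1" "Re (c * \<eta>) = -1" "c \<noteq> 0"
proof -
  show 1: "Re c = -1" by (simp add: c_def)
  show "Re (c * \<eta>) = -1" using assms(1) by (simp add: c_def)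
  show "c \<noteq> 0" using 1 by auto
qed

text \<open>\<open>K\<close> is the inverse of a linearizing chart. It is rescaled to be defined on the bidisc of radius \<open>2\<close>, which leaves
  room for Cauchy's estimates over the bidisc of radius \<open>1\<close>.\<close>

proposition linearizing_parametrization:
  assumes hyp: "hyperbolic_singularity V F"
  obtains K G \<eta> C where "Im \<eta> \<noteq> 0" "holomorphic_map_on (polydisc 2) K" "K 0 = 0" "inj_on K (polydisc 2)"
    "K ` polydisc 2 \<subseteq> V" "same_foliation (K ` polydisc 2) F G" "0 < C"
    "\<And>w. w \<in> polydisc 2 \<Longrightarrow> norm (K w) \<le> C * norm w"
    "\<And>w v. w \<in> polydisc 2 \<Longrightarrow> frechet_derivative K (at w) v = 0 \<Longrightarrow> v = 0"
    "\<And>w. w \<in> polydisc 2 \<Longrightarrow> frechet_derivative K (at w) (linear_field \<eta> w) = G (K w)"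
proof -
  obtain W \<Phi> G \<eta> where W: "W \<subseteq> V" and cc: "centered_coords W \<Phi>" and sf: "same_foliation W F G"
    and \<eta>: "Im \<eta> \<noteq> 0"
    and bigo: "(\<lambda>z. norm (in_coords \<Phi> G z - linear_field \<eta> (\<Phi> z))) \<in> O[at 0](\<lambda>z. (norm (\<Phi> z))\<^sup>2)"
    using hyp unfolding hyperbolic_singularity_def by blast
  define X where "X = inv_into W \<Phi>"
  have oW: "open W" and W0: "0 \<in> W" and \<Phi>0: "\<Phi> 0 = 0" and inj\<Phi>: "inj_on \<Phi> W" and o\<Phi>: "open (\<Phi> ` W)"
    and h\<Phi>: "holomorphic_map_on W \<Phi>" and hX: "holomorphic_map_on (\<Phi> ` W) X"
    using cc unfolding centered_coords_def X_def by auto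
  have X\<Phi>: "X (\<Phi> z) = z" if "z \<in> W" for z using that inj\<Phi> by (simp add: X_def)
  have \<Phi>X: "\<Phi> (X w) = w" "X w \<in> W" if "w \<in> \<Phi> ` W" for w
    using that by (auto simp: X\<Phi>)
  have X0: "X 0 = 0" using X\<Phi>[OF W0] \<Phi>0 by simp
  have XW: "X ` (\<Phi> ` W) \<subseteq> W" using \<Phi>X(2) by blast
  have hG: "holomorphic_map_on W G" and G0: "G 0 = 0" using sf unfolding same_foliation_def by auto
  have D\<Phi>X: "frechet_derivative \<Phi> (at (X w)) (frechet_derivative X (at w) v) = v" if w: "w \<in> \<Phi> ` W" for w v
  proof -
    have "((\<lambda>w. w) has_derivative frechet_derivative (\<lambda>w. \<Phi> (X w)) (at w)) (at w)"
      by (rule has_derivative_transform_within_open[OF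
            holomorphic_map_on_derivative(1)[OF holomorphic_map_on_compose(1)[OF h\<Phi> hX XW] w] o\<Phi> w])
         (rule \<Phi>X(1))
    from has_derivative_unique[OF this has_derivative_ident]
    show ?thesis using holomorphic_map_on_compose(2)[OF h\<Phi> hX XW w, of v] by (simp add: fun_eq_iff)
  qed
  have DX\<Phi>: "frechet_derivative X (at (\<Phi> z)) (frechet_derivative \<Phi> (at z) v) = v" if z: "z \<in> W" for z v
  proof -
    have sub: "\<Phi> ` W \<subseteq> \<Phi> ` W" by simp
    have "((\<lambda>z. z) has_derivative frechet_derivative (\<lambda>z. X (\<Phi> z)) (at z)) (at z)"
      by (rule has_derivative_transform_within_open[OF
            holomorphic_map_on_derivative(1)[OF holomorphic_map_on_compose(1)[OF hX h\<Phi> sub] z] oW z])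
         (rule X\<Phi>)
    from has_derivative_unique[OF this has_derivative_ident]
    show ?thesis using holomorphic_map_on_compose(2)[OF hX h\<Phi> sub z, of v] by (simp add: fun_eq_iff)
  qed
  \<comment> \<open>The field in the given coordinates, with time rotated so that both eigenvalues have real part \<open>-1\<close>.\<close>
  define c where "c = - 1 + \<i> * of_real ((1 - Re \<eta>) / Im \<eta>)"
  note c = rotate_eigenvalues[OF \<eta>, folded c_def]
  define \<Lambda> :: "complex^2" where "\<Lambda> = vector [c * \<eta>, c]"
  have \<Lambda>: "Re (\<Lambda> $ i) = -1" for i
    using c(1,2) exhaust_2[of i] by (auto simp: \<Lambda>_def)
  have \<Lambda>_lin: "diag_field \<Lambda> w = c *s linear_field \<eta> w" for w
    by (simp add: vec_eq_iff forall_2 \<Lambda>_def linear_field_def)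
  define Y where "Y w = c *s in_coords \<Phi> G (X w)" for w
  have hY: "holomorphic_map_on (\<Phi> ` W) Y"
    unfolding holomorphic_map_on_iff
  proof
    fix i
    have \<Phi>i: "cdiff_on W (\<lambda>z. \<Phi> z $ i)" using h\<Phi> by (simp add: holomorphic_map_on_iff)
    have "cdiff_on (\<Phi> ` W) (\<lambda>w. c * frechet_derivative (\<lambda>z. \<Phi> z $ i) (at (X w)) (G (X w)))"
      by (intro cdiff_on_mult cdiff_on_const
          cdiff_on_compose(1)[OF cdiff_on_derivative_along_field[OF oW \<Phi>i hG] hX XW])
    then show "cdiff_on (\<Phi> ` W) (\<lambda>w. Y w $ i)"
      by (rule cdiff_on_cong_open[OF _ o\<Phi>])
         (simp add: Y_def in_coords_def frechet_derivative_nth[OF h\<Phi> \<Phi>X(2)])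
  qed
  obtain B where B: "0 < B" and ev: "\<forall>\<^sub>F z in at 0. norm (in_coords \<Phi> G z - linear_field \<eta> (\<Phi> z)) \<le> B * (norm (\<Phi> z))\<^sup>2"
    using bigo by (auto elim!: landau_o.bigE)
  obtain d where d: "0 < d"
    and dB: "\<And>z. z \<noteq> 0 \<Longrightarrow> norm z < d \<Longrightarrow> norm (in_coords \<Phi> G z - linear_field \<eta> (\<Phi> z)) \<le> B * (norm (\<Phi> z))\<^sup>2"
    using ev unfolding eventually_at by (auto simp: dist_norm)
  have zero_in: "0 \<in> \<Phi> ` W" using W0 \<Phi>0 by (metis imageI)
  have "isCont X 0"
    by (rule has_derivative_continuous[OF holomorphic_map_on_derivative(1)[OF hX zero_in]])
  then obtain R1 where R1: "0 < R1" "\<And>w. norm w < R1 \<Longrightarrow> norm (X w) < d"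
    using d X0 unfolding continuous_at_eps_delta by (auto simp: dist_norm)
  obtain R2 where R2: "0 < R2" "ball 0 R2 \<subseteq> \<Phi> ` W" using o\<Phi> zero_in open_contains_ball by blast
  define R where "R = min R1 R2"
  have R: "0 < R" using R1 R2 by (simp add: R_def)
  have RW: "ball 0 R \<subseteq> \<Phi> ` W" using R2(2) by (auto simp: R_def)
  have Yb: "norm (Y w - diag_field \<Lambda> w) \<le> (norm c * B) * (norm w)\<^sup>2" if w: "w \<in> ball 0 R" for w
  proof (cases "w = 0")
    case True
    have "linear (frechet_derivative \<Phi> (at 0))"
      by (rule has_derivative_linear[OF holomorphic_map_on_derivative(1)[OF h\<Phi> W0]])
    then have "Y 0 = 0" by (simp add: Y_def X0 in_coords_def G0 linear_0)
    moreover have "diag_field \<Lambda> 0 = 0" by (simp add: vec_eq_iff)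
    ultimately show ?thesis using True by simp
  next
    case False
    have wW: "w \<in> \<Phi> ` W" using w RW by blast
    have "X w \<noteq> 0" using False \<Phi>X(1)[OF wW] \<Phi>0 by metis
    moreover have "norm (X w) < d" using w by (intro R1(2)) (simp add: R_def)
    ultimately have "norm (in_coords \<Phi> G (X w) - linear_field \<eta> w) \<le> B * (norm w)\<^sup>2"
      using dB[of "X w"] \<Phi>X(1)[OF wW] by simp
    moreover have "Y w - diag_field \<Lambda> w = c *s (in_coords \<Phi> G (X w) - linear_field \<eta> w)"
      unfolding Y_def \<Lambda>_lin by (rule vector_ssub_ldistrib[symmetric])
    ultimately show ?thesis
      using mult_left_mono[of "norm (in_coords \<Phi> G (X w) - linear_field \<eta> w)" "B * (norm w)\<^sup>2" "norm c"]
      by (simp add: mult.assoc del: vector_ssub_ldistrib)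
  qed
  have cB: "0 < norm c * B" using c(3) B by simp
  obtain r H where r: "0 < r" and hH: "holomorphic_map_on (ball 0 r) H" and H0: "H 0 = 0"
    and HR: "H ` ball 0 r \<subseteq> ball 0 R" and injH: "inj_on H (ball 0 r)"
    and DH0: "\<And>w v. w \<in> ball 0 r \<Longrightarrow> frechet_derivative H (at w) v = 0 \<Longrightarrow> v = 0"
    and DH: "\<And>w. w \<in> ball 0 r \<Longrightarrow> frechet_derivative H (at w) (diag_field \<Lambda> w) = Y (H w)"
    using Poincare_linearization[OF \<Lambda> holomorphic_map_on_subset[OF hY RW] R Yb cB] by blast
  define P where "P w = X (H w)" for w
  have HW: "H ` ball 0 r \<subseteq> \<Phi> ` W" using HR RW by blast
  have hP: "holomorphic_map_on (ball 0 r) P"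
    unfolding P_def by (rule holomorphic_map_on_compose(1)[OF hX hH HW])
  have DP: "frechet_derivative P (at w) v = frechet_derivative X (at (H w)) (frechet_derivative H (at w) v)"
    if "w \<in> ball 0 r" for w v
    unfolding P_def by (rule holomorphic_map_on_compose(2)[OF hX hH HW that])
  have P0: "P 0 = 0" by (simp add: P_def H0 X0)
  have DP_lin: "frechet_derivative P (at w) (linear_field \<eta> w) = G (P w)" if w: "w \<in> ball 0 r" for w
  proof -
    have HwW: "H w \<in> \<Phi> ` W" using w HW by blast
    have "c *s frechet_derivative H (at w) (linear_field \<eta> w) = c *s in_coords \<Phi> G (X (H w))"
      using DH[OF w] unfolding \<Lambda>_lin holomorphic_map_on_derivative(2)[OF hH w] Y_def .
    then have "frechet_derivative H (at w) (linear_field \<eta> w) = in_coords \<Phi> G (P w)"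
      using c(3) by (simp add: P_def vec_eq_iff)
    then have "frechet_derivative P (at w) (linear_field \<eta> w)
        = frechet_derivative X (at (\<Phi> (P w))) (frechet_derivative \<Phi> (at (P w)) (G (P w)))"
      unfolding DP[OF w] in_coords_def using \<Phi>X(1)[OF HwW] by (simp add: P_def)
    also have "\<dots> = G (P w)" by (rule DX\<Phi>) (use \<Phi>X(2)[OF HwW] in \<open>simp add: P_def\<close>)
    finally show ?thesis .
  qed
  have DP0: "v = 0" if w: "w \<in> ball 0 r" and z: "frechet_derivative P (at w) v = 0" for w v
  proof -
    have HwW: "H w \<in> \<Phi> ` W" using w HW by blast
    have "linear (frechet_derivative \<Phi> (at (X (H w))))"
      by (rule has_derivative_linear[OF holomorphic_map_on_derivative(1)[OF h\<Phi> \<Phi>X(2)[OF HwW]]])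
    then have "frechet_derivative H (at w) v = 0"
      using D\<Phi>X[OF HwW, of "frechet_derivative H (at w) v"] z unfolding DP[OF w] by (simp add: linear_0)
    then show ?thesis by (rule DH0[OF w])
  qed
  have injP: "inj_on P (ball 0 r)"
  proof (rule inj_onI)
    fix x y assume xy: "x \<in> ball 0 r" "y \<in> ball 0 r" "P x = P y"
    have "\<Phi> (P x) = \<Phi> (P y)" using xy(3) by simp
    then have "H x = H y" unfolding P_def using \<Phi>X(1) HW xy(1,2) by (metis imageI subsetD)
    then show "x = y" using injH xy by (meson inj_onD)
  qed
  have zr: "0 \<in> ball 0 r" using r by simp
  have "\<exists>L>0. \<exists>s>0. \<forall>w. norm w < s \<longrightarrow> norm (P w) \<le> L * norm w"
  proof -
    have dP: "(P has_derivative frechet_derivative P (at 0)) (at 0)"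
      by (rule holomorphic_map_on_derivative(1)[OF hP zr])
    obtain L where L: "\<And>v. norm (frechet_derivative P (at 0) v) \<le> norm v * L" "0 < L"
      using bounded_linear.pos_bounded[OF has_derivative_bounded_linear[OF dP]] by blast
    obtain s where s: "0 < s" "\<And>y. norm (y - 0) < s \<Longrightarrow> norm (P y - P 0 - frechet_derivative P (at 0) (y - 0)) \<le> 1 * norm (y - 0)"
      using dP unfolding has_derivative_at_alt by (metis zero_less_one)
    have "norm (P w) \<le> (L + 1) * norm w" if "norm w < s" for w
    proof -
      have "norm (P w) \<le> norm (P w - frechet_derivative P (at 0) w) + norm (frechet_derivative P (at 0) w)"
        by (metis diff_add_cancel norm_triangle_ineq)
      also have "\<dots> \<le> norm w + norm w * L" using s(2)[of w] that L(1)[of w] P0 by (intro add_mono) auto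
      finally show ?thesis by (simp add: algebra_simps)
    qed
    then show ?thesis using L(2) s(1) by (intro exI[of _ "L + 1"] conjI exI[of _ s]) auto
  qed
  then obtain L s where L: "0 < L" and s: "0 < s" and Ls: "\<And>w. norm w < s \<Longrightarrow> norm (P w) \<le> L * norm w"
    by blast
  define \<rho> where "\<rho> = min r s / 4"
  have \<rho>: "0 < \<rho>" using r s by (simp add: \<rho>_def)
  have \<rho>w: "norm (\<rho> *\<^sub>R w) < r" "norm (\<rho> *\<^sub>R w) < s" if "w \<in> polydisc 2" for w
  proof -
    have "\<rho> * norm w < \<rho> * 4" using norm_less_if_polydisc[OF that] \<rho> by simp
    then show "norm (\<rho> *\<^sub>R w) < r" "norm (\<rho> *\<^sub>R w) < s" using \<rho> by (auto simp: \<rho>_def)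
  qed
  define K where "K w = P (\<rho> *\<^sub>R w)" for w
  have hS: "holomorphic_map_on (polydisc 2) (\<lambda>w. \<rho> *\<^sub>R w)"
    unfolding holomorphic_map_on_iff
    by (auto simp: scaleR_conv_of_real[where 'a=complex] intro!: cdiff_on_mult cdiff_on_coord)
  have DS: "frechet_derivative (\<lambda>w. \<rho> *\<^sub>R w) (at w) v = \<rho> *\<^sub>R v" for w v :: "complex^2"
    using frechet_derivative_at[OF has_derivative_scaleR_right[OF has_derivative_ident], of \<rho> w]
    by (metis)
  have S: "(\<lambda>w. \<rho> *\<^sub>R w) ` polydisc 2 \<subseteq> ball 0 r" using \<rho>w(1) by auto
  have hK: "holomorphic_map_on (polydisc 2) K"
    unfolding K_def by (rule holomorphic_map_on_compose(1)[OF hP hS S])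
  have DK: "frechet_derivative K (at w) v = frechet_derivative P (at (\<rho> *\<^sub>R w)) (\<rho> *\<^sub>R v)"
    if "w \<in> polydisc 2" for w v
    unfolding K_def using holomorphic_map_on_compose(2)[OF hP hS S that] by (simp add: DS)
  have KW: "K ` polydisc 2 \<subseteq> W"
    unfolding K_def P_def using S HW \<Phi>X(2) by blast
  show ?thesis
  proof (rule that[OF \<eta> hK])
    show "K 0 = 0" by (simp add: K_def P0)
    show "inj_on K (polydisc 2)"
    proof (rule inj_onI)
      fix x y assume xy: "x \<in> polydisc 2" "y \<in> polydisc 2" "K x = K y"
      then have "\<rho> *\<^sub>R x = \<rho> *\<^sub>R y"
        using inj_onD[OF injP, of "\<rho> *\<^sub>R x" "\<rho> *\<^sub>R y"] \<rho>w(1)[OF xy(1)] \<rho>w(1)[OF xy(2)]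
        by (simp add: K_def)
      then show "x = y" using \<rho> by simp
    qed
    show "K ` polydisc 2 \<subseteq> V" using KW W by blast
    show "same_foliation (K ` polydisc 2) F G"
      using sf KW unfolding same_foliation_def by (auto intro: holomorphic_map_on_subset)
    show "0 < L * \<rho>" using L \<rho> by simp
    show "norm (K w) \<le> L * \<rho> * norm w" if "w \<in> polydisc 2" for w
      using Ls[OF \<rho>w(2)[OF that]] \<rho> by (simp add: K_def)
    show "v = 0" if w: "w \<in> polydisc 2" and z: "frechet_derivative K (at w) v = 0" for w v
      using DP0[of "\<rho> *\<^sub>R w" "\<rho> *\<^sub>R v"] \<rho>w(1)[OF w] z \<rho> by (simp add: DK[OF w])
    show "frechet_derivative K (at w) (linear_field \<eta> w) = G (K w)" if w: "w \<in> polydisc 2" for w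
    proof -
      have "\<rho> *\<^sub>R linear_field \<eta> w = linear_field \<eta> (\<rho> *\<^sub>R w)"
        by (simp add: vec_eq_iff forall_2 linear_field_def)
      then show ?thesis using DP_lin[of "\<rho> *\<^sub>R w"] \<rho>w(1)[OF w] by (simp add: DK[OF w] K_def)
    qed
  qed
qed

section \<open>Integration over a quadrant\<close>

definition quadrant :: "(real \<times> real) set" where
  "quadrant = {0<..} \<times> {0<..}"

lemma quadrant_iff [simp]: "z \<in> quadrant \<longleftrightarrow> 0 < fst z \<and> 0 < snd z"
  by (cases z) (auto simp: quadrant_def)

lemma open_quadrant: "open quadrant"
  unfolding quadrant_def by (intro open_Times) auto

lemma quadrant_measurable: "quadrant \<in> sets borel"
  by (rule borel_open[OF open_quadrant])

lemma borel_measurable_fst_snd: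
  "(fst :: real \<times> real \<Rightarrow> real) \<in> borel_measurable borel"
  "(snd :: real \<times> real \<Rightarrow> real) \<in> borel_measurable borel"
  by (intro borel_measurable_continuous_onI continuous_intros)+

lemma borel_measurable_weight:
  "(\<lambda>z. A * (B + fst z + snd z) powr s) \<in> borel_measurable (borel :: (real \<times> real) measure)"
  by (intro borel_measurable_times borel_measurable_add borel_measurable_const
        powr_real_measurable borel_measurable_fst_snd)

lemma indicator_quadrant: "indicator quadrant (x, y) = (indicator {0<..} x * indicator {0<..} y :: real)"
  by (auto simp: indicator_def)

text \<open>A derivative that is not integrable has the Bochner integral \<open>0\<close> by convention.\<close>

lemma integral_derivative_vanishing_at_ends:
  fixes f :: "real \<Rightarrow> complex"
  assumes f: "\<And>x. 0 < x \<Longrightarrow> (f has_vector_derivative f' x) (at x)"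
    and z: "\<And>x. 0 < x \<Longrightarrow> x < c \<Longrightarrow> f x = 0" and c: "0 < c" and lim: "(f \<longlongrightarrow> 0) at_top"
  shows "(\<integral>x. indicator {0<..} x *\<^sub>R f' x \<partial>lborel) = 0"
proof (cases "integrable lborel (\<lambda>x. indicator {0<..} x *\<^sub>R f' x)")
  case True
  have z': "f' x = 0" if "0 < x" "x < c" for x
  proof -
    have "((\<lambda>_. 0) has_vector_derivative f' x) (at x)"
      by (rule has_vector_derivative_transform_within_open[OF f[OF that(1)], of "{0<..<c}"]) (use that z in auto)
    then show ?thesis by (metis has_vector_derivative_const vector_derivative_at)
  qed
  have eq: "(\<lambda>x. indicator {0<..} x *\<^sub>R f' x) = (\<lambda>x. indicator {c/2..} x *\<^sub>R f' x)"
    using z' c by (auto simp: indicator_def fun_eq_iff not_le)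
  have "(LINT x:{c/2..}|lborel. f' x) = 0 - f (c / 2)"
  proof (rule integral_FTC_halfline[OF _ _ lim])
    show "(f has_vector_derivative f' x) (at x within {c / 2..})" if "c / 2 \<le> x" for x
      using that c by (intro has_vector_derivative_at_within[OF f]) auto
    show "set_integrable lborel {c / 2..} f'"
      using True unfolding set_integrable_def eq .
  qed
  then show ?thesis using z[of "c/2"] c by (simp add: eq set_lebesgue_integral_def)
qed (rule not_integrable_integral_eq)

text \<open>The divergence theorem on the quadrant, for a function that vanishes near the edges and tends to \<open>0\<close> at
  infinity, by the fundamental theorem of calculus on each line.\<close>

lemma integral_partial_derivative_eq_0:
  fixes f f1 f2 :: "real \<times> real \<Rightarrow> complex"
  assumes d1: "\<And>x y. 0 < x \<Longrightarrow> 0 < y \<Longrightarrow> ((\<lambda>x. f (x, y)) has_vector_derivative f1 (x, y)) (at x)"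
    and d2: "\<And>x y. 0 < x \<Longrightarrow> 0 < y \<Longrightarrow> ((\<lambda>y. f (x, y)) has_vector_derivative f2 (x, y)) (at y)"
    and z: "\<And>x y. 0 < x \<Longrightarrow> 0 < y \<Longrightarrow> x < c \<or> y < c \<Longrightarrow> f (x, y) = 0" and c: "0 < c"
    and l1: "\<And>y. 0 < y \<Longrightarrow> ((\<lambda>x. f (x, y)) \<longlongrightarrow> 0) at_top"
    and l2: "\<And>x. 0 < x \<Longrightarrow> ((\<lambda>y. f (x, y)) \<longlongrightarrow> 0) at_top"
    and i1: "set_integrable lborel quadrant f1" and i2: "set_integrable lborel quadrant f2"
  shows "(LINT z:quadrant|lborel. f1 z) = 0" "(LINT z:quadrant|lborel. f2 z) = 0"
proof -
  have "(LINT z:quadrant|lborel. f1 z)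
      = (\<integral>y. (\<integral>x. indicator quadrant (x, y) *\<^sub>R f1 (x, y) \<partial>lborel) \<partial>lborel)"
    using lborel_pair.integral_snd[of "\<lambda>x y. indicator quadrant (x, y) *\<^sub>R f1 (x, y)"] i1
    by (simp add: set_lebesgue_integral_def set_integrable_def lborel_prod case_prod_beta')
  also have "\<dots> = (\<integral>y. 0 \<partial>(lborel :: real measure))"
  proof (rule Bochner_Integration.integral_cong)
    fix y :: real
    show "(\<integral>x. indicator quadrant (x, y) *\<^sub>R f1 (x, y) \<partial>lborel) = 0"
    proof (cases "0 < y")
      case True
      have "(\<integral>x. indicator {0<..} x *\<^sub>R f1 (x, y) \<partial>lborel) = 0"
        by (rule integral_derivative_vanishing_at_ends[where f="\<lambda>x. f (x, y)" and c=c])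
           (use True d1 z c l1 in auto)
      then show ?thesis using True by (simp add: indicator_quadrant)
    qed (simp add: indicator_quadrant)
  qed simp
  finally show "(LINT z:quadrant|lborel. f1 z) = 0" by simp
  have "(LINT z:quadrant|lborel. f2 z)
      = (\<integral>x. (\<integral>y. indicator quadrant (x, y) *\<^sub>R f2 (x, y) \<partial>lborel) \<partial>lborel)"
    using lborel_pair.integral_fst[of "\<lambda>x y. indicator quadrant (x, y) *\<^sub>R f2 (x, y)"] i2
    by (simp add: set_lebesgue_integral_def set_integrable_def lborel_prod case_prod_beta')
  also have "\<dots> = (\<integral>x. 0 \<partial>(lborel :: real measure))"
  proof (rule Bochner_Integration.integral_cong)
    fix x :: real
    show "(\<integral>y. indicator quadrant (x, y) *\<^sub>R f2 (x, y) \<partial>lborel) = 0"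
    proof (cases "0 < x")
      case True
      have "(\<integral>y. indicator {0<..} y *\<^sub>R f2 (x, y) \<partial>lborel) = 0"
        by (rule integral_derivative_vanishing_at_ends[where f="\<lambda>y. f (x, y)" and c=c])
           (use True d2 z c l2 in auto)
      then show ?thesis using True by (simp add: indicator_quadrant)
    qed (simp add: indicator_quadrant)
  qed simp
  finally show "(LINT z:quadrant|lborel. f2 z) = 0" by simp
qed

lemma integral_lborel_product:
  fixes u v :: "real \<Rightarrow> real"
  assumes u: "integrable lborel u" and v: "integrable lborel v"
  shows "integrable lborel (\<lambda>z. u (fst z) * v (snd z))"
    and "(\<integral>z. u (fst z) * v (snd z) \<partial>lborel) = (\<integral>x. u x \<partial>lborel) * (\<integral>y. v y \<partial>lborel)"
proof -
  have m: "u \<in> borel_measurable borel" "v \<in> borel_measurable borel" using u v by auto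
  have "integrable (lborel \<Otimes>\<^sub>M lborel) (\<lambda>z. u (fst z) * v (snd z))"
  proof (rule lborel_pair.Fubini_integrable)
    show "(\<lambda>z. u (fst z) * v (snd z)) \<in> borel_measurable (lborel \<Otimes>\<^sub>M lborel)"
      using m by measurable
  qed (use u v in \<open>simp_all add: abs_mult\<close>)
  then show i: "integrable lborel (\<lambda>z. u (fst z) * v (snd z))" by (simp add: lborel_prod)
  have "(\<integral>z. u (fst z) * v (snd z) \<partial>lborel) = (\<integral>x. (\<integral>y. u x * v y \<partial>lborel) \<partial>lborel)"
    using lborel_pair.integral_fst[of "\<lambda>x y. u x * v y"] i by (simp add: lborel_prod case_prod_beta')
  then show "(\<integral>z. u (fst z) * v (snd z) \<partial>lborel) = (\<integral>x. u x \<partial>lborel) * (\<integral>y. v y \<partial>lborel)"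
    by simp
qed

lemma has_integral_exp_minus:
  "has_bochner_integral lborel (\<lambda>x. indicator {0..} x * exp (- x) :: real) 1"
proof (rule has_bochner_integral_nn_integral)
  show "(\<integral>\<^sup>+x. ennreal (indicator {0..} x * exp (- x)) \<partial>lborel) = ennreal 1"
    unfolding nn_integral_exp_minus_halfline[symmetric]
    by (intro nn_integral_cong) (auto simp: indicator_def)
qed auto

lemma has_integral_scaled_powr:
  assumes "1 < p" "0 < A"
  shows "has_bochner_integral lborel (\<lambda>y. indicator {0..} y * (A powr (p - 1) * (A + y) powr (- p)) :: real) (1 / (p - 1))"
proof (rule has_bochner_integral_nn_integral)
  have "(\<integral>\<^sup>+y. ennreal (A powr (p - 1) * (A + y) powr (- p)) * indicator {0..} y \<partial>lborel)
      = ennreal (0 - (- (A powr (p - 1) * (A + 0) powr (1 - p) / (p - 1))))"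
  proof (rule nn_integral_FTC_atLeast[where F="\<lambda>y. - (A powr (p - 1) * (A + y) powr (1 - p) / (p - 1))"])
    show "DERIV (\<lambda>y. - (A powr (p - 1) * (A + y) powr (1 - p) / (p - 1))) y :> A powr (p - 1) * (A + y) powr (- p)"
      if "0 \<le> y" for y
    proof -
      have "DERIV (\<lambda>y. (A + y) powr (1 - p)) y :> (1 - p) * (A + y) powr (1 - p - 1) * 1"
        by (rule DERIV_chain2[OF has_real_derivative_powr])
           (use that assms in \<open>auto intro!: derivative_eq_intros\<close>)
      from DERIV_cmult[OF this, of "- (A powr (p - 1)) / (p - 1)"]
      have "DERIV (\<lambda>y. - (A powr (p - 1)) / (p - 1) * (A + y) powr (1 - p)) y :>
          - (A powr (p - 1)) / (p - 1) * ((1 - p) * (A + y) powr (1 - p - 1) * 1)" .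
      moreover have "- a / (p - 1) * ((1 - p) * b * 1) = a * b" for a b :: real
        using assms(1) by (simp add: divide_simps) (simp add: algebra_simps)
      ultimately show ?thesis by simp
    qed
    have "((\<lambda>y. (A + y) powr (1 - p)) \<longlongrightarrow> 0) at_top"
      using assms by (intro tendsto_neg_powr filterlim_tendsto_add_at_top[OF tendsto_const filterlim_ident]) auto
    from tendsto_mult[OF tendsto_const this, of "- (A powr (p - 1)) / (p - 1)"]
    show "((\<lambda>y. - (A powr (p - 1) * (A + y) powr (1 - p) / (p - 1))) \<longlongrightarrow> 0) at_top"
      by simp
  qed auto
  also have "0 - (- (A powr (p - 1) * (A + 0) powr (1 - p) / (p - 1))) = 1 / (p - 1)"
    using assms by (simp add: powr_add[symmetric])
  finally show "(\<integral>\<^sup>+y. ennreal (indicator {0..} y * (A powr (p - 1) * (A + y) powr (- p))) \<partial>lborel) = ennreal (1 / (p - 1))"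
    by (subst nn_integral_cong[where v="\<lambda>y. ennreal (A powr (p - 1) * (A + y) powr (- p)) * indicator {0..} y"])
       (auto simp: indicator_def)
qed (use assms in auto)

text \<open>In the coordinates of the quadrant, \<open>weight p A\<close> is the size of the kernel whose vertex lies at distance \<open>A\<close>, and
  \<open>edge_decay\<close> that of the tangent vector of the leaf.\<close>

definition weight :: "real \<Rightarrow> real \<Rightarrow> real \<times> real \<Rightarrow> real" where
  "weight p A z = A powr (p - 1) * (A + fst z + snd z) powr (- p)"

definition edge_decay :: "real \<times> real \<Rightarrow> real" where
  "edge_decay z = exp (- fst z) + exp (- snd z)"

text \<open>The condition \<open>1 < p\<close> is what makes the weight integrable along the two edges of the quadrant, and the
  factor \<open>A powr (p - 1)\<close> bounds the total mass independently of \<open>A\<close>.\<close>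

lemma integrable_weight_edge_decay:
  assumes p: "1 < p" and A: "1 \<le> A"
  shows "set_integrable lborel quadrant (\<lambda>z. weight p A z * edge_decay z)"
    and "(LINT z:quadrant|lborel. weight p A z * edge_decay z) \<le> 2 / (p - 1)"
proof -
  define u where "u = (\<lambda>x. indicator {0..} x * exp (- x) :: real)"
  define v where "v = (\<lambda>y. indicator {0..} y * (A powr (p - 1) * (A + y) powr (- p)) :: real)"
  have u: "integrable lborel u" "integral\<^sup>L lborel u = 1"
    using has_integral_exp_minus unfolding u_def has_bochner_integral_iff by auto
  have v: "integrable lborel v" "integral\<^sup>L lborel v = 1 / (p - 1)"
    using has_integral_scaled_powr[OF p, of A] A unfolding v_def has_bochner_integral_iff by auto
  note uv = integral_lborel_product[OF u(1) v(1)] and vu = integral_lborel_product[OF v(1) u(1)]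
  let ?B = "\<lambda>z. u (fst z) * v (snd z) + v (fst z) * u (snd z)"
  have B: "integrable lborel ?B" "integral\<^sup>L lborel ?B = 2 / (p - 1)"
    using uv vu by (simp_all add: u v)
  have le: "indicator quadrant z * (weight p A z * edge_decay z) \<le> ?B z" for z
  proof (cases "z \<in> quadrant")
    case True
    then have xy: "0 < fst z" "0 < snd z" by auto
    have "(A + fst z + snd z) powr (- p) \<le> (A + snd z) powr (- p)"
      "(A + fst z + snd z) powr (- p) \<le> (A + fst z) powr (- p)"
      using xy A p by (auto intro!: powr_mono2')
    then have "weight p A z \<le> v (snd z)" "weight p A z \<le> v (fst z)"
      using xy by (auto simp: weight_def v_def intro!: mult_left_mono)
    then have "weight p A z * exp (- fst z) \<le> v (snd z) * u (fst z)"
      "weight p A z * exp (- snd z) \<le> v (fst z) * u (snd z)"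
      using xy by (auto simp: u_def intro!: mult_right_mono)
    then show ?thesis using True by (simp add: edge_decay_def algebra_simps)
  next
    case False
    then show ?thesis by (simp add: u_def v_def)
  qed
  have ge: "0 \<le> indicator quadrant z * (weight p A z * edge_decay z)" for z
    by (simp add: weight_def edge_decay_def add_nonneg_nonneg)
  have m: "(\<lambda>z. indicator quadrant z * (weight p A z * edge_decay z)) \<in> borel_measurable lborel"
    unfolding measurable_lborel2 weight_def edge_decay_def
    by (intro borel_measurable_times borel_measurable_indicator quadrant_measurable
        borel_measurable_weight[unfolded mult.assoc[symmetric]]
        borel_measurable_continuous_onI[of "\<lambda>z. exp (- fst z) + exp (- snd z)"] continuous_intros)
  have i: "integrable lborel (\<lambda>z. indicator quadrant z * (weight p A z * edge_decay z))"
  proof (rule Bochner_Integration.integrable_bound[OF B(1) m], rule AE_I2)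
    fix z :: "real \<times> real"
    show "norm (indicator quadrant z * (weight p A z * edge_decay z)) \<le> norm (?B z)"
      using order.trans[OF le[of z] abs_ge_self] ge[of z] by (simp only: real_norm_def abs_of_nonneg)
  qed
  then show "set_integrable lborel quadrant (\<lambda>z. weight p A z * edge_decay z)"
    by (simp add: set_integrable_def)
  show "(LINT z:quadrant|lborel. weight p A z * edge_decay z) \<le> 2 / (p - 1)"
    unfolding B(2)[symmetric] set_lebesgue_integral_def real_scaleR_def
    by (rule integral_mono[OF i B(1) le])
qed

text \<open>The derivatives of the kernel gain one more power, which makes them integrable over the whole quadrant and not
  only along its edges.\<close>

lemma integrable_weight_over_distance:
  assumes p: "1 < p" and A: "1 \<le> A"
  shows "set_integrable lborel quadrant (\<lambda>z. A powr (p - 1) * (A + fst z + snd z) powr (- p - 1))"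
proof -
  define s where "s = (p + 1) / 2"
  have s: "1 < s" "- p - 1 = - s + - s" using p by (auto simp: s_def)
  define v where "v = (\<lambda>y. indicator {0..} y * (1 powr (s - 1) * (1 + y) powr (- s)) :: real)"
  have v: "integrable lborel v"
    using has_integral_scaled_powr[OF s(1), of 1] unfolding v_def has_bochner_integral_iff by auto
  have B: "integrable lborel (\<lambda>z. A powr (p - 1) * (v (fst z) * v (snd z)))"
    using integral_lborel_product(1)[OF v v] by simp
  have le: "indicator quadrant z * (A powr (p - 1) * (A + fst z + snd z) powr (- p - 1)) \<le> A powr (p - 1) * (v (fst z) * v (snd z))" for z
  proof (cases "z \<in> quadrant")
    case True
    then have xy: "0 < fst z" "0 < snd z" by auto
    have "(A + fst z + snd z) powr (- p - 1) = (A + fst z + snd z) powr (- s) * (A + fst z + snd z) powr (- s)"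
      unfolding s(2) by (rule powr_add)
    also have "\<dots> \<le> (1 + fst z) powr (- s) * (1 + snd z) powr (- s)"
      using xy A s by (intro mult_mono powr_mono2') auto
    finally show ?thesis using True by (simp add: v_def mult_left_mono)
  qed (simp add: v_def)
  have m: "(\<lambda>z. indicator quadrant z * (A powr (p - 1) * (A + fst z + snd z) powr (- p - 1))) \<in> borel_measurable lborel"
    unfolding measurable_lborel2
    by (intro borel_measurable_times[OF borel_measurable_indicator] quadrant_measurable borel_measurable_weight)
  have "integrable lborel (\<lambda>z. indicator quadrant z * (A powr (p - 1) * (A + fst z + snd z) powr (- p - 1)))"
  proof (rule Bochner_Integration.integrable_bound[OF B m], rule AE_I2)
    fix z :: "real \<times> real"
    have ge: "0 \<le> indicator quadrant z * (A powr (p - 1) * (A + fst z + snd z) powr (- p - 1))" by simp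
    show "norm (indicator quadrant z * (A powr (p - 1) * (A + fst z + snd z) powr (- p - 1)))
        \<le> norm (A powr (p - 1) * (v (fst z) * v (snd z)))"
      using order.trans[OF le[of z] abs_ge_self] ge by (simp only: real_norm_def abs_of_nonneg)
  qed
  then show ?thesis by (simp add: set_integrable_def)
qed

section \<open>Positive harmonic functions on a sector\<close>

lemma norm_powr_of_real:
  fixes u :: complex
  assumes "u \<noteq> 0" shows "norm (u powr of_real s) = norm u powr s"
  using assms by (simp add: powr_def)

lemma Re_powr_of_real:
  fixes u :: complex
  assumes "u \<noteq> 0" shows "Re (u powr of_real s) = norm u powr s * cos (s * Im (Ln u))"
  using assms by (simp add: powr_def Re_exp)

lemma half_plane_containing_sector:
  fixes e1 e2 :: complex
  assumes "Im (cnj e1 * e2) \<noteq> 0"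
  obtains k where "0 < Re (k * e1)" "0 < Re (k * e2)"
proof -
  have lt: "\<bar>Re (cnj e1 * e2)\<bar> < norm e1 * norm e2"
  proof -
    have "(Re (cnj e1 * e2))\<^sup>2 < (norm (cnj e1 * e2))\<^sup>2"
      using assms by (simp add: cmod_power2)
    then show ?thesis using norm_mult[of "cnj e1" e2] by (metis abs_norm_cancel complex_mod_cnj power2_less_imp_less power2_abs abs_ge_zero norm_ge_zero)
  qed
  have e: "e1 \<noteq> 0" "e2 \<noteq> 0" using assms by auto
  show thesis
  proof
    \<comment> \<open>Multiplication by \<open>k\<close> turns the bisector of the angle between \<open>e1\<close> and \<open>e2\<close> into the positive real
      axis.\<close>
    let ?k = "cnj e1 / norm e1 + cnj e2 / norm e2"
    have "Re (?k * e1) = norm e1 + Re (cnj e1 * e2) / norm e2"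
    proof -
      have "cnj e1 / norm e1 * e1 = norm e1"
        using e by (simp add: field_simps complex_norm_square[symmetric] power2_eq_square mult.commute[of e1])
      then show ?thesis by (simp add: distrib_right)
    qed
    moreover have "Re (?k * e2) = norm e2 + Re (cnj e1 * e2) / norm e1"
    proof -
      have "cnj e2 / norm e2 * e2 = norm e2"
        using e by (simp add: field_simps complex_norm_square[symmetric] power2_eq_square mult.commute[of e2])
      then show ?thesis by (simp add: distrib_right)
    qed
    moreover have "0 < norm e1 + Re (cnj e1 * e2) / norm e2" "0 < norm e2 + Re (cnj e1 * e2) / norm e1"
      using lt e by (auto simp: field_simps abs_less_iff)
    ultimately show "0 < Re (?k * e1)" "0 < Re (?k * e2)" by simp_all
  qed
qed

text \<open>On a sector of angle less than \<open>\<pi>\<close> some power \<open>u powr (- p)\<close> with \<open>p > 1\<close> still has positive real part. Moving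
  the vertex by \<open>A\<close> keeps the function bounded below, up to distance \<open>A\<close> from the old vertex, by a
  fixed multiple of \<open>1 / A\<close>.\<close>

proposition positive_kernel:
  fixes e1 e2 :: complex
  assumes indep: "Im (cnj e1 * e2) \<noteq> 0"
  obtains p c C and q q' q'' :: "real \<Rightarrow> complex \<Rightarrow> complex" where "1 < p" "0 < c" "0 < C"
    "\<And>A x y t. 1 \<le> A \<Longrightarrow> 0 \<le> x \<Longrightarrow> 0 \<le> y \<Longrightarrow> t = of_real x * e1 + of_real y * e2 \<Longrightarrow>
      (q A has_field_derivative q' A t) (at t) \<and> (q' A has_field_derivative q'' A t) (at t) \<and>
      q'' A field_differentiable (at t) \<and> c * weight p A (x, y) \<le> Re (q A t) \<and> norm (q A t) \<le> C * weight p A (x, y) \<and>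
      norm (q' A t) \<le> C * (A powr (p - 1) * (A + x + y) powr (- p - 1)) \<and>
      norm (q'' A t) \<le> C * (A powr (p - 1) * (A + x + y) powr (- p - 1))"
proof -
  obtain k where k: "0 < Re (k * e1)" "0 < Re (k * e2)" using half_plane_containing_sector[OF indep] .
  define c0 where "c0 = min 1 (min (Re (k * e1)) (Re (k * e2)))"
  have c0: "0 < c0" "c0 \<le> 1" "c0 \<le> Re (k * e1)" "c0 \<le> Re (k * e2)" using k by (auto simp: c0_def)
  define C0 where "C0 = max 1 (max (norm (k * e1)) (norm (k * e2)))"
  have C0: "1 \<le> C0" "norm (k * e1) \<le> C0" "norm (k * e2) \<le> C0" by (auto simp: C0_def)
  \<comment> \<open>All values \<open>u\<close> lie in the sector \<open>\<bar>Im u\<bar> \<le> M * Re u\<close>, of opening \<open>2 * arctan M\<close>.\<close>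
  define M where "M = C0 / c0"
  have M: "0 < M" using C0 c0 by (simp add: M_def)
  have "arctan M < pi / 2" "0 < arctan M" using arctan_ubound M by auto
  then have "1 < pi / 2 / arctan M" by (simp add: field_simps)
  then obtain p where p: "1 < p" "p < pi / 2 / arctan M" using dense by blast
  have pM: "p * arctan M < pi / 2" using p(2) \<open>0 < arctan M\<close> by (simp add: field_simps)
  define c1 where "c1 = cos (p * arctan M)"
  have c1: "0 < c1" unfolding c1_def using pM p \<open>0 < arctan M\<close> by (intro cos_gt_zero) auto
  define u where "u A t = of_real A + k * t" for A :: real and t
  have u: "c0 * (A + x + y) \<le> Re (u A t)" "norm (u A t) \<le> C0 * (A + x + y)"
    if "1 \<le> A" "0 \<le> x" "0 \<le> y" "t = of_real x * e1 + of_real y * e2" for A x y t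
  proof -
    have ut: "u A t = of_real A + of_real x * (k * e1) + of_real y * (k * e2)"
      by (simp add: u_def that algebra_simps)
    have "c0 * A \<le> A" "c0 * x \<le> x * Re (k * e1)" "c0 * y \<le> y * Re (k * e2)"
      using that c0 mult_right_mono[OF c0(3) that(2)] mult_right_mono[OF c0(4) that(3)]
      by (auto simp: mult_left_le_one_le mult.commute)
    then show "c0 * (A + x + y) \<le> Re (u A t)" unfolding ut by (simp add: algebra_simps)
    have "norm (u A t) \<le> A + x * norm (k * e1) + y * norm (k * e2)"
      unfolding ut using that by (intro norm_triangle_mono) (auto simp: norm_mult)
    also have "\<dots> \<le> C0 * A + x * C0 + y * C0"
      using that C0 mult_right_mono[OF C0(1), of A] by (intro add_mono mult_left_mono) auto
    finally show "norm (u A t) \<le> C0 * (A + x + y)" by (simp add: algebra_simps)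
  qed
  define pp where "pp s A t = of_real (A powr (p - 1)) * u A t powr of_real s" for s A t
  define C where "C = max (c0 powr (- p)) (max (p * norm k * c0 powr (- p - 1)) (p * (p + 1) * (norm k)\<^sup>2 * c0 powr (- p - 2)))"
  show thesis
  proof
    show "1 < p" by (rule p)
    show "0 < c1 * C0 powr (- p)" using c1 C0 by simp
    show "0 < C" using c0 by (simp add: C_def less_max_iff_disj)
    fix A x y :: real and t :: complex
    assume A: "1 \<le> A" and x: "0 \<le> x" and y: "0 \<le> y" and t: "t = of_real x * e1 + of_real y * e2"
    define S where "S = A + x + y"
    have S: "1 \<le> S" using A x y by (simp add: S_def)
    have uR: "c0 * S \<le> Re (u A t)" and uN: "norm (u A t) \<le> C0 * S" using u[OF A x y t] by (auto simp: S_def)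
    have uRpos: "0 < Re (u A t)" using uR c0 S mult_pos_pos[of c0 S] by linarith
    then have u0: "u A t \<noteq> 0" "u A t \<notin> \<real>\<^sub>\<le>\<^sub>0" by (auto simp: complex_nonpos_Reals_iff)
    have Re_le: "Re (u A t) \<le> norm (u A t)" by (rule complex_Re_le_cmod)
    have low: "c0 * S \<le> norm (u A t)" using uR Re_le by linarith
    have upper: "norm (u A t) powr (- s) \<le> c0 powr (- s) * S powr (- s)" if "0 \<le> s" for s
      using powr_mono2'[of "- s" "c0 * S" "norm (u A t)"] that low c0 S by (simp add: powr_mult)
    have du: "(u A has_field_derivative k) (at t)"
      unfolding u_def[abs_def] by (auto intro!: derivative_eq_intros)
    have dpp: "(pp s A has_field_derivative of_real s * k * pp (s - 1) A t) (at t)" for s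
      unfolding pp_def[abs_def]
      using DERIV_cmult[OF DERIV_chain2[OF has_field_derivative_powr[OF u0(2), of "of_real s"] du], of "of_real (A powr (p - 1))"]
      by (simp add: mult_ac)
    have npp: "norm (pp (- s) A t) \<le> A powr (p - 1) * (c0 powr (- s) * S powr (- s))" if "0 \<le> s" for s
      unfolding pp_def norm_mult norm_powr_of_real[OF u0(1)] using upper[OF that] A
      by (simp add: mult_left_mono)
    have "Im (u A t) / Re (u A t) \<le> M" "- M \<le> Im (u A t) / Re (u A t)"
    proof -
      have "\<bar>Im (u A t)\<bar> \<le> C0 * S" using abs_Im_le_cmod[of "u A t"] uN by linarith
      also have "\<dots> = M * (c0 * S)" using c0 by (simp add: M_def)
      also have "\<dots> \<le> M * Re (u A t)" using uR M by simp
      finally show "Im (u A t) / Re (u A t) \<le> M" "- M \<le> Im (u A t) / Re (u A t)"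
        using uRpos by (auto simp: field_simps abs_le_iff)
    qed
    then have "\<bar>arctan (Im (u A t) / Re (u A t))\<bar> \<le> arctan M"
      using arctan_le_iff[of "Im (u A t) / Re (u A t)" M] arctan_le_iff[of "- M" "Im (u A t) / Re (u A t)"]
      by (simp add: arctan_minus abs_le_iff)
    moreover have "Im (Ln (u A t)) = arctan (Im (u A t) / Re (u A t))"
      using arg_conv_arctan[OF uRpos] Arg_eq_Im_Ln[OF u0(1)] by simp
    ultimately have "\<bar>p * Im (Ln (u A t))\<bar> \<le> p * arctan M" using p(1) by (simp add: abs_mult)
    moreover have "p * arctan M \<le> pi" using pM pi_gt_zero by linarith
    ultimately have cosb: "c1 \<le> cos (- p * Im (Ln (u A t)))"
      unfolding c1_def using cos_monotone_0_pi_le[of "\<bar>p * Im (Ln (u A t))\<bar>" "p * arctan M"] by simp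
    have lowN: "C0 powr (- p) * S powr (- p) \<le> norm (u A t) powr (- p)"
      using powr_mono2'[of "- p" "norm (u A t)" "C0 * S"] uN u0(1) p(1) C0 S by (simp add: powr_mult)
    have Wd: "weight p A (x, y) = A powr (p - 1) * S powr (- p)" by (simp add: weight_def S_def)
    have "c1 * C0 powr (- p) * weight p A (x, y) \<le> Re (pp (- p) A t)"
    proof -
      have "C0 powr (- p) * S powr (- p) * c1 \<le> norm (u A t) powr (- p) * cos (- p * Im (Ln (u A t)))"
        using lowN cosb c1 by (intro mult_mono) auto
      then have "A powr (p - 1) * (C0 powr (- p) * S powr (- p) * c1)
          \<le> A powr (p - 1) * (norm (u A t) powr (- p) * cos (- p * Im (Ln (u A t))))"
        by (rule mult_left_mono) simp
      also have "\<dots> = Re (pp (- p) A t)"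
        unfolding pp_def using Re_powr_of_real[OF u0(1), of "- p"] by simp
      finally show ?thesis by (simp add: Wd mult_ac)
    qed
    moreover have "norm (pp (- p) A t) \<le> C * weight p A (x, y)"
    proof -
      have "norm (pp (- p) A t) \<le> c0 powr (- p) * weight p A (x, y)" using npp[of p] p by (simp add: Wd mult_ac)
      also have "\<dots> \<le> C * weight p A (x, y)" by (rule mult_right_mono) (auto simp: C_def Wd)
      finally show ?thesis .
    qed
    moreover have "norm (of_real (- p) * k * pp (- p - 1) A t) \<le> C * (A powr (p - 1) * S powr (- p - 1))"
    proof -
      have "norm (of_real (- p) * k * pp (- p - 1) A t) = (p * norm k) * norm (pp (- (p + 1)) A t)"
        using p by (simp add: norm_mult)
      also have "\<dots> \<le> (p * norm k) * (A powr (p - 1) * (c0 powr (- (p + 1)) * S powr (- (p + 1))))"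
        using p by (intro mult_left_mono npp) auto
      also have "\<dots> = (p * norm k * c0 powr (- p - 1)) * (A powr (p - 1) * S powr (- p - 1))"
        by (simp add: mult_ac)
      also have "\<dots> \<le> C * (A powr (p - 1) * S powr (- p - 1))" by (rule mult_right_mono) (auto simp: C_def)
      finally show ?thesis .
    qed
    moreover have "norm (of_real (- p) * k * (of_real (- p - 1) * k * pp (- p - 2) A t)) \<le> C * (A powr (p - 1) * S powr (- p - 1))"
    proof -
      have "norm (of_real (- p) * k * (of_real (- p - 1) * k * pp (- p - 2) A t))
          = (p * (p + 1) * (norm k)\<^sup>2) * norm (pp (- (p + 2)) A t)"
      proof -
        have "norm (complex_of_real (- p - 1)) = p + 1" using p by (subst norm_of_real) simp
        then show ?thesis using p by (simp add: norm_mult power2_eq_square del: of_real_diff of_real_minus)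
      qed
      also have "\<dots> \<le> (p * (p + 1) * (norm k)\<^sup>2) * (A powr (p - 1) * (c0 powr (- (p + 2)) * S powr (- (p + 2))))"
        using p by (intro mult_left_mono npp) auto
      also have "\<dots> \<le> (p * (p + 1) * (norm k)\<^sup>2) * (A powr (p - 1) * (c0 powr (- (p + 2)) * S powr (- p - 1)))"
        using p S by (intro mult_left_mono powr_mono) auto
      also have "\<dots> = (p * (p + 1) * (norm k)\<^sup>2 * c0 powr (- p - 2)) * (A powr (p - 1) * S powr (- p - 1))"
        by (simp add: mult_ac)
      also have "\<dots> \<le> C * (A powr (p - 1) * S powr (- p - 1))" by (rule mult_right_mono) (auto simp: C_def)
      finally show ?thesis .
    qed
    moreover have "((\<lambda>t. of_real (- p) * k * pp (- p - 1) A t) has_field_derivative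
        of_real (- p) * k * (of_real (- p - 1) * k * pp (- p - 2) A t)) (at t)"
      using DERIV_cmult[OF dpp[of "- p - 1"], of "of_real (- p) * k"] by (simp add: algebra_simps)
    moreover have "(\<lambda>t. of_real (- p) * k * (of_real (- p - 1) * k * pp (- p - 2) A t)) field_differentiable (at t)"
      using DERIV_cmult[OF DERIV_cmult[OF dpp[of "- p - 2"], of "of_real (- p - 1) * k"], of "of_real (- p) * k"]
      unfolding field_differentiable_def by blast
    ultimately show "(pp (- p) A has_field_derivative (\<lambda>A t. of_real (- p) * k * pp (- p - 1) A t) A t) (at t) \<and>
      ((\<lambda>A t. of_real (- p) * k * pp (- p - 1) A t) A has_field_derivative
        (\<lambda>A t. of_real (- p) * k * (of_real (- p - 1) * k * pp (- p - 2) A t)) A t) (at t) \<and>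
      (\<lambda>A t. of_real (- p) * k * (of_real (- p - 1) * k * pp (- p - 2) A t)) A field_differentiable (at t) \<and>
      c1 * C0 powr (- p) * weight p A (x, y) \<le> Re (pp (- p) A t) \<and>
      norm (pp (- p) A t) \<le> C * weight p A (x, y) \<and>
      norm ((\<lambda>A t. of_real (- p) * k * pp (- p - 1) A t) A t) \<le> C * (A powr (p - 1) * (A + x + y) powr (- p - 1)) \<and>
      norm ((\<lambda>A t. of_real (- p) * k * (of_real (- p - 1) * k * pp (- p - 2) A t)) A t)
        \<le> C * (A powr (p - 1) * (A + x + y) powr (- p - 1))"
      using dpp[of "- p"] by (simp add: S_def)
  qed
qed

section \<open>Test functions and Wirtinger derivatives\<close>

lemma nderiv_append: "nderiv (vs @ ws) f = nderiv vs (nderiv ws f)"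
  by (induction vs) auto

lemma smooth_imp_has_derivative:
  assumes "smooth_on UNIV f"
  shows "(nderiv vs f has_derivative frechet_derivative (nderiv vs f) (at z)) (at z)"
  using assms unfolding smooth_on_def differentiable_on_def
  by (metis UNIV_I frechet_derivative_works)

lemma smooth_nderiv: "smooth_on UNIV f \<Longrightarrow> smooth_on UNIV (nderiv vs f)"
  unfolding smooth_on_def by (simp add: nderiv_append[symmetric])

lemma smooth_linear_combination:
  fixes f g :: "'a::real_normed_vector \<Rightarrow> complex"
  assumes f: "smooth_on UNIV f" and g: "smooth_on UNIV g"
  shows "smooth_on UNIV (\<lambda>z. a * f z + b * g z)"
proof -
  have d: "((\<lambda>z. a * nderiv vs f z + b * nderiv vs g z) has_derivative
      (\<lambda>v. a * frechet_derivative (nderiv vs f) (at z) v + b * frechet_derivative (nderiv vs g) (at z) v)) (at z)" for vs z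
    by (intro has_derivative_add has_derivative_mult_right smooth_imp_has_derivative f g)
  have "nderiv vs (\<lambda>z. a * f z + b * g z) = (\<lambda>z. a * nderiv vs f z + b * nderiv vs g z)" for vs
  proof (induction vs)
    case (Cons v vs)
    show ?case
    proof
      fix z
      show "nderiv (v # vs) (\<lambda>z. a * f z + b * g z) z = a * nderiv (v # vs) f z + b * nderiv (v # vs) g z"
        using fun_cong[OF frechet_derivative_at[OF d[of vs z]], of v] by (simp add: Cons.IH)
    qed
  qed simp
  then show ?thesis
    unfolding smooth_on_def differentiable_on_def differentiable_def using d by auto
qed

lemma nderiv_eq_0_outside:
  assumes K: "closed K" and f: "\<And>z. z \<notin> K \<Longrightarrow> f z = 0" and z: "z \<notin> K"
  shows "nderiv vs f z = 0"
  using z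
proof (induction vs arbitrary: z)
  case (Cons v vs)
  have "((\<lambda>_. 0) has_derivative (\<lambda>_. 0)) (at z)" by (rule has_derivative_const)
  then have "(nderiv vs f has_derivative (\<lambda>_. 0)) (at z)"
    by (rule has_derivative_transform_within_open[of _ _ _ _ "- K"]) (use K Cons in auto)
  from fun_cong[OF frechet_derivative_at[OF this], of v] show ?case by simp
qed (use f in simp)

lemma test_on_imp_continuous: "test_on U f \<Longrightarrow> continuous_on S f"
proof -
  assume "test_on U f"
  then have "f differentiable_on UNIV"
    unfolding test_on_def smooth_on_def by (metis nderiv.simps(1))
  then show ?thesis by (meson continuous_on_subset differentiable_imp_continuous_on subset_UNIV)
qed

lemma test_on_imp_bounded:
  fixes f :: "'a::real_normed_vector \<Rightarrow> 'b::real_normed_vector"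
  assumes "test_on U f"
  obtains M where "0 \<le> M" "\<And>z. norm (f z) \<le> M"
proof -
  obtain K where K: "compact K" "\<And>z. z \<notin> K \<Longrightarrow> f z = 0" using assms unfolding test_on_def by blast
  have "bounded (f ` K)"
    by (intro compact_imp_bounded compact_continuous_image test_on_imp_continuous[OF assms] K)
  then obtain B where B: "\<And>z. z \<in> K \<Longrightarrow> norm (f z) \<le> B" unfolding bounded_iff by blast
  have "norm (f z) \<le> max 0 B" for z using B[of z] K(2)[of z] by (cases "z \<in> K") auto
  then show thesis using that[of "max 0 B"] by auto
qed

lemma test_on_nderiv:
  assumes "test_on U f"
  shows "test_on U (nderiv vs f)"
  using assms nderiv_eq_0_outside[OF compact_imp_closed] smooth_nderiv unfolding test_on_def by metis

lemma test_on_linear_combination: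
  fixes f g :: "'a::real_normed_vector \<Rightarrow> complex"
  assumes f: "test_on U f" and g: "test_on U g"
  shows "test_on U (\<lambda>z. a * f z + b * g z)"
proof -
  obtain K L where "compact K" "K \<subseteq> U" "\<And>z. z \<notin> K \<Longrightarrow> f z = 0" "compact L" "L \<subseteq> U" "\<And>z. z \<notin> L \<Longrightarrow> g z = 0"
    using f g unfolding test_on_def by blast
  then have "compact (K \<union> L)" "K \<union> L \<subseteq> U" "\<forall>z. z \<notin> K \<union> L \<longrightarrow> a * f z + b * g z = 0" by auto
  then show ?thesis
    using smooth_linear_combination f g unfolding test_on_def by blast
qed

lemma d_z_eq_nderiv: "d_z j f = (\<lambda>z. (1/2) * nderiv [axis j 1] f z + (- \<i>/2) * nderiv [axis j \<i>] f z)"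
  by (simp add: d_z_def fun_eq_iff field_simps)

lemma d_zbar_eq_nderiv: "d_zbar j f = (\<lambda>z. (1/2) * nderiv [axis j 1] f z + (\<i>/2) * nderiv [axis j \<i>] f z)"
  by (simp add: d_zbar_def fun_eq_iff field_simps)

lemma test_on_d_z: "test_on U f \<Longrightarrow> test_on U (d_z j f)"
  unfolding d_z_eq_nderiv by (intro test_on_linear_combination test_on_nderiv)

lemma test_on_d_zbar: "test_on U f \<Longrightarrow> test_on U (d_zbar j f)"
  unfolding d_zbar_eq_nderiv by (intro test_on_linear_combination test_on_nderiv)

lemma Wirtinger_expansion:
  fixes f :: "C2 \<Rightarrow> complex"
  assumes "(f has_derivative D) (at z)"
  shows "D v = (\<Sum>j\<in>UNIV. d_z j f z * v $ j + d_zbar j f z * cnj (v $ j))"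
proof -
  have D: "frechet_derivative f (at z) = D" using frechet_derivative_at[OF assms] by simp
  have lin: "linear D" by (rule has_derivative_linear[OF assms])
  have v: "v = (\<Sum>j\<in>UNIV. Re (v $ j) *\<^sub>R axis j 1 + Im (v $ j) *\<^sub>R axis j \<i>)"
    by (simp add: vec_eq_iff axis_def complex_eq_iff UNIV_2 forall_2)
  have "D v = (\<Sum>j\<in>UNIV. Re (v $ j) *\<^sub>R D (axis j 1) + Im (v $ j) *\<^sub>R D (axis j \<i>))"
    by (subst v) (simp add: linear_sum[OF lin] linear_add[OF lin] linear_scale[OF lin])
  also have "\<dots> = (\<Sum>j\<in>UNIV. d_z j f z * v $ j + d_zbar j f z * cnj (v $ j))"
  proof (rule sum.cong[OF refl])
    fix j
    show "Re (v $ j) *\<^sub>R D (axis j 1) + Im (v $ j) *\<^sub>R D (axis j \<i>)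
        = d_z j f z * v $ j + d_zbar j f z * cnj (v $ j)"
      unfolding d_z_def d_zbar_def D by (simp add: complex_eq_iff field_simps)
  qed
  finally show ?thesis .
qed

text \<open>\<open>a\<close> and \<open>b\<close> are the derivatives with respect to \<open>t\<close> and to its conjugate. Products of
  holomorphic and antiholomorphic factors are then differentiated by one product rule.\<close>

definition Wirtinger :: "(complex \<Rightarrow> complex) \<Rightarrow> complex \<Rightarrow> complex \<Rightarrow> complex \<Rightarrow> bool" where
  "Wirtinger F a b t \<longleftrightarrow> (F has_derivative (\<lambda>e. a * e + b * cnj e)) (at t)"

lemma Wirtinger_mult:
  assumes "Wirtinger F a b t" "Wirtinger G a' b' t"
  shows "Wirtinger (\<lambda>t. F t * G t) (a * G t + F t * a') (b * G t + F t * b') t"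
  using has_derivative_mult[OF assms[unfolded Wirtinger_def]]
  unfolding Wirtinger_def by (simp add: algebra_simps)

lemma Wirtinger_sum:
  assumes "\<And>i. i \<in> I \<Longrightarrow> Wirtinger (F i) (a i) (b i) t"
  shows "Wirtinger (\<lambda>t. \<Sum>i\<in>I. F i t) (\<Sum>i\<in>I. a i) (\<Sum>i\<in>I. b i) t"
  using has_derivative_sum[of I F, OF assms[unfolded Wirtinger_def]]
  unfolding Wirtinger_def by (simp add: sum_distrib_right sum.distrib)

lemma Wirtinger_holomorphic: "(F has_field_derivative a) (at t) \<Longrightarrow> Wirtinger F a 0 t"
  unfolding Wirtinger_def has_field_derivative_def by simp

lemma Wirtinger_cnj: "Wirtinger F a b t \<Longrightarrow> Wirtinger (\<lambda>t. cnj (F t)) (cnj b) (cnj a) t"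
  unfolding Wirtinger_def using bounded_linear.has_derivative[OF bounded_linear_cnj]
  by (fastforce simp: add.commute)

lemma Wirtinger_compose:
  fixes P :: "complex \<Rightarrow> C2"
  assumes f: "test_on U f" and P: "\<And>j. ((\<lambda>t. P t $ j) has_field_derivative P' $ j) (at t)"
  shows "Wirtinger (\<lambda>t. f (P t)) (\<Sum>j\<in>UNIV. d_z j f (P t) * P' $ j) (\<Sum>j\<in>UNIV. d_zbar j f (P t) * cnj (P' $ j)) t"
proof -
  have dP: "(P has_derivative (\<lambda>e. e *s P')) (at t)"
    by (rule has_derivative_vec_lambda)
      (use P in \<open>simp add: has_field_derivative_def mult_commute_abs\<close>)
  have "(f has_derivative frechet_derivative f (at (P t))) (at (P t))"
    using smooth_imp_has_derivative[of f "[]"] f unfolding test_on_def by simp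
  from has_derivative_compose[OF dP this]
  have "((\<lambda>t. f (P t)) has_derivative (\<lambda>e. frechet_derivative f (at (P t)) (e *s P'))) (at t)" .
  moreover have "frechet_derivative f (at (P t)) (e *s P')
      = (\<Sum>j\<in>UNIV. d_z j f (P t) * P' $ j) * e + (\<Sum>j\<in>UNIV. d_zbar j f (P t) * cnj (P' $ j)) * cnj e" for e
    unfolding Wirtinger_expansion[OF \<open>(f has_derivative _) (at (P t))\<close>]
    by (simp add: sum.distrib sum_distrib_left sum_distrib_right mult_ac)
  ultimately show ?thesis unfolding Wirtinger_def by simp
qed

lemma ddc_norm_squared:
  "ddc (\<lambda>z. of_real ((norm z)\<^sup>2)) z $ j $ k = (if j = k then \<i> / of_real pi else 0)"
proof -
  have d1: "((\<lambda>z::C2. complex_of_real ((norm z)\<^sup>2)) has_derivative (\<lambda>v. of_real (2 * (z \<bullet> v)))) (at z)" for z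
  proof -
    have "((\<lambda>z::C2. z \<bullet> z) has_derivative (\<lambda>v. z \<bullet> v + v \<bullet> z)) (at z)"
      by (intro has_derivative_inner has_derivative_ident)
    from has_derivative_of_real[OF this, where 'a=complex] show ?thesis
      by (simp add: power2_norm_eq_inner inner_commute[of _ z])
  qed
  have "d_zbar k (\<lambda>z. of_real ((norm z)\<^sup>2)) = (\<lambda>z. z $ k)"
  proof
    fix z
    show "d_zbar k (\<lambda>z. of_real ((norm z)\<^sup>2)) z = z $ k"
      unfolding d_zbar_def frechet_derivative_at[OF d1, symmetric]
      by (simp add: inner_axis complex_eq_iff)
  qed
  moreover have "((\<lambda>z::C2. z $ k) has_derivative (\<lambda>v. v $ k)) (at z)"
    by (intro bounded_linear_imp_has_derivative bounded_linear_vec_nth)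
  ultimately show ?thesis
    unfolding ddc_def d_z_def by (simp add: frechet_derivative_at[symmetric] axis_def)
qed

section \<open>A leaf through the linearizing coordinates\<close>

text \<open>A function that decays is integrable against a kernel, a bounded one against a derivative of a kernel.\<close>

definition bounded_on_quadrant :: "(real \<times> real \<Rightarrow> complex) \<Rightarrow> bool" where
  "bounded_on_quadrant f \<longleftrightarrow> continuous_on quadrant f \<and> (\<exists>N. \<forall>z\<in>quadrant. norm (f z) \<le> N)"

definition decays :: "(real \<times> real \<Rightarrow> complex) \<Rightarrow> bool" where
  "decays f \<longleftrightarrow> continuous_on quadrant f \<and> (\<exists>N. \<forall>z\<in>quadrant. norm (f z) \<le> N * edge_decay z)"

lemma edge_decay_pos: "0 < edge_decay z"
  by (simp add: edge_decay_def add_pos_pos)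

lemma edge_decay_le: "z \<in> quadrant \<Longrightarrow> edge_decay z \<le> 2"
proof -
  assume "z \<in> quadrant"
  then have "exp (- fst z) \<le> 1" "exp (- snd z) \<le> 1" by auto
  then show ?thesis unfolding edge_decay_def by linarith
qed

lemma decays_bound:
  assumes "decays f" obtains N where "0 \<le> N" "\<And>z. z \<in> quadrant \<Longrightarrow> norm (f z) \<le> N * edge_decay z"
proof -
  obtain N where N: "\<And>z. z \<in> quadrant \<Longrightarrow> norm (f z) \<le> N * edge_decay z"
    using assms unfolding decays_def by blast
  have "norm (f z) \<le> max 0 N * edge_decay z" if "z \<in> quadrant" for z
    using order.trans[OF N[OF that] mult_right_mono[of N "max 0 N" "edge_decay z"]] edge_decay_pos[of z] by simp
  then show thesis using that[of "max 0 N"] by simp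
qed

lemma bounded_on_quadrant_bound:
  assumes "bounded_on_quadrant f" obtains N where "0 \<le> N" "\<And>z. z \<in> quadrant \<Longrightarrow> norm (f z) \<le> N"
proof -
  obtain N where N: "\<And>z. z \<in> quadrant \<Longrightarrow> norm (f z) \<le> N"
    using assms unfolding bounded_on_quadrant_def by blast
  then show thesis using that[of "max 0 N"] by (meson max.cobounded1 max.coboundedI2)
qed

lemma decays_imp_bounded: "decays f \<Longrightarrow> bounded_on_quadrant f"
proof -
  assume f: "decays f"
  then obtain N where N: "0 \<le> N" "\<And>z. z \<in> quadrant \<Longrightarrow> norm (f z) \<le> N * edge_decay z" using decays_bound by blast
  have "norm (f z) \<le> N * 2" if "z \<in> quadrant" for z
    using order.trans[OF N(2)[OF that] mult_left_mono[OF edge_decay_le[OF that] N(1)]] .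
  then show ?thesis using f unfolding decays_def bounded_on_quadrant_def by blast
qed

lemma decays_mult_left:
  assumes f: "bounded_on_quadrant f" and g: "decays g" shows "decays (\<lambda>z. f z * g z)"
proof -
  obtain M where M: "0 \<le> M" "\<And>z. z \<in> quadrant \<Longrightarrow> norm (f z) \<le> M" using bounded_on_quadrant_bound[OF f] by blast
  obtain N where N: "0 \<le> N" "\<And>z. z \<in> quadrant \<Longrightarrow> norm (g z) \<le> N * edge_decay z" using decays_bound[OF g] by blast
  have "norm (f z * g z) \<le> M * N * edge_decay z" if "z \<in> quadrant" for z
    using mult_mono[OF M(2)[OF that] N(2)[OF that]] M N by (simp add: norm_mult mult.assoc)
  moreover have "continuous_on quadrant (\<lambda>z. f z * g z)"
    using f g unfolding decays_def bounded_on_quadrant_def by (auto intro!: continuous_on_mult)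
  ultimately show ?thesis unfolding decays_def by blast
qed

lemma decays_add:
  assumes f: "decays f" and g: "decays g" shows "decays (\<lambda>z. f z + g z)"
proof -
  obtain M where M: "0 \<le> M" "\<And>z. z \<in> quadrant \<Longrightarrow> norm (f z) \<le> M * edge_decay z" using decays_bound[OF f] by blast
  obtain N where N: "0 \<le> N" "\<And>z. z \<in> quadrant \<Longrightarrow> norm (g z) \<le> N * edge_decay z" using decays_bound[OF g] by blast
  have "norm (f z + g z) \<le> (M + N) * edge_decay z" if "z \<in> quadrant" for z
    using norm_triangle_le[OF add_mono[OF M(2)[OF that] N(2)[OF that]]] by (simp add: distrib_right)
  moreover have "continuous_on quadrant (\<lambda>z. f z + g z)"
    using f g unfolding decays_def by (auto intro!: continuous_on_add)
  ultimately show ?thesis unfolding decays_def by blast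
qed

lemma decays_sum: "(\<And>i. i \<in> I \<Longrightarrow> decays (f i)) \<Longrightarrow> decays (\<lambda>z. \<Sum>i\<in>I. f i z)"
proof (induction I rule: infinite_finite_induct)
  case (insert i I)
  then show ?case by (simp add: decays_add)
qed (auto simp: decays_def intro!: exI[of _ 0])

lemma decays_cnj: "decays f \<Longrightarrow> decays (\<lambda>z. cnj (f z))"
  unfolding decays_def by (auto intro: continuous_on_cnj)

lemma set_integrable_quadrant:
  fixes f :: "real \<times> real \<Rightarrow> complex" and g :: "real \<times> real \<Rightarrow> real"
  assumes f: "continuous_on quadrant f" and g: "set_integrable lborel quadrant g"
    and le: "\<And>z. z \<in> quadrant \<Longrightarrow> norm (f z) \<le> B * g z"
  shows "set_integrable lborel quadrant f"
proof (rule set_integrable_bound)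
  show "set_integrable lborel quadrant (\<lambda>z. B * g z)" using g by simp
  have "(\<lambda>z. indicator quadrant z *\<^sub>R f z) \<in> borel_measurable borel"
    by (rule borel_measurable_continuous_on_indicator[OF quadrant_measurable f])
  then show "set_borel_measurable lborel quadrant f" by (simp add: set_borel_measurable_def)
  show "AE z in lborel. z \<in> quadrant \<longrightarrow> norm (f z) \<le> norm (B * g z)"
    by (intro AE_I2 impI) (simp only: real_norm_def order.trans[OF le abs_ge_self])
qed

lemma weight_over_distance_le:
  assumes "1 < p" "1 \<le> A" "z \<in> quadrant"
  shows "A powr (p - 1) * (A + fst z + snd z) powr (- p - 1) \<le> weight p A z"
  unfolding weight_def using assms by (intro mult_left_mono powr_mono) auto

lemma weight_le:
  assumes "1 < p" "1 \<le> A" "z \<in> quadrant"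
  shows "weight p A z \<le> A powr (p - 1) / (1 + fst z + snd z)" and "weight p A z \<le> 1"
proof -
  have z: "0 < fst z" "0 < snd z" using assms by auto
  have "(A + fst z + snd z) powr (- p) \<le> (A + fst z + snd z) powr (- 1)"
    using assms z by (intro powr_mono) auto
  also have "\<dots> \<le> (1 + fst z + snd z) powr (- 1)" using assms z by (intro powr_mono2') auto
  also have "\<dots> = 1 / (1 + fst z + snd z)" using z by (simp add: powr_minus_divide)
  finally show "weight p A z \<le> A powr (p - 1) / (1 + fst z + snd z)"
    unfolding weight_def using mult_left_mono[of _ "1 / (1 + fst z + snd z)" "A powr (p - 1)"] by simp
  have "weight p A z \<le> A powr (p - 1) * A powr (- p)"
    unfolding weight_def using assms z by (intro mult_left_mono powr_mono2') auto
  also have "\<dots> = 1 / A" using assms by (simp add: powr_add[symmetric] powr_neg_one)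
  also have "\<dots> \<le> 1" using assms by simp
  finally show "weight p A z \<le> 1" .
qed

text \<open>\<open>K\<close> carries the linear field \<open>\<eta> z\<^sub>1 \<partial>/\<partial>z\<^sub>1 + z\<^sub>2 \<partial>/\<partial>z\<^sub>2\<close> to \<open>G\<close>, and thus the leaves of the one to those
  of the other.\<close>

locale leaf =
  fixes \<eta> :: complex and K G :: "C2 \<Rightarrow> C2" and C :: real
  assumes Im_eta: "Im \<eta> \<noteq> 0"
    and K_holomorphic: "holomorphic_map_on (polydisc 2) K"
    and K_inj: "inj_on K (polydisc 2)"
    and K_bound: "\<And>w. w \<in> polydisc 2 \<Longrightarrow> norm (K w) \<le> C * norm w" and C_pos: "0 < C"
    and K_field: "\<And>w. w \<in> polydisc 2 \<Longrightarrow> frechet_derivative K (at w) (linear_field \<eta> w) = G (K w)"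
begin

definition linear_leaf :: "complex \<Rightarrow> C2" where
  "linear_leaf t = vector [exp (\<eta> * t), exp t]"

definition param :: "complex \<Rightarrow> C2" where
  "param t = K (linear_leaf t)"

text \<open>\<open>tau (x, y)\<close> is the point \<open>t\<close> with \<open>Re t = - x\<close> and \<open>Re (\<eta> t) = - y\<close>, so that the part of the leaf
  inside the bidisc is parametrized by a quadrant.\<close>

definition e_x :: complex where "e_x = - \<i> * cnj \<eta> / of_real (Im \<eta>)"
definition e_y :: complex where "e_y = \<i> / of_real (Im \<eta>)"
definition tau :: "real \<times> real \<Rightarrow> complex" where
  "tau z = of_real (fst z) * e_x + of_real (snd z) * e_y"

definition leaf_domain :: "complex set" where
  "leaf_domain = {t. Re t < ln 2 \<and> Re (\<eta> * t) < ln 2}"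

definition param_deriv2 :: "2 \<Rightarrow> complex \<Rightarrow> complex" where
  "param_deriv2 j t = deriv (\<lambda>t. G (param t) $ j) t"

lemma Re_e_x_y: "Re e_x = -1" "Re (\<eta> * e_x) = 0" "Re e_y = 0" "Re (\<eta> * e_y) = -1"
  using Im_eta by (simp_all add: e_x_def e_y_def Re_divide_of_real Im_divide_of_real field_simps)

lemma e_x_y_independent: "Im (cnj e_x * e_y) \<noteq> 0"
proof -
  have "Im (cnj e_x * e_y) = - 1 / Im \<eta>"
    using Im_eta by (simp add: e_x_def e_y_def Re_divide_of_real Im_divide_of_real)
  then show ?thesis using Im_eta by simp
qed

lemma Re_tau: "Re (tau z) = - fst z" "Re (\<eta> * tau z) = - snd z"
proof -
  show "Re (tau z) = - fst z" by (simp add: tau_def Re_e_x_y)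
  have "\<eta> * tau z = of_real (fst z) * (\<eta> * e_x) + of_real (snd z) * (\<eta> * e_y)"
    by (simp add: tau_def algebra_simps)
  then show "Re (\<eta> * tau z) = - snd z"
    by (simp only: plus_complex.sel Re_complex_of_real Im_complex_of_real times_complex.sel(1)[of "of_real _"] Re_e_x_y)
qed

lemma norm_linear_leaf: "norm (linear_leaf t $ 1) = exp (Re (\<eta> * t))" "norm (linear_leaf t $ 2) = exp (Re t)"
  by (simp_all add: linear_leaf_def)

lemma norm_linear_leaf_le: "norm (linear_leaf t) \<le> exp (Re t) + exp (Re (\<eta> * t))"
  using norm_le_add_coordinates[of "linear_leaf t"] by (simp add: norm_linear_leaf)

lemma linear_leaf_in_polydisc: "t \<in> leaf_domain \<Longrightarrow> linear_leaf t \<in> polydisc 2"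
  unfolding polydisc_def leaf_domain_def mem_Collect_eq norm_linear_leaf
  by (metis exp_less_mono exp_ln zero_less_numeral)

lemma linear_leaf_tau_in_polydisc: "z \<in> quadrant \<Longrightarrow> linear_leaf (tau z) \<in> polydisc 1"
  by (simp add: polydisc_def norm_linear_leaf Re_tau del: times_complex.sel)

lemma param_tau_in: "z \<in> quadrant \<Longrightarrow> param (tau z) \<in> K ` polydisc 1"
  unfolding param_def using linear_leaf_tau_in_polydisc by blast

lemma tau_in_leaf_domain: "z \<in> quadrant \<Longrightarrow> tau z \<in> leaf_domain"
proof -
  assume "z \<in> quadrant"
  moreover have "0 < ln (2::real)" by simp
  ultimately show ?thesis unfolding leaf_domain_def mem_Collect_eq Re_tau quadrant_iff by linarith
qed

lemma open_leaf_domain: "open leaf_domain"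
  unfolding leaf_domain_def by (intro open_Collect_conj open_Collect_less continuous_intros)

text \<open>The field \<open>G\<close> is the velocity of the parametrization, so that the current is expressed without derivatives
  of \<open>param\<close>.\<close>

lemma param_derivative:
  assumes t: "t \<in> leaf_domain" shows "((\<lambda>t. param t $ j) has_field_derivative G (param t) $ j) (at t)"
proof -
  note w = linear_leaf_in_polydisc[OF t]
  have "(linear_leaf has_derivative (\<lambda>s. s *s linear_field \<eta> (linear_leaf t))) (at t)"
  proof (rule has_derivative_vec_lambda)
    fix i :: 2
    have "((\<lambda>t. exp (\<eta> * t)) has_field_derivative \<eta> * exp (\<eta> * t)) (at t)"
      "((\<lambda>t. exp t) has_field_derivative exp t) (at t)"
      by (auto intro!: derivative_eq_intros)
    then show "((\<lambda>t. linear_leaf t $ i) has_derivative (\<lambda>s. (s *s linear_field \<eta> (linear_leaf t)) $ i)) (at t)"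
      using exhaust_2[of i] by (auto simp: linear_leaf_def linear_field_def has_field_derivative_def mult_commute_abs)
  qed
  from has_derivative_compose[OF this holomorphic_map_on_derivative(1)[OF K_holomorphic w]]
  have "(param has_derivative (\<lambda>s. s *s G (param t))) (at t)"
    unfolding param_def[abs_def] holomorphic_map_on_derivative(2)[OF K_holomorphic w] K_field[OF w] .
  from bounded_linear.has_derivative[OF bounded_linear_vec_nth this, of j] show ?thesis
    by (simp add: has_field_derivative_def mult_commute_abs)
qed

lemma param_holomorphic: "(\<lambda>t. param t $ j) holomorphic_on leaf_domain"
  using param_derivative holomorphic_on_open[OF open_leaf_domain] by blast

lemma G_holomorphic: "(\<lambda>t. G (param t) $ j) holomorphic_on leaf_domain"
  by (rule holomorphic_transform[OF holomorphic_deriv[OF param_holomorphic[of j] open_leaf_domain]])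
     (rule DERIV_imp_deriv[OF param_derivative])

lemma G_derivative: "t \<in> leaf_domain \<Longrightarrow> ((\<lambda>t. G (param t) $ j) has_field_derivative param_deriv2 j t) (at t)"
  unfolding param_deriv2_def by (rule holomorphic_derivI[OF G_holomorphic open_leaf_domain])

lemma continuous_on_tau: "continuous_on S tau"
  unfolding tau_def by (intro continuous_intros)

lemma continuous_on_quadrant_tau: "f holomorphic_on leaf_domain \<Longrightarrow> continuous_on quadrant (\<lambda>z. f (tau z))"
  by (rule continuous_on_compose2[OF holomorphic_on_imp_continuous_on continuous_on_tau])
     (use tau_in_leaf_domain in auto)

lemma continuous_on_param_tau: "continuous_on quadrant (\<lambda>z. param (tau z))"
proof -
  have "continuous_on quadrant (\<lambda>z. \<chi> j. param (tau z) $ j)"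
    by (intro continuous_on_vec_lambda continuous_on_quadrant_tau param_holomorphic)
  then show ?thesis by simp
qed

lemma norm_param_tau: "z \<in> quadrant \<Longrightarrow> norm (param (tau z)) \<le> C * edge_decay z"
  unfolding param_def
  by (rule order.trans[OF K_bound[OF linear_leaf_in_polydisc[OF tau_in_leaf_domain]]])
     (use C_pos norm_linear_leaf_le[of "tau z"] in
       \<open>auto simp: edge_decay_def Re_tau simp del: times_complex.sel intro!: mult_left_mono\<close>)

text \<open>The derivatives of the parametrization decay like the parametrization itself, by Cauchy's estimate
  on discs of a fixed radius.\<close>

lemma decays_G: "decays (\<lambda>z. G (param (tau z)) $ j)" and decays_param_deriv2: "decays (\<lambda>z. param_deriv2 j (tau z))"
proof -
  define r where "r = ln 2 / (1 + norm \<eta>)"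
  have n1: "0 < 1 + norm \<eta>" by (simp add: add_pos_nonneg)
  have r: "0 < r" "r \<le> ln 2" "norm \<eta> * r \<le> ln 2"
    using n1 by (auto simp: r_def field_simps)
  have disc: "s \<in> leaf_domain \<and> norm (param s $ j) \<le> 2 * C * edge_decay z"
    if z: "z \<in> quadrant" and s: "s \<in> cball (tau z) r" for z s
  proof -
    have ns: "norm (s - tau z) \<le> r" using s by (simp add: dist_norm norm_minus_commute)
    have "Re s - Re (tau z) \<le> norm (s - tau z)" using complex_Re_le_cmod[of "s - tau z"] by simp
    then have 1: "Re s \<le> - fst z + ln 2" using ns r by (simp add: Re_tau)
    have "Re (\<eta> * s) - Re (\<eta> * tau z) = Re (\<eta> * (s - tau z))" by (simp add: algebra_simps)
    also have "\<dots> \<le> norm \<eta> * norm (s - tau z)"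
      using complex_Re_le_cmod[of "\<eta> * (s - tau z)"] by (simp only: norm_mult)
    also have "\<dots> \<le> ln 2" using mult_left_mono[OF ns, of "norm \<eta>"] r by simp
    finally have 2: "Re (\<eta> * s) \<le> - snd z + ln 2" by (simp only: Re_tau)
    have sd: "s \<in> leaf_domain" using 1 2 z unfolding leaf_domain_def by auto
    have "norm (param s $ j) \<le> norm (param s)" by (rule Finite_Cartesian_Product.norm_nth_le)
    also have "\<dots> \<le> C * norm (linear_leaf s)" unfolding param_def by (rule K_bound[OF linear_leaf_in_polydisc[OF sd]])
    also have "\<dots> \<le> C * (exp (- fst z + ln 2) + exp (- snd z + ln 2))"
      using C_pos norm_linear_leaf_le[of s] 1 2
      by (intro mult_left_mono) (auto intro!: order.trans[OF norm_linear_leaf_le] add_mono simp del: times_complex.sel)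
    also have "\<dots> = 2 * C * edge_decay z" by (simp add: edge_decay_def exp_diff exp_minus field_simps)
    finally show ?thesis using sd by simp
  qed
  have est: "norm ((deriv ^^ n) (\<lambda>t. param t $ j) (tau z)) \<le> fact n * (2 * C * edge_decay z) / r ^ n"
    if z: "z \<in> quadrant" for n z
  proof (rule Cauchy_inequality[OF _ _ r(1)])
    have h: "(\<lambda>t. param t $ j) holomorphic_on cball (tau z) r"
      by (rule holomorphic_on_subset[OF param_holomorphic]) (use disc[OF z] in blast)
    then show "(\<lambda>t. param t $ j) holomorphic_on ball (tau z) r"
      by (rule holomorphic_on_subset) auto
    show "continuous_on (cball (tau z) r) (\<lambda>t. param t $ j)" by (rule holomorphic_on_imp_continuous_on[OF h])
    show "norm (param x $ j) \<le> 2 * C * edge_decay z" if "norm (tau z - x) = r" for x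
      using disc[OF z, of x] that by (simp add: dist_norm)
  qed
  have d1: "deriv (\<lambda>t. param t $ j) t = G (param t) $ j" if "t \<in> leaf_domain" for t
    by (rule DERIV_imp_deriv[OF param_derivative[OF that]])
  have "norm (G (param (tau z)) $ j) \<le> (2 * C / r) * edge_decay z" if z: "z \<in> quadrant" for z
    using est[OF z, of 1] d1[OF tau_in_leaf_domain[OF z]] by simp
  moreover have "continuous_on quadrant (\<lambda>z. G (param (tau z)) $ j)"
    by (rule continuous_on_quadrant_tau[OF G_holomorphic])
  ultimately show "decays (\<lambda>z. G (param (tau z)) $ j)" unfolding decays_def by blast
  have "norm (param_deriv2 j (tau z)) \<le> (4 * C / r ^ 2) * edge_decay z" if z: "z \<in> quadrant" for z
  proof -
    have "deriv (deriv (\<lambda>t. param t $ j)) (tau z) = param_deriv2 j (tau z)"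
      by (rule DERIV_imp_deriv, rule has_field_derivative_transform_within_open[OF G_derivative open_leaf_domain])
         (use tau_in_leaf_domain[OF z] d1 in auto)
    then show ?thesis using est[OF z, of 2] by (simp add: numeral_2_eq_2)
  qed
  moreover have "continuous_on quadrant (\<lambda>z. param_deriv2 j (tau z))"
    unfolding param_deriv2_def by (rule continuous_on_quadrant_tau[OF holomorphic_deriv[OF G_holomorphic open_leaf_domain]])
  ultimately show "decays (\<lambda>z. param_deriv2 j (tau z))" unfolding decays_def by blast
qed

lemma bounded_test_on_leaf:
  assumes "test_on U f" shows "bounded_on_quadrant (\<lambda>z. f (param (tau z)))"
proof -
  obtain M where "\<And>z. norm (f z) \<le> M" using test_on_imp_bounded[OF assms] by blast
  moreover have "continuous_on quadrant (\<lambda>z. f (param (tau z)))"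
    by (rule continuous_on_compose2[OF test_on_imp_continuous[OF assms, of UNIV] continuous_on_param_tau]) simp
  ultimately show ?thesis unfolding bounded_on_quadrant_def by blast
qed

text \<open>Compact subsets of the image of the open bidisc keep away from the edges of the quadrant. They may contain the
  singular point, which the leaf approaches at infinity, so nothing can be said about large \<open>z\<close>.\<close>

lemma leaf_leaves_compact:
  assumes "compact L" "L \<subseteq> K ` polydisc 1"
  obtains c where "0 < c" "\<And>z. z \<in> quadrant \<Longrightarrow> fst z < c \<or> snd z < c \<Longrightarrow> param (tau z) \<notin> L"
proof -
  have sub: "polydisc 1 \<subseteq> polydisc 2" by (auto simp: polydisc_def)
  have K: "continuous_on (polydisc 1) K" "inj_on K (polydisc 1)"
    using holomorphic_map_on_imp_continuous_on[OF holomorphic_map_on_subset[OF K_holomorphic sub]]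
      inj_on_subset[OF K_inj sub] by auto
  have "continuous_on (K ` polydisc 1) (inv_into (polydisc 1) K)"
    by (rule continuous_on_inverse_open[OF open_polydisc K(1) order_refl inv_into_f_f[OF K(2)]])
  then have comp: "compact (inv_into (polydisc 1) K ` L)"
    using assms by (meson compact_continuous_image continuous_on_subset)
  have ct: "continuous_on (inv_into (polydisc 1) K ` L) (\<lambda>w::C2. max (norm (w $ 1)) (norm (w $ 2)))"
    by (intro continuous_intros)
  have "\<exists>\<rho><1. 0 < \<rho> \<and> (\<forall>w\<in>inv_into (polydisc 1) K ` L. max (norm (w $ 1)) (norm (w $ 2)) \<le> \<rho>)"
  proof (cases "L = {}")
    case False
    then obtain w where w: "w \<in> inv_into (polydisc 1) K ` L"
      and wm: "\<And>y. y \<in> inv_into (polydisc 1) K ` L \<Longrightarrow> max (norm (y $ 1)) (norm (y $ 2)) \<le> max (norm (w $ 1)) (norm (w $ 2))"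
      using continuous_attains_sup[OF comp _ ct] by blast
    have "w \<in> polydisc 1" using w assms(2) by (auto intro: inv_into_into)
    then have "max (norm (w $ 1)) (norm (w $ 2)) < 1" by (auto simp: polydisc_def)
    then show ?thesis using wm
      by (intro exI[of _ "max (1/2) (max (norm (w $ 1)) (norm (w $ 2)))"]) (auto simp: le_max_iff_disj)
  qed (auto intro: exI[of _ "1/2"])
  then obtain \<rho> where \<rho>: "0 < \<rho>" "\<rho> < 1" "\<And>w. w \<in> inv_into (polydisc 1) K ` L \<Longrightarrow> max (norm (w $ 1)) (norm (w $ 2)) \<le> \<rho>"
    by blast
  show thesis
  proof
    show "0 < - ln \<rho>" using \<rho> by simp
    fix z assume z: "z \<in> quadrant" "fst z < - ln \<rho> \<or> snd z < - ln \<rho>"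
    show "param (tau z) \<notin> L"
    proof
      assume "param (tau z) \<in> L"
      then have "inv_into (polydisc 1) K (param (tau z)) \<in> inv_into (polydisc 1) K ` L" by blast
      then have "linear_leaf (tau z) \<in> inv_into (polydisc 1) K ` L"
        unfolding param_def by (simp add: inv_into_f_f[OF K(2) linear_leaf_tau_in_polydisc[OF z(1)]])
      from \<rho>(3)[OF this] have "exp (- fst z) \<le> \<rho>" "exp (- snd z) \<le> \<rho>"
        by (auto simp: norm_linear_leaf Re_tau simp del: times_complex.sel)
      then have "- fst z \<le> ln \<rho>" "- snd z \<le> ln \<rho>" using \<rho>(1) by (simp_all add: ln_ge_iff)
      then show False using z(2) by auto
    qed
  qed
qed

text \<open>The two partial derivatives in the quadrant are linear combinations of \<open>a\<close> and \<open>b\<close>, with a matrix that is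
  invertible because \<open>e_x\<close> and \<open>e_y\<close> are independent over the reals.\<close>

lemma integral_Wirtinger_eq_0:
  assumes W: "\<And>z. z \<in> quadrant \<Longrightarrow> Wirtinger F (a z) (b z) (tau z)"
    and z: "\<And>z. z \<in> quadrant \<Longrightarrow> fst z < c \<or> snd z < c \<Longrightarrow> F (tau z) = 0" and c: "0 < c"
    and lim: "\<And>z. z \<in> quadrant \<Longrightarrow> norm (F (tau z)) \<le> B / (1 + fst z + snd z)"
    and a: "set_integrable lborel quadrant a" and b: "set_integrable lborel quadrant b"
  shows "(LINT z:quadrant|lborel. a z) = 0" "(LINT z:quadrant|lborel. b z) = 0"
proof -
  have i: "set_integrable lborel quadrant (\<lambda>z. a z * e + b z * cnj e)" for e
    by (intro set_integral_add set_integrable_mult_left a b)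
  have lim0: "((\<lambda>x. B / (1 + x + y)) \<longlongrightarrow> 0) at_top" for y :: real
  proof -
    have "filterlim (\<lambda>x. (1 + y) + x) at_top at_top"
      by (rule filterlim_tendsto_add_at_top[OF tendsto_const filterlim_ident])
    from tendsto_divide_0[OF tendsto_const filterlim_at_top_imp_at_infinity[OF this], of B]
    show ?thesis by (simp add: add_ac)
  qed
  have D: "((\<lambda>x. F (tau (x, y))) has_vector_derivative (a (x, y) * e_x + b (x, y) * cnj e_x)) (at x)"
    "((\<lambda>y. F (tau (x, y))) has_vector_derivative (a (x, y) * e_y + b (x, y) * cnj e_y)) (at y)"
    if "0 < x" "0 < y" for x y
  proof -
    have F: "(F has_derivative (\<lambda>e. a (x, y) * e + b (x, y) * cnj e)) (at (tau (x, y)))"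
      using W[of "(x, y)"] that unfolding Wirtinger_def by simp
    have 1: "((\<lambda>x. tau (x, y)) has_derivative (\<lambda>s. of_real s * e_x)) (at x)"
      unfolding tau_def by (auto intro!: derivative_eq_intros)
    have 2: "((\<lambda>y. tau (x, y)) has_derivative (\<lambda>s. of_real s * e_y)) (at y)"
      unfolding tau_def by (auto intro!: derivative_eq_intros)
    show "((\<lambda>x. F (tau (x, y))) has_vector_derivative (a (x, y) * e_x + b (x, y) * cnj e_x)) (at x)"
      using has_derivative_compose[OF 1 F] unfolding has_vector_derivative_def
      by (simp add: scaleR_conv_of_real algebra_simps)
    show "((\<lambda>y. F (tau (x, y))) has_vector_derivative (a (x, y) * e_y + b (x, y) * cnj e_y)) (at y)"
      using has_derivative_compose[OF 2 F] unfolding has_vector_derivative_def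
      by (simp add: scaleR_conv_of_real algebra_simps)
  qed
  have l1: "((\<lambda>x. F (tau (x, y))) \<longlongrightarrow> 0) at_top" if "0 < y" for y
    by (rule Lim_null_comparison[OF eventually_mono[OF eventually_gt_at_top[of 0]] lim0[of y]])
       (use lim[of "(_, y)"] that in auto)
  have l2: "((\<lambda>y. F (tau (x, y))) \<longlongrightarrow> 0) at_top" if "0 < x" for x
    by (rule Lim_null_comparison[OF eventually_mono[OF eventually_gt_at_top[of 0]] lim0[of x]])
       (use lim[of "(x, _)"] that in \<open>auto simp: add_ac\<close>)
  note zero = integral_partial_derivative_eq_0[where f="\<lambda>z. F (tau z)", OF D(1) D(2) _ c l1 l2 i i]
  define I J where "I = (LINT z:quadrant|lborel. a z)" and "J = (LINT z:quadrant|lborel. b z)"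
  have split: "(LINT z:quadrant|lborel. a z * e + b z * cnj e) = I * e + J * cnj e" for e
    unfolding I_def J_def using a b by (simp add: set_integral_add set_integrable_mult_left)
  have eq1: "I * e_x + J * cnj e_x = 0" unfolding split[symmetric] by (rule zero(1)) (use z in auto)
  have eq2: "I * e_y + J * cnj e_y = 0" unfolding split[symmetric] by (rule zero(2)) (use z in auto)
  have det: "e_x * cnj e_y - cnj e_x * e_y \<noteq> 0"
  proof
    assume "e_x * cnj e_y - cnj e_x * e_y = 0"
    then have "Im (e_x * cnj e_y - cnj e_x * e_y) = 0" by simp
    then show False using e_x_y_independent by simp
  qed
  have "I * (e_x * cnj e_y - cnj e_x * e_y) = (I * e_x + J * cnj e_x) * cnj e_y - (I * e_y + J * cnj e_y) * cnj e_x"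
    by (simp add: algebra_simps)
  then show "(LINT z:quadrant|lborel. a z) = 0" using det eq1 eq2 by (simp add: I_def)
  have "J * (e_x * cnj e_y - cnj e_x * e_y) = (I * e_y + J * cnj e_y) * e_x - (I * e_x + J * cnj e_x) * e_y"
    by (simp add: algebra_simps)
  then show "(LINT z:quadrant|lborel. b z) = 0" using det eq1 eq2 by (simp add: J_def)
qed

lemma isCont_tau: "isCont tau z"
  using continuous_on_tau[of UNIV] by (metis UNIV_I continuous_on_eq_continuous_at open_UNIV)

lemma continuous_on_quadrant_compose_tau:
  fixes f :: "complex \<Rightarrow> complex"
  assumes "\<And>z. z \<in> quadrant \<Longrightarrow> isCont f (tau z)"
  shows "continuous_on quadrant (\<lambda>z. f (tau z))"
  by (intro continuous_at_imp_continuous_on ballI isCont_o2[OF isCont_tau assms])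

text \<open>The mixed Wirtinger derivative of \<open>\<phi> \<circ> param\<close>, a quarter of its Laplacian.\<close>

definition Levi :: "(C2 \<Rightarrow> complex) \<Rightarrow> real \<times> real \<Rightarrow> complex" where
  "Levi \<phi> z = (\<Sum>k\<in>UNIV. (\<Sum>j\<in>UNIV. d_z j (d_zbar k \<phi>) (param (tau z)) * G (param (tau z)) $ j) * cnj (G (param (tau z)) $ k))"

lemma decays_Levi:
  assumes "test_on U \<phi>" shows "decays (Levi \<phi>)"
  unfolding Levi_def
  by (intro decays_sum decays_mult_left decays_cnj decays_G decays_imp_bounded[OF decays_sum]
      bounded_test_on_leaf[OF test_on_d_z[OF test_on_d_zbar[OF assms]]])

lemma set_integrable_weight_mult:
  assumes "1 < p" "1 \<le> A" "continuous_on quadrant k" "decays f"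
    and k: "\<And>z. z \<in> quadrant \<Longrightarrow> norm (k z) \<le> B * weight p A z"
  shows "set_integrable lborel quadrant (\<lambda>z. k z * f z)"
proof -
  obtain N where N: "0 \<le> N" "\<And>z. z \<in> quadrant \<Longrightarrow> norm (f z) \<le> N * edge_decay z"
    using decays_bound[OF assms(4)] by blast
  show ?thesis
  proof (rule set_integrable_quadrant[OF _ integrable_weight_edge_decay(1)[OF assms(1,2)], where B="B * N"])
    show "continuous_on quadrant (\<lambda>z. k z * f z)"
      using assms(3,4) unfolding decays_def by (intro continuous_on_mult) auto
    show "norm (k z * f z) \<le> B * N * (weight p A z * edge_decay z)" if z: "z \<in> quadrant" for z
      using mult_mono[OF k[OF z] N(2)[OF z]] order.trans[OF norm_ge_zero k[OF z]]
      by (simp add: norm_mult mult_ac)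
  qed
qed

lemma set_integrable_distance_mult:
  assumes "1 < p" "1 \<le> A" "continuous_on quadrant k" "bounded_on_quadrant f"
    and k: "\<And>z. z \<in> quadrant \<Longrightarrow> norm (k z) \<le> B * (A powr (p - 1) * (A + fst z + snd z) powr (- p - 1))"
  shows "set_integrable lborel quadrant (\<lambda>z. k z * f z)"
proof -
  obtain N where N: "0 \<le> N" "\<And>z. z \<in> quadrant \<Longrightarrow> norm (f z) \<le> N"
    using bounded_on_quadrant_bound[OF assms(4)] by blast
  show ?thesis
  proof (rule set_integrable_quadrant[OF _ integrable_weight_over_distance[OF assms(1,2)], where B="B * N"])
    show "continuous_on quadrant (\<lambda>z. k z * f z)"
      using assms(3,4) unfolding bounded_on_quadrant_def by (intro continuous_on_mult) auto
    show "norm (k z * f z) \<le> B * N * (A powr (p - 1) * (A + fst z + snd z) powr (- p - 1))" if z: "z \<in> quadrant" for z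
      using mult_mono[OF k[OF z] N(2)[OF z]] order.trans[OF norm_ge_zero k[OF z]]
      by (simp add: norm_mult mult_ac)
  qed
qed

text \<open>Both \<open>q\<close> and its conjugate are harmonic, so twice integrating by parts kills the pairing with the
  Laplacian of \<open>\<phi> \<circ> param\<close>. The second integration is arranged so as not to exchange the two derivatives
  of \<open>\<phi>\<close>.\<close>

proposition integral_kernel_Levi_eq_0:
  assumes \<phi>: "test_on (K ` polydisc 1) \<phi>" and p: "1 < p" and A: "1 \<le> A"
    and q: "\<And>z. z \<in> quadrant \<Longrightarrow> (q has_field_derivative q' (tau z)) (at (tau z))"
    and q': "\<And>z. z \<in> quadrant \<Longrightarrow> (q' has_field_derivative q'' (tau z)) (at (tau z))"
    and q'': "\<And>z. z \<in> quadrant \<Longrightarrow> q'' field_differentiable (at (tau z))"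
    and b: "\<And>z. z \<in> quadrant \<Longrightarrow> norm (q (tau z)) \<le> B * weight p A z"
    and b': "\<And>z. z \<in> quadrant \<Longrightarrow> norm (q' (tau z)) \<le> B * (A powr (p - 1) * (A + fst z + snd z) powr (- p - 1))"
    and b'': "\<And>z. z \<in> quadrant \<Longrightarrow> norm (q'' (tau z)) \<le> B * (A powr (p - 1) * (A + fst z + snd z) powr (- p - 1))"
  shows "set_integrable lborel quadrant (\<lambda>z. q (tau z) * Levi \<phi> z)"
    and "(LINT z:quadrant|lborel. q (tau z) * Levi \<phi> z) = 0"
    and "(LINT z:quadrant|lborel. cnj (q (tau z)) * Levi \<phi> z) = 0"
proof -
  note cont = continuous_on_quadrant_compose_tau
  have qc: "continuous_on quadrant (\<lambda>z. q (tau z))" by (rule cont) (rule DERIV_isCont[OF q])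
  have qc': "continuous_on quadrant (\<lambda>z. q' (tau z))" by (rule cont) (rule DERIV_isCont[OF q'])
  have qc'': "continuous_on quadrant (\<lambda>z. q'' (tau z))"
    by (rule cont) (rule field_differentiable_imp_continuous_at[OF q''])
  have cqc: "continuous_on quadrant (\<lambda>z. cnj (q (tau z)))" "continuous_on quadrant (\<lambda>z. cnj (q' (tau z)))"
    by (intro continuous_on_cnj qc qc')+
  obtain B1 where B1: "0 \<le> B1" "B \<le> B1" by (metis max.cobounded1 max.cobounded2)
  have bw': "norm (q' (tau z)) \<le> B1 * weight p A z" if z: "z \<in> quadrant" for z
  proof -
    have "norm (q' (tau z)) \<le> B1 * (A powr (p - 1) * (A + fst z + snd z) powr (- p - 1))"
      using B1 by (intro order.trans[OF b'[OF z]] mult_right_mono) auto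
    also have "\<dots> \<le> B1 * weight p A z"
      by (rule mult_left_mono[OF weight_over_distance_le[OF p A z] B1(1)])
    finally show ?thesis .
  qed
  have bw: "norm (q (tau z)) \<le> B1 * weight p A z" if z: "z \<in> quadrant" for z
    using B1 by (intro order.trans[OF b[OF z]] mult_right_mono) (auto simp: weight_def)
  obtain L where L: "compact L" "L \<subseteq> K ` polydisc 1" "\<And>z. z \<notin> L \<Longrightarrow> \<phi> z = 0"
    using \<phi> unfolding test_on_def by blast
  obtain c where c: "0 < c" "\<And>z. z \<in> quadrant \<Longrightarrow> fst z < c \<or> snd z < c \<Longrightarrow> param (tau z) \<notin> L"
    using leaf_leaves_compact[OF L(1,2)] by blast
  define g where "g t = \<phi> (param t)" for t
  define w where "w t = (\<Sum>k\<in>UNIV. d_zbar k \<phi> (param t) * cnj (G (param t) $ k))" for t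
  define gz where "gz z = (\<Sum>j\<in>UNIV. d_z j \<phi> (param (tau z)) * G (param (tau z)) $ j)" for z
  define wb where "wb z = (\<Sum>k\<in>UNIV. (\<Sum>j\<in>UNIV. d_zbar j (d_zbar k \<phi>) (param (tau z)) * cnj (G (param (tau z)) $ j)) * cnj (G (param (tau z)) $ k)
      + d_zbar k \<phi> (param (tau z)) * cnj (param_deriv2 k (tau z)))" for z
  have Wg: "Wirtinger g (gz z) (w (tau z)) (tau z)" if z: "z \<in> quadrant" for z
    unfolding g_def[abs_def] gz_def w_def by (rule Wirtinger_compose[OF \<phi> param_derivative[OF tau_in_leaf_domain[OF z]]])
  have Ww: "Wirtinger w (Levi \<phi> z) (wb z) (tau z)" if z: "z \<in> quadrant" for z
  proof -
    have "Wirtinger (\<lambda>t. cnj (G (param t) $ k)) (cnj 0) (cnj (param_deriv2 k (tau z))) (tau z)" for k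
      by (rule Wirtinger_cnj[OF Wirtinger_holomorphic[OF G_derivative[OF tau_in_leaf_domain[OF z]]]])
    from Wirtinger_sum[OF Wirtinger_mult[OF Wirtinger_compose[OF test_on_d_zbar[OF \<phi>] param_derivative[OF tau_in_leaf_domain[OF z]]] this],
        where I=UNIV]
    show ?thesis by (simp add: w_def[abs_def] wb_def Levi_def)
  qed
  have Wq: "Wirtinger q (q' (tau z)) 0 (tau z)" if "z \<in> quadrant" for z
    by (rule Wirtinger_holomorphic[OF q[OF that]])
  have Wq': "Wirtinger q' (q'' (tau z)) 0 (tau z)" if "z \<in> quadrant" for z
    by (rule Wirtinger_holomorphic[OF q'[OF that]])
  have Wcq: "Wirtinger (\<lambda>t. cnj (q t)) 0 (cnj (q' (tau z))) (tau z)" if "z \<in> quadrant" for z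
    using Wirtinger_cnj[OF Wq[OF that]] by simp
  have g0: "g (tau z) = 0" and w0: "w (tau z) = 0" if z: "z \<in> quadrant" "fst z < c \<or> snd z < c" for z
  proof -
    have PL: "param (tau z) \<notin> L" by (rule c(2)[OF z])
    show "g (tau z) = 0" by (simp add: g_def L(3)[OF PL])
    show "w (tau z) = 0"
      by (simp add: w_def d_zbar_eq_nderiv nderiv_eq_0_outside[OF compact_imp_closed[OF L(1)] L(3) PL] del: nderiv.simps)
  qed
  have dw: "decays (\<lambda>z. w (tau z))"
    unfolding w_def
    by (intro decays_sum decays_mult_left decays_cnj decays_G bounded_test_on_leaf[OF test_on_d_zbar[OF \<phi>]])
  have dgz: "decays gz"
    unfolding gz_def
    by (intro decays_sum decays_mult_left decays_G bounded_test_on_leaf[OF test_on_d_z[OF \<phi>]])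
  have dwb: "decays wb"
    unfolding wb_def
    by (intro decays_sum decays_add decays_mult_left decays_cnj decays_G decays_param_deriv2 decays_imp_bounded[OF decays_sum]
        bounded_test_on_leaf[OF test_on_d_zbar[OF test_on_d_zbar[OF \<phi>]]] bounded_test_on_leaf[OF test_on_d_zbar[OF \<phi>]])
  have bg: "bounded_on_quadrant (\<lambda>z. g (tau z))"
    unfolding g_def by (rule bounded_test_on_leaf[OF \<phi>])
  note dL = decays_Levi[OF \<phi>]
  have lim: "\<exists>B'. \<forall>z\<in>quadrant. norm (k z * f z) \<le> B' / (1 + fst z + snd z)"
    if k: "\<And>z. z \<in> quadrant \<Longrightarrow> norm (k z) \<le> B1 * weight p A z" and f: "bounded_on_quadrant f" for k f
  proof -
    obtain N where N: "0 \<le> N" "\<And>z. z \<in> quadrant \<Longrightarrow> norm (f z) \<le> N"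
      using bounded_on_quadrant_bound[OF f] by blast
    have "norm (k z * f z) \<le> (B1 * A powr (p - 1) * N) / (1 + fst z + snd z)" if z: "z \<in> quadrant" for z
    proof -
      have "norm (k z) \<le> B1 * (A powr (p - 1) / (1 + fst z + snd z))"
        using B1 weight_le(1)[OF p A z] by (intro order.trans[OF k[OF z]] mult_left_mono) auto
      from mult_mono[OF this N(2)[OF z] order.trans[OF norm_ge_zero this] norm_ge_zero]
      show ?thesis by (simp add: norm_mult mult_ac)
    qed
    then show ?thesis by blast
  qed
  obtain l1 where l1: "\<And>z. z \<in> quadrant \<Longrightarrow> norm (q (tau z) * w (tau z)) \<le> l1 / (1 + fst z + snd z)"
    using lim[of "\<lambda>z. q (tau z)", OF bw decays_imp_bounded[OF dw]] by blast
  have ncq: "norm (cnj (q (tau z))) \<le> B1 * weight p A z" "norm (cnj (q' (tau z))) \<le> B1 * weight p A z"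
    if "z \<in> quadrant" for z using bw[OF that] bw'[OF that] by auto
  obtain l2 where l2: "\<And>z. z \<in> quadrant \<Longrightarrow> norm (cnj (q (tau z)) * w (tau z)) \<le> l2 / (1 + fst z + snd z)"
    using lim[of "\<lambda>z. cnj (q (tau z))", OF ncq(1) decays_imp_bounded[OF dw]] by blast
  obtain l3 where l3: "\<And>z. z \<in> quadrant \<Longrightarrow> norm (q' (tau z) * g (tau z)) \<le> l3 / (1 + fst z + snd z)"
    using lim[of "\<lambda>z. q' (tau z)", OF bw' bg] by blast
  note iw = set_integrable_weight_mult[OF p A]
  show iqL: "set_integrable lborel quadrant (\<lambda>z. q (tau z) * Levi \<phi> z)" by (rule iw[OF qc dL bw])
  have iq'w: "set_integrable lborel quadrant (\<lambda>z. q' (tau z) * w (tau z))" by (rule iw[OF qc' dw bw'])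
  have "(LINT z:quadrant|lborel. q' (tau z) * w (tau z) + q (tau z) * Levi \<phi> z) = 0"
  proof (rule integral_Wirtinger_eq_0(1)[where F="\<lambda>t. q t * w t" and b="\<lambda>z. q (tau z) * wb z", OF _ _ c(1) l1])
    show "Wirtinger (\<lambda>t. q t * w t) (q' (tau z) * w (tau z) + q (tau z) * Levi \<phi> z) (q (tau z) * wb z) (tau z)"
      if "z \<in> quadrant" for z using Wirtinger_mult[OF Wq[OF that] Ww[OF that]] by simp
    show "set_integrable lborel quadrant (\<lambda>z. q' (tau z) * w (tau z) + q (tau z) * Levi \<phi> z)"
      by (rule set_integral_add(1)[OF iq'w iqL])
    show "set_integrable lborel quadrant (\<lambda>z. q (tau z) * wb z)" by (rule iw[OF qc dwb bw])
  qed (use w0 in auto)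
  moreover have "(LINT z:quadrant|lborel. q' (tau z) * w (tau z)) = 0"
  proof (rule integral_Wirtinger_eq_0(2)[where F="\<lambda>t. q' t * g t"
        and a="\<lambda>z. q'' (tau z) * g (tau z) + q' (tau z) * gz z", OF _ _ c(1) l3])
    show "Wirtinger (\<lambda>t. q' t * g t) (q'' (tau z) * g (tau z) + q' (tau z) * gz z) (q' (tau z) * w (tau z)) (tau z)"
      if "z \<in> quadrant" for z using Wirtinger_mult[OF Wq'[OF that] Wg[OF that]] by simp
    show "set_integrable lborel quadrant (\<lambda>z. q'' (tau z) * g (tau z) + q' (tau z) * gz z)"
      by (rule set_integral_add(1)[OF set_integrable_distance_mult[OF p A qc'' bg b''] iw[OF qc' dgz bw']])
  qed (use g0 iq'w in auto)
  ultimately show "(LINT z:quadrant|lborel. q (tau z) * Levi \<phi> z) = 0"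
    using set_integral_add(2)[OF iq'w iqL] by simp
  show "(LINT z:quadrant|lborel. cnj (q (tau z)) * Levi \<phi> z) = 0"
  proof (rule integral_Wirtinger_eq_0(1)[where F="\<lambda>t. cnj (q t) * w t"
        and b="\<lambda>z. cnj (q' (tau z)) * w (tau z) + cnj (q (tau z)) * wb z", OF _ _ c(1) l2])
    show "Wirtinger (\<lambda>t. cnj (q t) * w t) (cnj (q (tau z)) * Levi \<phi> z)
        (cnj (q' (tau z)) * w (tau z) + cnj (q (tau z)) * wb z) (tau z)"
      if "z \<in> quadrant" for z using Wirtinger_mult[OF Wcq[OF that] Ww[OF that]] by simp
    show "set_integrable lborel quadrant (\<lambda>z. cnj (q (tau z)) * Levi \<phi> z)" by (rule iw[OF cqc(1) dL ncq(1)])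
    show "set_integrable lborel quadrant (\<lambda>z. cnj (q' (tau z)) * w (tau z) + cnj (q (tau z)) * wb z)"
      by (rule set_integral_add(1)[OF iw[OF cqc(2) dw ncq(2)] iw[OF cqc(1) dwb ncq(1)]])
  qed (use w0 in auto)
qed

text \<open>The series over \<open>n\<close> superposes kernels with vertices at distances \<open>A n\<close>. Its weights \<open>1 / 2 ^ n\<close> make the mass
  finite, however fast \<open>A n\<close> grows.\<close>

proposition harmonic_density:
  obtains p c where "1 < p" "0 < c"
    "\<forall>A. (\<forall>n::nat. 1 \<le> A n) \<longrightarrow>
      (\<exists>h. (\<forall>z. 0 \<le> h z) \<and> (\<forall>z. z \<notin> quadrant \<longrightarrow> h z = 0) \<and> h \<in> borel_measurable borel \<and>
        integrable lborel (\<lambda>z. h z * edge_decay z) \<and>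
        (\<forall>\<phi>. test_on (K ` polydisc 1) \<phi> \<longrightarrow> (\<integral>z. of_real (h z) * Levi \<phi> z \<partial>lborel) = 0) \<and>
        (\<forall>n. \<forall>z\<in>quadrant. c / 2 ^ n * weight p (A n) z \<le> h z))"
proof -
  obtain p c B and q q' q'' :: "real \<Rightarrow> complex \<Rightarrow> complex" where p: "1 < p" and c: "0 < c" and B: "0 < B"
    and ker0: "\<And>A x y t. 1 \<le> A \<Longrightarrow> 0 \<le> x \<Longrightarrow> 0 \<le> y \<Longrightarrow> t = of_real x * e_x + of_real y * e_y \<Longrightarrow>
      (q A has_field_derivative q' A t) (at t) \<and> (q' A has_field_derivative q'' A t) (at t) \<and>
      q'' A field_differentiable (at t) \<and>
      c * weight p A (x, y) \<le> Re (q A t) \<and> norm (q A t) \<le> B * weight p A (x, y) \<and>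
      norm (q' A t) \<le> B * (A powr (p - 1) * (A + x + y) powr (- p - 1)) \<and>
      norm (q'' A t) \<le> B * (A powr (p - 1) * (A + x + y) powr (- p - 1))"
    using positive_kernel[OF e_x_y_independent] by blast
  show thesis
  proof (rule that[OF p c], intro allI impI)
    fix A :: "nat \<Rightarrow> real"
    assume "\<forall>n. 1 \<le> A n"
    then have A: "\<And>n. 1 \<le> A n" by blast
    have ker: "(q (A n) has_field_derivative q' (A n) (tau z)) (at (tau z))"
      "(q' (A n) has_field_derivative q'' (A n) (tau z)) (at (tau z))"
      "q'' (A n) field_differentiable (at (tau z))"
      "c * weight p (A n) z \<le> Re (q (A n) (tau z))" "norm (q (A n) (tau z)) \<le> B * weight p (A n) z"
      "norm (q' (A n) (tau z)) \<le> B * (A n powr (p - 1) * (A n + fst z + snd z) powr (- p - 1))"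
      "norm (q'' (A n) (tau z)) \<le> B * (A n powr (p - 1) * (A n + fst z + snd z) powr (- p - 1))"
      if "z \<in> quadrant" for z n
      using ker0[OF A, of "fst z" "snd z" "tau z" n] that by (auto simp: tau_def)
    define hn where "hn n z = indicator quadrant z * (Re (q (A n) (tau z)) / 2 ^ n)" for n z
    define h where "h z = (\<Sum>n. hn n z)" for z
    have Wpos: "0 \<le> weight p a z" for a z by (simp add: weight_def)
    have hn_le: "hn n z \<le> B / 2 ^ n * (indicator quadrant z * weight p (A n) z)" for n z
      using order.trans[OF complex_Re_le_cmod ker(5)] by (auto simp: hn_def indicator_def divide_right_mono)
    have hn_ge: "c / 2 ^ n * weight p (A n) z \<le> hn n z" if "z \<in> quadrant" for n z
      using ker(4)[OF that] that by (simp add: hn_def divide_right_mono)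
    have hn_pos: "0 \<le> hn n z" for n z
    proof (cases "z \<in> quadrant")
      case True
      have "0 \<le> c / 2 ^ n * weight p (A n) z" using c Wpos by simp
      then show ?thesis using hn_ge[OF True] by (rule order.trans)
    qed (simp add: hn_def)
    have hn_le1: "hn n z \<le> B * (1/2) ^ n" for n z
    proof -
      have "hn n z \<le> B / 2 ^ n * 1"
        using B weight_le(2)[OF p A] by (intro order.trans[OF hn_le] mult_left_mono) (auto simp: indicator_def)
      then show ?thesis by (simp add: power_divide)
    qed
    have sm: "summable (\<lambda>n. hn n z)" for z
      by (rule summable_comparison_test'[where g="\<lambda>n. B * (1/2) ^ n"])
         (use hn_pos hn_le1 in \<open>auto intro: summable_mult\<close>)
    have qcont: "continuous_on quadrant (\<lambda>z. Re (q (A n) (tau z)) / 2 ^ n)" for n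
      by (intro continuous_intros continuous_on_quadrant_compose_tau DERIV_isCont[OF ker(1)]) auto
    have hn_meas: "hn n \<in> borel_measurable borel" for n
      using borel_measurable_continuous_on_indicator[OF quadrant_measurable qcont[of n]]
      by (simp add: hn_def[abs_def])
    have h_meas: "h \<in> borel_measurable borel"
      unfolding h_def[abs_def] by (intro borel_measurable_suminf hn_meas)
    have h_ge: "hn n z \<le> h z" for n z
      unfolding h_def using sum_le_suminf[OF sm[of z], of "{n}"] hn_pos by simp
    have h_pos: "0 \<le> h z" for z unfolding h_def by (rule suminf_nonneg[OF sm hn_pos])
    have h_off: "h z = 0" if "z \<notin> quadrant" for z using that by (simp add: h_def hn_def)
    \<comment> \<open>Each kernel has the same mass bound, so the series may be integrated termwise.\<close>
    have termwise: "integrable lborel (\<lambda>z. of_real (hn n z) * f z)"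
      "(\<integral>z. norm (of_real (hn n z) * f z) \<partial>lborel) \<le> B * N * (2 / (p - 1)) * (1/2) ^ n"
      if f: "f \<in> borel_measurable borel" and N: "\<And>z. z \<in> quadrant \<Longrightarrow> norm (f z) \<le> N * edge_decay z" and N0: "0 \<le> N"
      for f :: "real \<times> real \<Rightarrow> complex" and N n
    proof -
      let ?b = "\<lambda>z. (B * N / 2 ^ n) * (indicator quadrant z * (weight p (A n) z * edge_decay z))"
      have ib: "integrable lborel ?b"
        using integrable_weight_edge_decay(1)[OF p A, of n] by (simp add: set_integrable_def)
      have le: "norm (of_real (hn n z) * f z) \<le> ?b z" for z
      proof (cases "z \<in> quadrant")
        case True
        have "norm (of_real (hn n z) * f z) = hn n z * norm (f z)" using hn_pos by (simp add: norm_mult)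
        also have "\<dots> \<le> (B / 2 ^ n * weight p (A n) z) * (N * edge_decay z)"
          using hn_le[of n z] True N[OF True] hn_pos B Wpos by (intro mult_mono) auto
        finally show ?thesis using True by (simp add: mult_ac)
      qed (simp add: hn_def)
      have m: "(\<lambda>z. complex_of_real (hn n z) * f z) \<in> borel_measurable lborel"
        unfolding measurable_lborel2 
        by (intro borel_measurable_times f measurable_compose[OF hn_meas]
            borel_measurable_continuous_onI continuous_intros)
      show i: "integrable lborel (\<lambda>z. of_real (hn n z) * f z)"
        by (rule Bochner_Integration.integrable_bound[OF ib m], rule AE_I2)
           (simp only: real_norm_def order.trans[OF le abs_ge_self])
      have "(\<integral>z. norm (of_real (hn n z) * f z) \<partial>lborel) \<le> (\<integral>z. ?b z \<partial>lborel)"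
        by (rule integral_mono[OF integrable_norm[OF i] ib le])
      also have "\<dots> = (B * N / 2 ^ n) * (LINT z:quadrant|lborel. weight p (A n) z * edge_decay z)"
        by (simp add: set_lebesgue_integral_def)
      also have "\<dots> \<le> (B * N / 2 ^ n) * (2 / (p - 1))"
        using B N0 by (intro mult_left_mono integrable_weight_edge_decay(2)[OF p A]) auto
      finally show "(\<integral>z. norm (of_real (hn n z) * f z) \<partial>lborel) \<le> B * N * (2 / (p - 1)) * (1/2) ^ n"
        by (simp add: power_divide mult_ac)
    qed
    have series: "integrable lborel (\<lambda>z. of_real (h z) * f z)"
      "(\<integral>z. of_real (h z) * f z \<partial>lborel) = (\<Sum>n. \<integral>z. of_real (hn n z) * f z \<partial>lborel)"
      if f: "f \<in> borel_measurable borel" and N: "\<And>z. z \<in> quadrant \<Longrightarrow> norm (f z) \<le> N * edge_decay z" and N0: "0 \<le> N"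
      for f :: "real \<times> real \<Rightarrow> complex" and N
    proof -
      have s1: "summable (\<lambda>n. norm (of_real (hn n z) * f z))" for z
        using summable_mult2[OF sm[of z], of "norm (f z)"] hn_pos by (simp add: norm_mult)
      have s2: "summable (\<lambda>n. \<integral>z. norm (of_real (hn n z) * f z) \<partial>lborel)"
        by (rule summable_comparison_test'[where g="\<lambda>n. B * N * (2 / (p - 1)) * (1/2) ^ n"])
           (use termwise(2)[OF f N N0] in \<open>auto intro!: summable_mult simp del: norm_mult\<close>)
      have eq: "(\<Sum>n. of_real (hn n z) * f z) = of_real (h z) * f z" for z
        unfolding h_def using suminf_mult2[OF summable_of_real[OF sm[of z], where 'a=complex], of "f z"] suminf_of_real[OF sm[of z], where 'a=complex]
        by simp
      show "integrable lborel (\<lambda>z. of_real (h z) * f z)"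
        using integrable_suminf[OF termwise(1)[OF f N N0] AE_I2[OF s1] s2] by (simp add: eq)
      show "(\<integral>z. of_real (h z) * f z \<partial>lborel) = (\<Sum>n. \<integral>z. of_real (hn n z) * f z \<partial>lborel)"
        using integral_suminf[OF termwise(1)[OF f N N0] AE_I2[OF s1] s2] by (simp add: eq)
    qed
    have h_int: "integrable lborel (\<lambda>z. h z * edge_decay z)"
    proof -
      have m: "(\<lambda>z. complex_of_real (edge_decay z)) \<in> borel_measurable borel"
        unfolding edge_decay_def by (intro borel_measurable_continuous_onI continuous_intros)
      have "integrable lborel (\<lambda>z. complex_of_real (h z) * of_real (edge_decay z))"
        by (rule series(1)[OF m, of 1]) (use edge_decay_pos in \<open>auto simp: less_imp_le\<close>)
      then have "integrable lborel (\<lambda>z. Re (complex_of_real (h z) * of_real (edge_decay z)))" by (rule integrable_Re)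
      then show ?thesis by simp
    qed
    have closed: "(\<integral>z. of_real (h z) * Levi \<phi> z \<partial>lborel) = 0" if \<phi>: "test_on (K ` polydisc 1) \<phi>" for \<phi>
    proof -
      define f where "f z = indicator quadrant z *\<^sub>R Levi \<phi> z" for z
      note dL = decays_Levi[OF \<phi>]
      have m: "f \<in> borel_measurable borel"
        unfolding f_def[abs_def]
        by (rule borel_measurable_continuous_on_indicator[OF quadrant_measurable])
           (use dL in \<open>simp add: decays_def\<close>)
      obtain N where N: "0 \<le> N" "\<And>z. z \<in> quadrant \<Longrightarrow> norm (Levi \<phi> z) \<le> N * edge_decay z"
        using decays_bound[OF dL] by blast
      have Nf: "\<And>z. z \<in> quadrant \<Longrightarrow> norm (f z) \<le> N * edge_decay z" using N by (simp add: f_def)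
      have zero: "(\<integral>z. of_real (hn n z) * f z \<partial>lborel) = 0" for n
      proof -
        note iz = integral_kernel_Levi_eq_0[OF \<phi> p A[of n] ker(1,2,3,5,6,7)]
        have i2: "set_integrable lborel quadrant (\<lambda>z. cnj (q (A n) (tau z)) * Levi \<phi> z)"
        proof (rule set_integrable_weight_mult[OF p A _ dL])
          show "continuous_on quadrant (\<lambda>z. cnj (q (A n) (tau z)))"
            by (intro continuous_on_cnj continuous_on_quadrant_compose_tau DERIV_isCont[OF ker(1)])
          show "norm (cnj (q (A n) (tau z))) \<le> B * weight p (A n) z" if "z \<in> quadrant" for z
            using ker(5)[OF that] by simp
        qed
        have "(\<integral>z. of_real (hn n z) * f z \<partial>lborel)
            = (LINT z:quadrant|lborel. (1 / 2 / 2 ^ n) * (q (A n) (tau z) * Levi \<phi> z + cnj (q (A n) (tau z)) * Levi \<phi> z))"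
          unfolding set_lebesgue_integral_def
        proof (rule Bochner_Integration.integral_cong[OF refl])
          fix z
          have "complex_of_real (Re (q (A n) (tau z))) = (q (A n) (tau z) + cnj (q (A n) (tau z))) / 2"
            by (simp add: complex_add_cnj)
          then show "of_real (hn n z) * f z = indicator quadrant z *\<^sub>R
              ((1 / 2 / 2 ^ n) * (q (A n) (tau z) * Levi \<phi> z + cnj (q (A n) (tau z)) * Levi \<phi> z))"
            by (simp only: hn_def f_def of_real_mult of_real_divide) (simp add: indicator_def field_simps)
        qed
        also have "\<dots> = (1 / 2 / 2 ^ n) * (LINT z:quadrant|lborel. q (A n) (tau z) * Levi \<phi> z + cnj (q (A n) (tau z)) * Levi \<phi> z)"
          by (rule set_integral_mult_right)
        also have "\<dots> = 0" using set_integral_add(2)[OF iz(1) i2] iz(2,3) by simp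
        finally show ?thesis .
      qed
      have "(\<integral>z. of_real (h z) * Levi \<phi> z \<partial>lborel) = (\<integral>z. of_real (h z) * f z \<partial>lborel)"
        by (rule Bochner_Integration.integral_cong) (auto simp: f_def h_off indicator_def)
      also have "\<dots> = (\<Sum>n. \<integral>z. of_real (hn n z) * f z \<partial>lborel)" by (rule series(2)[OF m Nf N(1)])
      also have "\<dots> = 0" by (simp add: zero)
      finally show ?thesis .
    qed
    show "\<exists>h. (\<forall>z. 0 \<le> h z) \<and> (\<forall>z. z \<notin> quadrant \<longrightarrow> h z = 0) \<and> h \<in> borel_measurable borel \<and>
        integrable lborel (\<lambda>z. h z * edge_decay z) \<and>
        (\<forall>\<phi>. test_on (K ` polydisc 1) \<phi> \<longrightarrow> (\<integral>z. of_real (h z) * Levi \<phi> z \<partial>lborel) = 0) \<and>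
        (\<forall>n. \<forall>z\<in>quadrant. c / 2 ^ n * weight p (A n) z \<le> h z)"
      using h_pos h_off h_meas h_int closed order.trans[OF hn_ge h_ge] by blast
  qed
qed

end

section \<open>The current of integration over a leaf\<close>

locale leaf_density = leaf +
  fixes h :: "real \<times> real \<Rightarrow> real"
  assumes h_nonneg: "0 \<le> h z" and h_off: "z \<notin> quadrant \<Longrightarrow> h z = 0"
    and h_measurable: "h \<in> borel_measurable borel"
    and h_integrable: "integrable lborel (\<lambda>z. h z * edge_decay z)"
begin

abbreviation U :: "C2 set" where "U \<equiv> K ` polydisc 1"

text \<open>The coefficient of the restriction of a (1,1)-form to the leaf. The factor \<open>- \<i>\<close> in \<open>T\<close> makes the forms
  \<open>\<i> \<alpha> \<and> cnj \<alpha>\<close> contribute nonnegatively.\<close>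

definition pairing :: "form11 \<Rightarrow> real \<times> real \<Rightarrow> complex" where
  "pairing A z = (\<Sum>k\<in>UNIV. (\<Sum>j\<in>UNIV. A (param (tau z)) $ j $ k * G (param (tau z)) $ j) * cnj (G (param (tau z)) $ k))"

definition T :: "form11 \<Rightarrow> complex" where
  "T A = - \<i> * (\<integral>z. of_real (h z) * pairing A z \<partial>lborel)"

definition mass_density :: "real \<times> real \<Rightarrow> real" where
  "mass_density z = h z * (norm (G (param (tau z))))\<^sup>2 / pi"

definition \<mu> :: "C2 measure" where
  "\<mu> = distr (density (restrict_space lborel quadrant) (\<lambda>z. ennreal (mass_density z)))
         (restrict_space borel U) (\<lambda>z. param (tau z))"

lemma norm_G_bound: obtains N where "0 \<le> N" "\<And>z. z \<in> quadrant \<Longrightarrow> (\<Sum>j\<in>UNIV. norm (G (param (tau z)) $ j))\<^sup>2 \<le> N * edge_decay z"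
proof -
  obtain N1 where N1: "0 \<le> N1" "\<And>z. z \<in> quadrant \<Longrightarrow> norm (G (param (tau z)) $ 1) \<le> N1 * edge_decay z"
    using decays_bound[OF decays_G[of 1]] by blast
  obtain N2 where N2: "0 \<le> N2" "\<And>z. z \<in> quadrant \<Longrightarrow> norm (G (param (tau z)) $ 2) \<le> N2 * edge_decay z"
    using decays_bound[OF decays_G[of 2]] by blast
  have "(\<Sum>j\<in>UNIV. norm (G (param (tau z)) $ j))\<^sup>2 \<le> (2 * (N1 + N2)\<^sup>2) * edge_decay z" if z: "z \<in> quadrant" for z
  proof -
    have "(\<Sum>j\<in>UNIV. norm (G (param (tau z)) $ j)) \<le> (N1 + N2) * edge_decay z"
      using add_mono[OF N1(2)[OF z] N2(2)[OF z]] by (simp add: UNIV_2 distrib_right)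
    then have "(\<Sum>j\<in>UNIV. norm (G (param (tau z)) $ j))\<^sup>2 \<le> ((N1 + N2) * edge_decay z)\<^sup>2"
      by (rule power_mono) (simp add: sum_nonneg)
    also have "\<dots> = (N1 + N2)\<^sup>2 * (edge_decay z * edge_decay z)" by (simp add: power2_eq_square mult_ac)
    also have "\<dots> \<le> (N1 + N2)\<^sup>2 * (2 * edge_decay z)"
      using edge_decay_le[OF z] edge_decay_pos[of z] by (intro mult_left_mono mult_right_mono) auto
    finally show ?thesis by simp
  qed
  then show thesis using that[of "2 * (N1 + N2)\<^sup>2"] by simp
qed

lemma norm_pairing_le:
  assumes "\<And>x. norm (A x) \<le> M"
  shows "norm (pairing A z) \<le> M * (\<Sum>j\<in>UNIV. norm (G (param (tau z)) $ j))\<^sup>2"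
proof -
  let ?g = "\<lambda>j. norm (G (param (tau z)) $ j)"
  have a: "norm (A (param (tau z)) $ j $ k) \<le> M" for j k
    using order.trans[OF Finite_Cartesian_Product.norm_nth_le[of "A (param (tau z)) $ j" k]
        order.trans[OF Finite_Cartesian_Product.norm_nth_le assms]] .
  have "norm (pairing A z) \<le> (\<Sum>k\<in>UNIV. (\<Sum>j\<in>UNIV. M * ?g j) * ?g k)"
    unfolding pairing_def norm_mult[symmetric]
  proof (intro order.trans[OF norm_sum] sum_mono)
    fix k
    have "norm (\<Sum>j\<in>UNIV. A (param (tau z)) $ j $ k * G (param (tau z)) $ j) \<le> (\<Sum>j\<in>UNIV. M * ?g j)"
      by (intro order.trans[OF norm_sum] sum_mono) (simp add: norm_mult mult_right_mono[OF a])
    from mult_right_mono[OF this norm_ge_zero[of "G (param (tau z)) $ k"]]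
    show "norm ((\<Sum>j\<in>UNIV. A (param (tau z)) $ j $ k * G (param (tau z)) $ j) * cnj (G (param (tau z)) $ k))
        \<le> (\<Sum>j\<in>UNIV. M * ?g j) * ?g k"
      by (simp add: norm_mult)
  qed
  also have "\<dots> = M * (\<Sum>j\<in>UNIV. ?g j)\<^sup>2"
    by (simp add: sum_distrib_left[symmetric] power2_eq_square mult.assoc)
  finally show ?thesis .
qed

lemma continuous_on_pairing:
  assumes "continuous_on UNIV A" shows "continuous_on quadrant (pairing A)"
proof -
  have "continuous_on quadrant (\<lambda>z. A (param (tau z)))"
    by (rule continuous_on_compose2[OF assms continuous_on_param_tau]) simp
  then have cA: "continuous_on quadrant (\<lambda>z. A (param (tau z)) $ j $ k)" for j k
    by (intro continuous_on_component)
  have cG: "continuous_on quadrant (\<lambda>z. G (param (tau z)) $ j)" for j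
    using decays_G[of j] by (simp add: decays_def)
  show ?thesis
    unfolding pairing_def[abs_def]
    by (intro continuous_on_sum continuous_on_mult continuous_on_cnj cA cG)
qed

lemma borel_measurable_mult_h:
  fixes f :: "real \<times> real \<Rightarrow> complex"
  assumes "continuous_on quadrant f" shows "(\<lambda>z. of_real (h z) * f z) \<in> borel_measurable borel"
proof -
  have "(\<lambda>z. of_real (h z) * (indicator quadrant z *\<^sub>R f z)) \<in> borel_measurable borel"
    by (intro borel_measurable_times borel_measurable_continuous_on_indicator[OF quadrant_measurable assms]
        measurable_compose[OF h_measurable] borel_measurable_continuous_onI continuous_intros)
  moreover have "(\<lambda>z. of_real (h z) * (indicator quadrant z *\<^sub>R f z)) = (\<lambda>z. of_real (h z) * f z)"
    using h_off by (auto simp: fun_eq_iff indicator_def simp del: quadrant_iff split_paired_All)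
  ultimately show ?thesis by simp
qed

text \<open>The current has order \<open>0\<close>: it is bounded by the supremum of the coefficients, and one constant serves for all
  compact sets because the total mass is finite.\<close>

lemma pairing_estimate:
  obtains C0 where "\<And>A M. continuous_on UNIV A \<Longrightarrow> (\<And>x. norm (A x) \<le> M) \<Longrightarrow>
      integrable lborel (\<lambda>z. of_real (h z) * pairing A z) \<and> norm (T A) \<le> C0 * M"
proof -
  obtain N where N: "0 \<le> N" "\<And>z. z \<in> quadrant \<Longrightarrow> (\<Sum>j\<in>UNIV. norm (G (param (tau z)) $ j))\<^sup>2 \<le> N * edge_decay z"
    using norm_G_bound by blast
  show thesis
  proof (rule that, intro conjI)
    fix A :: form11 and M :: real assume A: "continuous_on UNIV A" and M: "\<And>x. norm (A x) \<le> M"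
    have M0: "0 \<le> M" using order.trans[OF norm_ge_zero M] .
    have le: "norm (of_real (h z) * pairing A z) \<le> (M * N) * (h z * edge_decay z)" for z
    proof (cases "z \<in> quadrant")
      case True
      have "norm (pairing A z) \<le> M * (N * edge_decay z)"
        by (rule order.trans[OF norm_pairing_le[OF M] mult_left_mono[OF N(2)[OF True] M0]])
      from mult_left_mono[OF this h_nonneg[of z]] show ?thesis
        using h_nonneg[of z] by (simp add: norm_mult mult_ac)
    qed (simp add: h_off)
    have ib: "integrable lborel (\<lambda>z. (M * N) * (h z * edge_decay z))" using h_integrable by simp
    show i: "integrable lborel (\<lambda>z. of_real (h z) * pairing A z)"
    proof (rule Bochner_Integration.integrable_bound[OF ib])
      show "(\<lambda>z. of_real (h z) * pairing A z) \<in> borel_measurable lborel"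
        unfolding measurable_lborel2 by (rule borel_measurable_mult_h[OF continuous_on_pairing[OF A]])
      show "AE z in lborel. norm (of_real (h z) * pairing A z) \<le> norm ((M * N) * (h z * edge_decay z))"
        by (rule AE_I2) (simp only: real_norm_def order.trans[OF le abs_ge_self])
    qed
    have "norm (T A) = norm (\<integral>z. of_real (h z) * pairing A z \<partial>lborel)" by (simp add: T_def norm_mult)
    also have "\<dots> \<le> (\<integral>z. (M * N) * (h z * edge_decay z) \<partial>lborel)"
      by (rule norm_integral_le[OF i ib le])
    finally show "norm (T A) \<le> (N * (\<integral>z. h z * edge_decay z \<partial>lborel)) * M" by (simp add: mult_ac)
  qed
qed

lemma current_T: "current U T"
proof -
  obtain C0 where C0: "\<And>A M. continuous_on UNIV A \<Longrightarrow> (\<And>x. norm (A x) \<le> M) \<Longrightarrow>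
      integrable lborel (\<lambda>z. of_real (h z) * pairing A z) \<and> norm (T A) \<le> C0 * M"
    using pairing_estimate by blast
  have int: "integrable lborel (\<lambda>z. of_real (h z) * pairing A z)" if A: "test_on U A" for A
  proof -
    obtain M where "\<And>x. norm (A x) \<le> M" using test_on_imp_bounded[OF A] by blast
    then show ?thesis using C0[OF test_on_imp_continuous[OF A]] by blast
  qed
  show ?thesis
    unfolding current_def
  proof (intro conjI allI impI)
    fix A B :: form11 assume A: "test_on U A" and B: "test_on U B"
    have "pairing (\<lambda>z. A z + B z) z = pairing A z + pairing B z" for z
      by (simp add: pairing_def algebra_simps sum.distrib)
    then show "T (\<lambda>z. A z + B z) = T A + T B"
      using int[OF A] int[OF B] by (simp add: T_def algebra_simps)
  next
    fix c and A :: form11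
    have "pairing (form_scale (\<lambda>_. c) A) z = c * pairing A z" for z
      by (simp add: pairing_def form_scale_def sum_distrib_left mult_ac)
    then have "T (form_scale (\<lambda>_. c) A) = - \<i> * (\<integral>z. c * (of_real (h z) * pairing A z) \<partial>lborel)"
      by (simp add: T_def mult_ac)
    then show "T (form_scale (\<lambda>_. c) A) = c * T A" by (simp add: T_def)
  next
    fix L :: "C2 set"
    show "\<exists>C N. \<forall>A M. test_on U A \<longrightarrow> (\<forall>z. z \<notin> L \<longrightarrow> A z = 0) \<longrightarrow>
        (\<forall>vs z. set vs \<subseteq> Basis \<longrightarrow> length vs \<le> N \<longrightarrow> norm (nderiv vs A z) \<le> M) \<longrightarrow> norm (T A) \<le> C * M"
    proof (intro exI[of _ C0] exI[of _ 0] allI impI)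
      fix A :: form11 and M assume A: "test_on U A"
        and M: "\<forall>vs z. set vs \<subseteq> Basis \<longrightarrow> length vs \<le> 0 \<longrightarrow> norm (nderiv vs A z) \<le> M"
      have "norm (A z) \<le> M" for z using M[rule_format, of "[]" z] by simp
      then show "norm (T A) \<le> C0 * M" using C0[OF test_on_imp_continuous[OF A]] by blast
    qed
  qed
qed

lemma positive_T: "positive_current U T"
  unfolding positive_current_def
proof (intro conjI current_T allI impI)
  fix f :: "C2 \<Rightarrow> real" and \<alpha> :: form1 assume f: "\<forall>z. 0 \<le> f z"
  define S where "S z = (\<Sum>j\<in>UNIV. \<alpha> (param (tau z)) $ j * G (param (tau z)) $ j)" for z
  have "pairing (form_scale (\<lambda>z. \<i> * of_real (f z)) (wedge_10_01 \<alpha> (form_cnj \<alpha>))) z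
      = \<i> * of_real (f (param (tau z)) * (norm (S z))\<^sup>2)" for z
  proof -
    have "pairing (form_scale (\<lambda>z. \<i> * of_real (f z)) (wedge_10_01 \<alpha> (form_cnj \<alpha>))) z
        = \<i> * of_real (f (param (tau z))) * (S z * cnj (S z))"
      by (simp add: pairing_def form_scale_def wedge_10_01_def form_cnj_def S_def UNIV_2 algebra_simps)
    then show ?thesis by (simp add: complex_norm_square[symmetric] mult.assoc)
  qed
  then have "T (form_scale (\<lambda>z. \<i> * of_real (f z)) (wedge_10_01 \<alpha> (form_cnj \<alpha>)))
      = - \<i> * (\<integral>z. \<i> * of_real (h z * (f (param (tau z)) * (norm (S z))\<^sup>2)) \<partial>lborel)"
    by (simp add: T_def mult_ac)
  also have "\<dots> = (\<integral>z. complex_of_real (h z * (f (param (tau z)) * (norm (S z))\<^sup>2)) \<partial>lborel)"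
    unfolding integral_mult_right_zero mult.assoc[symmetric] by simp
  also have "\<dots> = of_real (\<integral>z. h z * (f (param (tau z)) * (norm (S z))\<^sup>2) \<partial>lborel)"
    by (rule integral_complex_of_real)
  finally show "T (form_scale (\<lambda>z. \<i> * of_real (f z)) (wedge_10_01 \<alpha> (form_cnj \<alpha>))) \<in> \<real>\<^sub>\<ge>\<^sub>0"
    using f h_nonneg by (simp add: Bochner_Integration.integral_nonneg)
qed

lemma ddc_closed_T:
  assumes "\<And>\<phi>. test_on U \<phi> \<Longrightarrow> (\<integral>z. of_real (h z) * Levi \<phi> z \<partial>lborel) = 0"
  shows "ddc_closed U T"
  unfolding ddc_closed_def
proof (intro allI impI)
  fix \<phi> :: "C2 \<Rightarrow> complex" assume \<phi>: "test_on U \<phi>"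
  have "pairing (ddc \<phi>) z = \<i> / of_real pi * Levi \<phi> z" for z
    by (simp add: pairing_def ddc_def Levi_def sum_distrib_left sum_distrib_right mult_ac)
  then have "T (ddc \<phi>) = - \<i> * (\<integral>z. \<i> / of_real pi * (of_real (h z) * Levi \<phi> z) \<partial>lborel)"
    by (simp add: T_def mult_ac)
  then show "T (ddc \<phi>) = 0" unfolding integral_mult_right_zero assms[OF \<phi>] by simp
qed

lemma T_wedge_eq_0:
  assumes "\<And>z. z \<in> U \<Longrightarrow> (\<Sum>j\<in>UNIV. \<Omega> z $ j * G z $ j) = 0"
  shows "T (wedge_10_01 \<Omega> \<beta>) = 0"
proof -
  have "of_real (h z) * pairing (wedge_10_01 \<Omega> \<beta>) z = 0" for z
  proof (cases "z \<in> quadrant")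
    case True
    have "pairing (wedge_10_01 \<Omega> \<beta>) z
        = (\<Sum>k\<in>UNIV. (\<Sum>j\<in>UNIV. \<Omega> (param (tau z)) $ j * G (param (tau z)) $ j) * \<beta> (param (tau z)) $ k * cnj (G (param (tau z)) $ k))"
      by (simp add: pairing_def wedge_10_01_def UNIV_2 algebra_simps)
    then show ?thesis using assms[OF param_tau_in[OF True]] by simp
  qed (simp add: h_off)
  then show ?thesis unfolding T_def by (simp only:) simp
qed

lemma norm_G_le_sum: "(norm (G (param (tau z))))\<^sup>2 \<le> (\<Sum>j\<in>UNIV. norm (G (param (tau z)) $ j))\<^sup>2"
  unfolding norm_vec_def by (intro power_mono L2_set_le_sum L2_set_nonneg) auto

lemma mass_density_nonneg: "0 \<le> mass_density z"
  using h_nonneg[of z] by (simp add: mass_density_def)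

lemma continuous_on_norm_G: "continuous_on quadrant (\<lambda>z. (norm (G (param (tau z))))\<^sup>2)"
proof -
  have "continuous_on quadrant (\<lambda>z. \<chi> j. G (param (tau z)) $ j)"
    using decays_G unfolding decays_def by (intro continuous_on_vec_lambda) blast
  then show ?thesis by (auto intro!: continuous_intros)
qed

lemma mass_density_measurable: "mass_density \<in> borel_measurable borel"
proof -
  have "(\<lambda>z. h z * (indicator quadrant z *\<^sub>R (norm (G (param (tau z))))\<^sup>2) / pi) \<in> borel_measurable borel"
    by (intro borel_measurable_divide borel_measurable_times h_measurable borel_measurable_const
        borel_measurable_continuous_on_indicator[OF quadrant_measurable continuous_on_norm_G])
  moreover have "(\<lambda>z. h z * (indicator quadrant z *\<^sub>R (norm (G (param (tau z))))\<^sup>2) / pi) = mass_density"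
    using h_off by (auto simp: fun_eq_iff indicator_def mass_density_def simp del: quadrant_iff split_paired_All)
  ultimately show ?thesis by simp
qed

lemma mass_density_integrable: "integrable lborel mass_density"
proof -
  obtain N where N: "0 \<le> N" "\<And>z. z \<in> quadrant \<Longrightarrow> (\<Sum>j\<in>UNIV. norm (G (param (tau z)) $ j))\<^sup>2 \<le> N * edge_decay z"
    using norm_G_bound by blast
  have ib: "integrable lborel (\<lambda>z. (N / pi) * (h z * edge_decay z))" using h_integrable by simp
  have le: "mass_density z \<le> (N / pi) * (h z * edge_decay z)" for z
  proof (cases "z \<in> quadrant")
    case True
    have "h z * (norm (G (param (tau z))))\<^sup>2 \<le> h z * (N * edge_decay z)"
      by (rule mult_left_mono[OF order.trans[OF norm_G_le_sum N(2)[OF True]] h_nonneg])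
    then show ?thesis by (simp add: mass_density_def divide_right_mono mult_ac)
  qed (simp add: h_off mass_density_def)
  show ?thesis
  proof (rule Bochner_Integration.integrable_bound[OF ib])
    show "mass_density \<in> borel_measurable lborel" unfolding measurable_lborel2 by (rule mass_density_measurable)
    show "AE z in lborel. norm (mass_density z) \<le> norm ((N / pi) * (h z * edge_decay z))"
      using mass_density_nonneg by (intro AE_I2) (simp only: real_norm_def abs_of_nonneg order.trans[OF le abs_ge_self])
  qed
qed

lemma measurable_restrict_quadrant:
  "f \<in> measurable borel M \<Longrightarrow> f \<in> measurable (restrict_space lborel quadrant) M"
  by (rule measurable_restrict_space1) simp

lemma measurable_leaf: "(\<lambda>z. param (tau z)) \<in> measurable (restrict_space lborel quadrant) (restrict_space borel U)"
proof (rule measurable_restrict_space2)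
  show "(\<lambda>z. param (tau z)) \<in> space (restrict_space lborel quadrant) \<rightarrow> U"
    using param_tau_in by (auto simp: space_restrict_space)
  have "measurable (restrict_space lborel quadrant) borel = measurable (restrict_space borel quadrant) (borel :: C2 measure)"
    by (rule measurable_cong_sets) (auto simp: sets_restrict_space)
  with borel_measurable_continuous_on_restrict[OF continuous_on_param_tau]
  show "(\<lambda>z. param (tau z)) \<in> borel_measurable (restrict_space lborel quadrant)" by simp
qed

lemma quadrant_in_lborel: "quadrant \<inter> space lborel \<in> sets lborel"
  using quadrant_measurable by simp

lemma mass_measure_\<mu>: "mass_measure U T \<mu>"
  unfolding mass_measure_def
proof (intro conjI allI impI)
  show "space \<mu> = U" by (simp add: \<mu>_def space_restrict_space)
  show "sets \<mu> = sets (restrict_space borel U)" by (simp add: \<mu>_def)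
  let ?M = "restrict_space lborel quadrant"
  let ?D = "density ?M (\<lambda>z. ennreal (mass_density z))"
  have dm: "(\<lambda>z. ennreal (mass_density z)) \<in> borel_measurable ?M"
    by (intro measurable_compose[OF measurable_restrict_quadrant[OF mass_density_measurable]]) simp
  have leafD: "(\<lambda>z. param (tau z)) \<in> measurable ?D (restrict_space borel U)"
    using measurable_leaf by simp
  have fin: "emeasure \<mu> (space \<mu>) < \<infinity>"
  proof -
    have "emeasure \<mu> (space \<mu>) = emeasure ?D (space ?D)"
    proof -
      have "(\<lambda>z. param (tau z)) -` space (restrict_space borel U) \<inter> space ?D = space ?D"
        using measurable_space[OF leafD] by blast
      then show ?thesis
        unfolding \<mu>_def space_distr by (subst emeasure_distr[OF leafD sets.top]) simp
    qed
    also have "\<dots> = (\<integral>\<^sup>+z. ennreal (mass_density z) \<partial>?M)"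
      by (subst emeasure_density[OF dm]) (auto intro!: nn_integral_cong)
    also have "\<dots> = (\<integral>\<^sup>+z. ennreal (mass_density z) * indicator quadrant z \<partial>lborel)"
      by (rule nn_integral_restrict_space[OF quadrant_in_lborel])
    also have "\<dots> \<le> (\<integral>\<^sup>+z. ennreal (norm (mass_density z)) \<partial>lborel)"
      by (intro nn_integral_mono) (auto simp: indicator_def mass_density_nonneg)
    also have "\<dots> < \<infinity>" using mass_density_integrable by (simp add: integrable_iff_bounded)
    finally show ?thesis .
  qed
  show "emeasure \<mu> L < \<infinity>" for L
    by (rule le_less_trans[OF emeasure_space fin])
  fix \<phi> :: "C2 \<Rightarrow> complex" assume \<phi>: "test_on U \<phi>"
  have \<phi>m: "\<phi> \<in> borel_measurable borel"
    by (rule borel_measurable_continuous_onI[OF test_on_imp_continuous[OF \<phi>]])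
  have \<phi>U: "\<phi> \<in> borel_measurable (restrict_space borel U)" by (rule measurable_restrict_space1[OF \<phi>m])
  have "(\<integral>z. \<phi> z \<partial>\<mu>) = (\<integral>z. \<phi> (param (tau z)) \<partial>?D)"
    unfolding \<mu>_def by (rule integral_distr[OF leafD \<phi>U])
  also have "\<dots> = (\<integral>z. mass_density z *\<^sub>R \<phi> (param (tau z)) \<partial>?M)"
    by (rule integral_density)
       (auto intro!: measurable_compose[OF measurable_leaf \<phi>U] measurable_restrict_quadrant mass_density_measurable AE_I2 mass_density_nonneg)
  also have "\<dots> = (\<integral>z. indicator quadrant z *\<^sub>R (mass_density z *\<^sub>R \<phi> (param (tau z))) \<partial>lborel)"
    by (rule integral_restrict_space[OF quadrant_in_lborel])
  also have "\<dots> = (\<integral>z. of_real (mass_density z) * \<phi> (param (tau z)) \<partial>lborel)"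
    by (rule Bochner_Integration.integral_cong)
       (use h_off in \<open>auto simp: indicator_def mass_density_def scaleR_conv_of_real simp del: quadrant_iff split_paired_All\<close>)
  finally have rhs: "(\<integral>z. \<phi> z \<partial>\<mu>) = (\<integral>z. of_real (mass_density z) * \<phi> (param (tau z)) \<partial>lborel)" .
  have "of_real (h z) * pairing (form_scale \<phi> (ddc (\<lambda>z. of_real ((norm z)\<^sup>2)))) z
      = \<i> * (of_real (mass_density z) * \<phi> (param (tau z)))" for z
  proof -
    have n: "complex_of_real ((norm (G (param (tau z))))\<^sup>2) = (\<Sum>k\<in>UNIV. G (param (tau z)) $ k * cnj (G (param (tau z)) $ k))"
      by (simp add: norm_vec_def L2_set_def UNIV_2 complex_norm_square[symmetric] sum_nonneg)
    have "pairing (form_scale \<phi> (ddc (\<lambda>z. of_real ((norm z)\<^sup>2)))) z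
      = (\<i> / of_real pi) * \<phi> (param (tau z)) * of_real ((norm (G (param (tau z))))\<^sup>2)"
      unfolding n by (simp add: pairing_def form_scale_def ddc_norm_squared UNIV_2 algebra_simps del: of_real_power)
    then show ?thesis by (simp add: mass_density_def mult_ac)
  qed
  then have "T (form_scale \<phi> (ddc (\<lambda>z. of_real ((norm z)\<^sup>2))))
      = - \<i> * (\<integral>z. \<i> * (of_real (mass_density z) * \<phi> (param (tau z))) \<partial>lborel)"
    by (simp add: T_def)
  also have "\<dots> = (\<integral>z. \<phi> z \<partial>\<mu>)" unfolding integral_mult_right_zero rhs by simp
  finally show "T (form_scale \<phi> (ddc (\<lambda>z. of_real ((norm z)\<^sup>2)))) = (\<integral>z. \<phi> z \<partial>\<mu>)" .
qed

lemma null_set_\<mu>: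
  assumes "S \<in> sets (restrict_space borel U)" "\<And>z. z \<in> quadrant \<Longrightarrow> param (tau z) \<notin> S"
  shows "S \<in> null_sets \<mu>"
proof -
  let ?D = "density (restrict_space lborel quadrant) (\<lambda>z. ennreal (mass_density z))"
  have leafD: "(\<lambda>z. param (tau z)) \<in> measurable ?D (restrict_space borel U)" using measurable_leaf by simp
  have "(\<lambda>z. param (tau z)) -` S \<inter> space ?D = {}" using assms(2) by (auto simp: space_restrict_space)
  then have "emeasure \<mu> S = 0" unfolding \<mu>_def by (simp add: emeasure_distr[OF leafD assms(1)])
  then show ?thesis using assms(1) by (simp add: null_sets_def \<mu>_def)
qed

lemma emeasure_\<mu>_ge:
  assumes S: "S \<in> sets (restrict_space borel U)" and R: "R \<in> sets borel" "R \<subseteq> quadrant"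
    and RS: "\<And>z. z \<in> R \<Longrightarrow> param (tau z) \<in> S" and a: "\<And>z. z \<in> R \<Longrightarrow> a \<le> mass_density z"
  shows "ennreal a * emeasure lborel R \<le> emeasure \<mu> S"
proof -
  let ?M = "restrict_space lborel quadrant"
  let ?D = "density ?M (\<lambda>z. ennreal (mass_density z))"
  have dm: "(\<lambda>z. ennreal (mass_density z)) \<in> borel_measurable ?M"
    by (intro measurable_compose[OF measurable_restrict_quadrant[OF mass_density_measurable]]) simp
  have leafD: "(\<lambda>z. param (tau z)) \<in> measurable ?D (restrict_space borel U)" using measurable_leaf by simp
  let ?V = "(\<lambda>z. param (tau z)) -` S \<inter> space ?D"
  have V: "?V \<in> sets ?M" using measurable_sets[OF leafD S] by simp
  have "ennreal a * emeasure lborel R = (\<integral>\<^sup>+z. ennreal a * indicator R z \<partial>lborel)"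
    using R by (simp add: nn_integral_cmult_indicator)
  also have "\<dots> \<le> (\<integral>\<^sup>+z. (ennreal (mass_density z) * indicator ?V z) * indicator quadrant z \<partial>lborel)"
  proof (rule nn_integral_mono)
    fix z
    show "ennreal a * indicator R z \<le> (ennreal (mass_density z) * indicator ?V z) * indicator quadrant z"
    proof (cases "z \<in> R")
      case True
      then have "z \<in> quadrant" "z \<in> ?V" using R(2) RS by (auto simp: space_restrict_space)
      then show ?thesis using True a[OF True] by (simp add: ennreal_leI)
    qed simp
  qed
  also have "\<dots> = (\<integral>\<^sup>+z. ennreal (mass_density z) * indicator ?V z \<partial>?M)"
    by (rule nn_integral_restrict_space[OF quadrant_in_lborel, symmetric])
  also have "\<dots> = emeasure ?D ?V" by (rule emeasure_density[OF dm V, symmetric])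
  also have "\<dots> = emeasure \<mu> S" unfolding \<mu>_def by (rule emeasure_distr[OF leafD S, symmetric])
  finally show ?thesis .
qed

text \<open>The part of the leaf inside the bidisc of radius \<open>\<delta>\<close> is a quadrant with vertex at distance about \<open>ln (1 / \<delta>)\<close>.
  Where \<open>h\<close> is comparable to \<open>1 / A\<close>, a strip of width \<open>1\<close> and length \<open>A\<close> along one edge carries mass
  comparable to \<open>\<delta>\<^sup>2\<close>.\<close>

lemma mass_polydisc_ge:
  assumes g0: "0 < g0"
    and near: "\<And>w. w \<in> polydisc 1 \<Longrightarrow> norm (K w) < r \<Longrightarrow> norm (linear_field \<eta> w) \<le> g0 * norm (G (K w))"
    and p: "1 < p" and c: "0 \<le> c" and low: "\<And>z. z \<in> quadrant \<Longrightarrow> c * weight p A z \<le> h z"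
    and \<delta>: "0 < \<delta>" "\<delta> < r" "\<delta> < 4 * C" and A: "2 * ln (4 * C / \<delta>) + 1 \<le> A" and sub: "polydisc \<delta> \<subseteq> U"
  shows "ennreal (c * (3 powr (- p) * exp (- 2) / (16 * C\<^sup>2 * g0\<^sup>2 * pi)) * \<delta>\<^sup>2) \<le> emeasure \<mu> (polydisc \<delta>)"
proof -
  define s where "s = ln (4 * C / \<delta>)"
  have s: "0 < s" using \<delta> by (simp add: s_def)
  have es: "exp (- s) = \<delta> / (4 * C)" using \<delta> C_pos by (simp add: s_def exp_minus)
  have A1: "1 \<le> A" "2 * s + 1 \<le> A" using A s by (auto simp: s_def)
  define R where "R = {s..s+1} \<times> {s..s+A}"
  have RQ: "R \<subseteq> quadrant" using s by (auto simp: R_def)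
  have Rm: "R \<in> sets borel" unfolding R_def by (intro borel_closed closed_Times) auto
  have normP: "norm (param (tau z)) < \<delta>" if z: "z \<in> R" for z
  proof -
    have "exp (- fst z) \<le> exp (- s)" "exp (- snd z) \<le> exp (- s)" using z by (auto simp: R_def)
    then have "edge_decay z \<le> exp (- s) + exp (- s)" unfolding edge_decay_def by (rule add_mono)
    then have "C * edge_decay z \<le> C * (2 * exp (- s))" using C_pos by (intro mult_left_mono) auto
    also have "\<dots> = \<delta> / 2" using C_pos by (simp add: es)
    finally show ?thesis using norm_param_tau[of z] z RQ \<delta>(1) by (auto intro: le_less_trans)
  qed
  have inS: "param (tau z) \<in> polydisc \<delta>" if "z \<in> R" for z
    using normP[OF that] Finite_Cartesian_Product.norm_nth_le[of "param (tau z)"]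
    unfolding polydisc_def by (auto intro: le_less_trans)
  define a where "a = c * (3 powr (- p) / A) * (exp (- 2) * (\<delta>\<^sup>2 / (16 * C\<^sup>2)) / g0\<^sup>2) / pi"
  have a: "a \<le> mass_density z" if z: "z \<in> R" for z
  proof -
    have zQ: "z \<in> quadrant" using z RQ by blast
    have xy: "s \<le> fst z" "fst z \<le> s + 1" "s \<le> snd z" "snd z \<le> s + A" using z by (auto simp: R_def)
    have "3 powr (- p) / A = A powr (p - 1) * (3 * A) powr (- p)"
    proof -
      have "A powr (p - 1) * (3 * A) powr (- p) = 3 powr (- p) * (A powr (p - 1) * A powr (- p))"
        using A1 by (simp add: powr_mult)
      also have "A powr (p - 1) * A powr (- p) = 1 / A"
        using A1 by (simp add: powr_add[symmetric] powr_neg_one)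
      finally show ?thesis by simp
    qed
    also have "\<dots> \<le> weight p A z"
      unfolding weight_def using xy A1 s p by (intro mult_left_mono powr_mono2') auto
    finally have hz: "c * (3 powr (- p) / A) \<le> h z"
      using mult_left_mono[OF _ c] low[OF zQ] order.trans by blast
    have "norm (linear_field \<eta> (linear_leaf (tau z))) \<le> g0 * norm (G (param (tau z)))"
      unfolding param_def using normP[OF z] \<delta>(2)
      by (intro near linear_leaf_tau_in_polydisc[OF zQ]) (simp add: param_def)
    moreover have "exp (- fst z) \<le> norm (linear_field \<eta> (linear_leaf (tau z)))"
      using Finite_Cartesian_Product.norm_nth_le[of "linear_field \<eta> (linear_leaf (tau z))" 2]
      by (simp add: linear_field_def norm_linear_leaf(2) Re_tau)
    ultimately have "exp (- fst z) \<le> g0 * norm (G (param (tau z)))" by linarith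
    moreover have "exp (- s - 1) \<le> exp (- fst z)" using xy by simp
    ultimately have "exp (- s - 1) \<le> g0 * norm (G (param (tau z)))" by linarith
    then have "exp (- s - 1) / g0 \<le> norm (G (param (tau z)))" using g0 by (simp add: divide_le_eq mult.commute)
    then have "(exp (- s - 1) / g0)\<^sup>2 \<le> (norm (G (param (tau z))))\<^sup>2" using g0 by (intro power_mono) auto
    moreover have "(exp (- s - 1) / g0)\<^sup>2 = exp (- 2) * (\<delta>\<^sup>2 / (16 * C\<^sup>2)) / g0\<^sup>2"
    proof -
      have "exp (- s - 1) = exp (- s) * exp (- 1)" by (simp add: exp_add[symmetric])
      moreover have "(exp (- 1))\<^sup>2 = exp (- 2 :: real)" by (simp add: power2_eq_square exp_add[symmetric])
      ultimately show ?thesis by (simp add: es power_divide power_mult_distrib mult_ac)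
    qed
    ultimately have "exp (- 2) * (\<delta>\<^sup>2 / (16 * C\<^sup>2)) / g0\<^sup>2 \<le> (norm (G (param (tau z))))\<^sup>2" by simp
    from mult_mono[OF hz this h_nonneg]
    have "c * (3 powr (- p) / A) * (exp (- 2) * (\<delta>\<^sup>2 / (16 * C\<^sup>2)) / g0\<^sup>2) \<le> h z * (norm (G (param (tau z))))\<^sup>2" by simp
    then show ?thesis unfolding a_def mass_density_def by (intro divide_right_mono) auto
  qed
  have eR: "emeasure lborel R = ennreal A"
  proof -
    have "emeasure lborel R = emeasure lborel {s..s+1} * emeasure lborel {s..s+A}"
      unfolding R_def lborel_prod[symmetric] by (rule lborel.emeasure_pair_measure_Times) auto
    then show ?thesis using A1 by simp
  qed
  have S: "polydisc \<delta> \<in> sets (restrict_space borel U)"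
    unfolding sets_restrict_space using sub open_polydisc[of \<delta>]
    by (intro image_eqI[of _ _ "polydisc \<delta>"]) auto
  have a0: "0 \<le> a" using c A1 by (simp add: a_def)
  have "ennreal a * ennreal A \<le> emeasure \<mu> (polydisc \<delta>)"
    using emeasure_\<mu>_ge[OF S Rm RQ inS a] by (simp add: eR)
  moreover have "ennreal a * ennreal A = ennreal (a * A)" using a0 A1 by (simp add: ennreal_mult)
  moreover have "a * A = c * (3 powr (- p) * exp (- 2) / (16 * C\<^sup>2 * g0\<^sup>2 * pi)) * \<delta>\<^sup>2"
    using A1 g0 C_pos by (simp add: a_def field_simps)
  ultimately show ?thesis by simp
qed

end

section \<open>Prescribing the rate of decay\<close>

text \<open>By continuity \<open>\<epsilon>\<close> is at most \<open>b n\<close> on some interval \<open>(0, d n]\<close>. These intervals may be chosen to shrink to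
  \<open>0\<close>, and then every \<open>\<delta>\<close> has a first \<open>n\<close> with \<open>d (n + 1) < \<delta>\<close>.\<close>

lemma scales_for_modulus:
  fixes \<epsilon> :: "real \<Rightarrow> real" and b :: "nat \<Rightarrow> real"
  assumes "continuous_on {0..1} \<epsilon>" "\<epsilon> 0 = 0" and b: "\<And>n. 0 < b n"
  obtains d :: "nat \<Rightarrow> real" where "\<And>n. 0 < d n" "d 0 \<le> 1"
    "\<And>\<delta>. 0 < \<delta> \<Longrightarrow> \<delta> \<le> d 0 \<Longrightarrow> \<exists>n. d (Suc n) < \<delta> \<and> \<epsilon> \<delta> \<le> b n"
proof -
  have "\<exists>e. 0 < e \<and> e \<le> 1 / (real n + 1) \<and> (\<forall>\<delta>. 0 < \<delta> \<and> \<delta> \<le> e \<longrightarrow> \<epsilon> \<delta> \<le> b n)" for n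
  proof -
    have "(\<epsilon> \<longlongrightarrow> 0) (at 0 within {0..1})"
      using assms(1,2) unfolding continuous_on_def by (metis atLeastAtMost_iff order_refl zero_le_one)
    then have "\<forall>\<^sub>F x in at 0 within {0..1}. \<epsilon> x < b n"
      using b[of n] by (simp add: order_tendsto_iff)
    then obtain e where e: "0 < e" "\<And>x. x \<in> {0..1} \<Longrightarrow> x \<noteq> 0 \<Longrightarrow> dist x 0 < e \<Longrightarrow> \<epsilon> x < b n"
      unfolding eventually_at by blast
    have "0 < min (e / 2) (1 / (real n + 1))" using e(1) by simp
    moreover have "\<epsilon> \<delta> \<le> b n" if "0 < \<delta>" "\<delta> \<le> min (e / 2) (1 / (real n + 1))" for \<delta>
    proof -
      have "1 / (real n + 1) \<le> 1" by simp
      then have "\<delta> \<le> 1" using that(2) by linarith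
      then show ?thesis using e(2)[of \<delta>] e(1) that by (simp add: less_imp_le)
    qed
    ultimately show ?thesis by (intro exI[of _ "min (e / 2) (1 / (real n + 1))"]) auto
  qed
  then obtain d where d: "\<And>n. 0 < d n" "\<And>n. d n \<le> 1 / (real n + 1)" "\<And>n \<delta>. 0 < \<delta> \<Longrightarrow> \<delta> \<le> d n \<Longrightarrow> \<epsilon> \<delta> \<le> b n"
    by metis
  show thesis
  proof (rule that[OF d(1)])
    show "d 0 \<le> 1" using d(2)[of 0] by simp
    fix \<delta> assume \<delta>: "0 < \<delta>" "\<delta> \<le> d 0"
    obtain m where m: "1 / real (Suc m) < \<delta>" using nat_approx_posE[OF \<delta>(1)] by blast
    have "1 / (real (Suc m) + 1) \<le> 1 / real (Suc m)" by (rule divide_left_mono) auto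
    then have ex: "\<exists>n. d (Suc n) < \<delta>" using m d(2)[of "Suc m"] by (intro exI[of _ m]) linarith
    define n where "n = (LEAST n. d (Suc n) < \<delta>)"
    have "d (Suc n) < \<delta>" unfolding n_def by (rule LeastI_ex[OF ex])
    moreover have "\<delta> \<le> d n"
    proof (cases n)
      case (Suc k)
      then have "\<not> d (Suc k) < \<delta>" unfolding n_def by (intro not_less_Least) simp
      then show ?thesis using Suc by simp
    qed (use \<delta> in simp)
    ultimately show "\<exists>n. d (Suc n) < \<delta> \<and> \<epsilon> \<delta> \<le> b n" using d(3)[OF \<delta>(1)] by blast
  qed
qed

theorem theorem1p1:
  fixes V :: "(complex^2) set" and F :: "complex^2 \<Rightarrow> complex^2" and \<epsilon> :: "real \<Rightarrow> real"
  assumes "foliation_field V F"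
    and "hyperbolic_singularity V F"
    and "continuous_on {0..1} \<epsilon>"
    and "\<And>x. x \<in> {0..1} \<Longrightarrow> 0 \<le> \<epsilon> x"
    and "\<epsilon> 0 = 0"
  shows "\<exists>\<delta>\<^sub>0 U T \<mu>. 0 < \<delta>\<^sub>0 \<and> \<delta>\<^sub>0 \<le> 1 \<and>
           open U \<and> polydisc \<delta>\<^sub>0 \<subseteq> U \<and> U \<subseteq> V \<and>
           positive_current U T \<and> ddc_closed U T \<and> directed_by U F T \<and>
           mass_measure U T \<mu> \<and> no_mass_on_separatrices V F U \<mu> \<and>
           (\<forall>\<delta>. 0 < \<delta> \<and> \<delta> < \<delta>\<^sub>0 \<longrightarrow> emeasure \<mu> (polydisc \<delta>) \<ge> ennreal (\<epsilon> \<delta> * \<delta>\<^sup>2))"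
proof -
  obtain K G \<eta> C where \<eta>: "Im \<eta> \<noteq> 0" and hK2: "holomorphic_map_on (polydisc 2) K" and K0: "K 0 = 0"
    and inj2: "inj_on K (polydisc 2)" and KV: "K ` polydisc 2 \<subseteq> V" and sf2: "same_foliation (K ` polydisc 2) F G"
    and C: "0 < C" and Kb: "\<And>w. w \<in> polydisc 2 \<Longrightarrow> norm (K w) \<le> C * norm w"
    and nondeg2: "\<And>w v. w \<in> polydisc 2 \<Longrightarrow> frechet_derivative K (at w) v = 0 \<Longrightarrow> v = 0"
    and field2: "\<And>w. w \<in> polydisc 2 \<Longrightarrow> frechet_derivative K (at w) (linear_field \<eta> w) = G (K w)"
    by (rule linearizing_parametrization[OF assms(2)], rule that)
  interpret leaf \<eta> K G C
  proof (rule leaf.intro)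
    show "norm (K w) \<le> C * norm w" if "w \<in> polydisc 2" for w by (rule Kb[OF that])
    show "frechet_derivative K (at w) (linear_field \<eta> w) = G (K w)" if "w \<in> polydisc 2" for w
      by (rule field2[OF that])
  qed (rule \<eta> hK2 inj2 C)+
  define D where "D = polydisc 1"
  define U where "U = K ` D"
  define \<Phi> where "\<Phi> = inv_into D K"
  have D2: "D \<subseteq> polydisc 2" by (auto simp: D_def polydisc_def)
  have oD: "open D" unfolding D_def by (rule open_polydisc)
  have D0: "0 \<in> D" by (simp add: D_def polydisc_def)
  have hK: "holomorphic_map_on D K" by (rule holomorphic_map_on_subset[OF hK2 D2])
  have inj: "inj_on K D" by (rule inj_on_subset[OF inj2 D2])
  have nondeg: "v = 0" if "w \<in> D" "frechet_derivative K (at w) v = 0" for w v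
    using nondeg2 that D2 by blast
  have oU: "open U"
    unfolding U_def by (rule holomorphic_inverse(1)[OF oD hK inj nondeg])
  have h\<Phi>: "holomorphic_map_on U \<Phi>"
    unfolding U_def \<Phi>_def by (rule holomorphic_inverse(2)[OF oD hK inj nondeg])
  have D\<Phi>: "frechet_derivative \<Phi> (at (K w)) (frechet_derivative K (at w) v) = v" if "w \<in> D" for w v
    unfolding \<Phi>_def by (rule holomorphic_inverse(3)[OF oD hK inj nondeg that])
  have U0: "0 \<in> U" unfolding U_def using D0 K0 by (metis imageI)
  have UV: "U \<subseteq> V" using KV D2 unfolding U_def by blast
  have sub2: "U \<subseteq> K ` polydisc 2" using D2 unfolding U_def by blast
  have sf: "same_foliation U F G"
    using sf2 sub2 unfolding same_foliation_def by (auto intro: holomorphic_map_on_subset)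
  have \<Phi>K: "\<Phi> (K w) = w" if "w \<in> D" for w using that inj by (simp add: \<Phi>_def)
  have K\<Phi>: "K (\<Phi> z) = z" "\<Phi> z \<in> D" if "z \<in> U" for z
    using that \<Phi>K unfolding U_def by auto
  have \<Phi>U: "\<Phi> ` U = D" using \<Phi>K K\<Phi>(2) unfolding U_def by (force simp: image_image)
  have inj\<Phi>: "inj_on \<Phi> U" by (rule inj_on_inverseI[where g=K]) (rule K\<Phi>(1))
  have inv\<Phi>: "inv_into U \<Phi> w = K w" if "w \<in> D" for w
    using inv_into_f_f[OF inj\<Phi>, of "K w"] \<Phi>K[OF that] that by (simp add: U_def)
  have coords: "linearizing_coords V F U \<Phi>"
    unfolding linearizing_coords_def centered_coords_def
  proof (intro conjI exI ballI)
    show "\<Phi> 0 = 0" using \<Phi>K[OF D0] K0 by simp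
    show "holomorphic_map_on (\<Phi> ` U) (inv_into U \<Phi>)"
      unfolding \<Phi>U by (rule holomorphic_map_on_cong_open[OF hK oD]) (simp add: inv\<Phi>)
    show "in_coords \<Phi> G z = linear_field \<eta> (\<Phi> z)" if z: "z \<in> U" for z
    proof -
      have "in_coords \<Phi> G (K (\<Phi> z)) = linear_field \<eta> (\<Phi> z)"
        unfolding in_coords_def using field2[of "\<Phi> z"] D2 K\<Phi>(2)[OF z] D\<Phi>[OF K\<Phi>(2)[OF z], of "linear_field \<eta> (\<Phi> z)"]
        by (simp add: subset_iff)
      then show ?thesis by (simp add: K\<Phi>(1)[OF z])
    qed
  qed (use oU U0 UV inj\<Phi> h\<Phi> sf \<eta> \<Phi>U oD in auto)
  \<comment> \<open>Near \<open>0\<close> the coordinates have bounded derivative, which bounds the tangent field from below.\<close>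
  obtain r where r: "0 < r" and rU: "ball 0 (2 * r) \<subseteq> U"
  proof -
    obtain e where "0 < e" "ball 0 e \<subseteq> U" using oU U0 open_contains_ball by blast
    then show thesis using that[of "e / 2"] by simp
  qed
  define g0 where "g0 = 8 / r"
  have g0: "0 < g0" using r by (simp add: g0_def)
  have near: "norm (linear_field \<eta> w) \<le> g0 * norm (G (K w))" if w: "w \<in> polydisc 1" and n: "norm (K w) < r" for w
  proof -
    have wD: "w \<in> D" using w by (simp add: D_def)
    have sub: "cball (K w) r \<subseteq> U"
    proof
      fix x assume "x \<in> cball (K w) r"
      then have "norm x < 2 * r" using n norm_triangle_ineq2[of x "K w"] by (simp add: dist_norm norm_minus_commute)
      then show "x \<in> U" using rU by auto
    qed
    have KwU: "K w \<in> U" using wD by (simp add: U_def)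
    have est: "norm (frechet_derivative \<Phi> (at (K w)) v $ i) \<le> 4 * norm v / r" for v i
      unfolding frechet_derivative_nth[OF h\<Phi> KwU]
    proof (rule cdiff_on_Cauchy_estimate[OF _ sub r])
      show "cdiff_on U (\<lambda>z. \<Phi> z $ i)" using h\<Phi> by (simp add: holomorphic_map_on_iff)
      fix z assume "z \<in> cball (K w) r"
      then have "\<Phi> z \<in> polydisc 2" using sub K\<Phi>(2) D2 by blast
      from norm_less_if_polydisc[OF this] Finite_Cartesian_Product.norm_nth_le[of "\<Phi> z" i]
      show "norm (\<Phi> z $ i) \<le> 4" by linarith
    qed
    have "linear_field \<eta> w = frechet_derivative \<Phi> (at (K w)) (G (K w))"
      using D\<Phi>[OF wD, of "linear_field \<eta> w"] field2[of w] wD D2 by (simp add: subset_iff)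
    then have "norm (linear_field \<eta> w) \<le> CARD(2) * (4 * norm (G (K w)) / r)"
      using norm_le_card_mult[OF est] by metis
    then show ?thesis by (simp add: g0_def)
  qed
  obtain p c where p: "1 < p" and c: "0 < c"
    and density: "\<forall>A. (\<forall>n::nat. 1 \<le> A n) \<longrightarrow>
      (\<exists>h. (\<forall>z. 0 \<le> h z) \<and> (\<forall>z. z \<notin> quadrant \<longrightarrow> h z = 0) \<and> h \<in> borel_measurable borel \<and>
        integrable lborel (\<lambda>z. h z * edge_decay z) \<and>
        (\<forall>\<phi>. test_on (K ` polydisc 1) \<phi> \<longrightarrow> (\<integral>z. of_real (h z) * Levi \<phi> z \<partial>lborel) = 0) \<and>
        (\<forall>n. \<forall>z\<in>quadrant. c / 2 ^ n * weight p (A n) z \<le> h z))"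
    by (rule harmonic_density, rule that)
  define \<kappa> where "\<kappa> = 3 powr (- p) * exp (- 2) / (16 * C\<^sup>2 * g0\<^sup>2 * pi)"
  have \<kappa>: "0 < \<kappa>" using C g0 by (simp add: \<kappa>_def)
  have pos: "0 < c / 2 ^ n * \<kappa>" for n :: nat using c \<kappa> by simp
  obtain d where d: "\<And>n. 0 < d n" "d 0 \<le> 1"
    "\<And>\<delta>. 0 < \<delta> \<Longrightarrow> \<delta> \<le> d 0 \<Longrightarrow> \<exists>n. d (Suc n) < \<delta> \<and> \<epsilon> \<delta> \<le> c / 2 ^ n * \<kappa>"
    by (rule scales_for_modulus[OF assms(3,5) pos], rule that)
  \<comment> \<open>The \<open>n\<close>-th kernel has to be effective for all radii above \<open>d (n + 1)\<close>.\<close>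
  define A where "A n = max 1 (2 * ln (4 * C / d (Suc n)) + 1)" for n
  have A1: "1 \<le> A n" for n by (simp add: A_def)
  have "\<forall>n. 1 \<le> A n" using A1 by blast
  from density[THEN spec, THEN mp, OF this]
  obtain h where hh: "(\<forall>z. 0 \<le> h z) \<and> (\<forall>z. z \<notin> quadrant \<longrightarrow> h z = 0) \<and> h \<in> borel_measurable borel \<and>
        integrable lborel (\<lambda>z. h z * edge_decay z) \<and>
        (\<forall>\<phi>. test_on (K ` polydisc 1) \<phi> \<longrightarrow> (\<integral>z. of_real (h z) * Levi \<phi> z \<partial>lborel) = 0) \<and>
        (\<forall>n. \<forall>z\<in>quadrant. c / 2 ^ n * weight p (A n) z \<le> h z)"
    by (rule exE)
  note h = hh[THEN conjunct1, rule_format] hh[THEN conjunct2, THEN conjunct1, rule_format]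
    hh[THEN conjunct2, THEN conjunct2, THEN conjunct1]
    hh[THEN conjunct2, THEN conjunct2, THEN conjunct2, THEN conjunct1]
    hh[THEN conjunct2, THEN conjunct2, THEN conjunct2, THEN conjunct2, THEN conjunct1, rule_format]
    hh[THEN conjunct2, THEN conjunct2, THEN conjunct2, THEN conjunct2, THEN conjunct2, rule_format]
  interpret leaf_density \<eta> K G C h 
  proof (rule leaf_density.intro[OF leaf_axioms leaf_density_axioms.intro])
    show "0 \<le> h z" for z by (rule h(1))
    show "h z = 0" if "z \<notin> quadrant" for z by (rule h(2)[OF that])
  qed (rule h(3) h(4))+
  have UD: "K ` polydisc 1 = U" by (simp add: U_def D_def)
  obtain e where e: "0 < e" "ball 0 e \<subseteq> U" using oU U0 open_contains_ball by blast
  define \<delta>0 where "\<delta>0 = min (d 0) (min r (min (4 * C) (e / 2)))"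
  have \<delta>0: "0 < \<delta>0" "\<delta>0 \<le> d 0" "\<delta>0 \<le> r" "\<delta>0 \<le> 4 * C" "\<delta>0 \<le> e / 2"
    using d(1)[of 0] r C e(1) by (auto simp: \<delta>0_def)
  have pd: "polydisc \<delta> \<subseteq> U" if "\<delta> \<le> \<delta>0" for \<delta>
  proof
    fix z assume "z \<in> polydisc \<delta>"
    then have "norm (z $ 1) < e / 2" "norm (z $ 2) < e / 2" using that \<delta>0(5) by (auto simp: polydisc_def)
    then have "norm z < e" using norm_le_add_coordinates[of z] by simp
    then show "z \<in> U" using e(2) by auto
  qed
  have positive: "positive_current U T" using positive_T by (simp add: UD)
  have closed: "ddc_closed U T" using ddc_closed_T[OF h(5)] by (simp add: UD)
  have mass: "mass_measure U T \<mu>" using mass_measure_\<mu> by (simp add: UD)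
  have directed: "directed_by U F T"
    unfolding directed_by_def
  proof (intro exI conjI ballI allI impI)
    let ?\<Omega> = "\<lambda>z. vector [- F z $ 2, F z $ 1] :: complex^2"
    have hF: "holomorphic_map_on U F"
      using assms(1) UV unfolding foliation_field_def by (auto intro: holomorphic_map_on_subset)
    then have F: "cdiff_on U (\<lambda>z. F z $ i)" for i by (simp add: holomorphic_map_on_iff)
    have "cdiff_on U (\<lambda>z. - F z $ 2)" using cdiff_on_diff[OF cdiff_on_const F, of 0 2] by simp
    then show "holomorphic_map_on U ?\<Omega>"
      unfolding holomorphic_map_on_iff using F[of 1] by (simp add: forall_2)
    show "?\<Omega> z \<noteq> 0" if "z \<in> U - {0}" for z
    proof
      assume "?\<Omega> z = 0"
      then have "?\<Omega> z $ 1 = 0" "?\<Omega> z $ 2 = 0" by simp_all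
      then have "F z = 0" by (simp add: vec_eq_iff forall_2)
      moreover have "F z \<noteq> 0" using sf that unfolding same_foliation_def by blast
      ultimately show False by blast
    qed
    show "?\<Omega> z $ 1 * F z $ 1 + ?\<Omega> z $ 2 * F z $ 2 = 0" for z by simp
    show "T (wedge_10_01 ?\<Omega> \<beta>) = 0" for \<beta>
    proof (rule T_wedge_eq_0)
      fix z assume "z \<in> K ` polydisc 1"
      then have "z \<in> U" by (simp add: UD)
      then have "F z $ 1 * G z $ 2 = F z $ 2 * G z $ 1"
        using sf unfolding same_foliation_def by (cases "z = 0") auto
      then show "(\<Sum>j\<in>UNIV. ?\<Omega> z $ j * G z $ j) = 0" by (simp add: UNIV_2)
    qed
  qed
  have nomass: "no_mass_on_separatrices V F U \<mu>"
    unfolding no_mass_on_separatrices_def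
  proof (intro exI conjI)
    show "linearizing_coords V F U \<Phi>" by (rule coords)
    show "separatrices U \<Phi> \<inter> U \<in> null_sets \<mu>"
    proof (rule null_set_\<mu>)
      have c\<Phi>: "continuous_on U \<Phi>" by (rule holomorphic_map_on_imp_continuous_on[OF h\<Phi>])
      have "{z \<in> U. \<Phi> z $ i = 0} \<in> sets (restrict_space borel U)" for i
      proof -
        have "(\<lambda>z. \<Phi> z $ i) \<in> borel_measurable (restrict_space borel U)"
          by (intro borel_measurable_continuous_on_restrict continuous_on_component c\<Phi>)
        from measurable_sets[OF this, of "{0}"] show ?thesis
          by (simp add: vimage_def space_restrict_space Int_def conj_commute)
      qed
      then have "separatrices U \<Phi> \<in> sets (restrict_space borel U)" unfolding separatrices_def by blast
      moreover have "separatrices U \<Phi> \<inter> U = separatrices U \<Phi>" unfolding separatrices_def by blast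
      ultimately show "separatrices U \<Phi> \<inter> U \<in> sets (restrict_space borel (K ` polydisc 1))"
        by (simp add: UD)
      fix z assume z: "z \<in> quadrant"
      have "\<Phi> (param (tau z)) = linear_leaf (tau z)"
        unfolding param_def by (rule \<Phi>K) (use linear_leaf_tau_in_polydisc[OF z] in \<open>simp add: D_def\<close>)
      then show "param (tau z) \<notin> separatrices U \<Phi> \<inter> U" by (simp add: separatrices_def linear_leaf_def)
    qed
  qed simp
  have lower: "ennreal (\<epsilon> \<delta> * \<delta>\<^sup>2) \<le> emeasure \<mu> (polydisc \<delta>)" if \<delta>: "0 < \<delta>" "\<delta> < \<delta>0" for \<delta>
  proof -
    obtain n where n: "d (Suc n) < \<delta>" "\<epsilon> \<delta> \<le> c / 2 ^ n * \<kappa>" using d(3)[of \<delta>] \<delta> \<delta>0(2) by auto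
    have "4 * C / \<delta> \<le> 4 * C / d (Suc n)" using n(1) d(1)[of "Suc n"] C by (intro divide_left_mono) auto
    then have "ln (4 * C / \<delta>) \<le> ln (4 * C / d (Suc n))" using C \<delta>(1) by (intro ln_mono) auto
    then have An: "2 * ln (4 * C / \<delta>) + 1 \<le> A n" by (simp add: A_def)
    have "ennreal (\<epsilon> \<delta> * \<delta>\<^sup>2) \<le> ennreal (c / 2 ^ n * \<kappa> * \<delta>\<^sup>2)"
      by (intro ennreal_leI mult_right_mono n(2)) simp
    also have "\<dots> \<le> emeasure \<mu> (polydisc \<delta>)"
      unfolding \<kappa>_def
      by (rule mass_polydisc_ge[OF g0 near p _ h(6) \<delta>(1) _ _ An]) (use \<delta> \<delta>0 c pd[of \<delta>] in \<open>auto simp: UD\<close>)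
    finally show ?thesis .
  qed
  show ?thesis
    using \<delta>0(1,2) d(2) oU pd[of \<delta>0] UV positive closed directed mass nomass lower
    by (intro exI[of _ \<delta>0] exI[of _ U] exI[of _ T] exI[of _ \<mu>]) auto
qed

end
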